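(* Let $P(D)$ be a partial differential operator of order $m$ on $\mathbb{R}^n$ with coefficients in $\widetilde{\mathbb{C}}$ such that $\widetilde{P}$ is invertible in some point of $\mathbb{R}^n$, and let $N(P)$ be the set of all zeros $\zeta\in\widetilde{\mathbb{C}}^n$ of $P$ (i.e. $P(\zeta)=0$ in $\widetilde{\mathbb{C}}$) whose imaginary part $\mathrm{Im}\,\zeta\in\widetilde{\mathbb{R}}^n$ is of log-type. (i) If $P(D)$ is $\mathcal{G}$-hypoelliptic then there exist $c\in\mathbb{R}$ and $a>0$ such that $$\mathrm{v}(|\mathrm{Re}\,\zeta|)\ge c+\mathrm{v}\big(e^{a|\mathrm{Im}\,\zeta|}\big)\qquad\text{for all }\zeta\in N(P).$$ (ii) If $P(D)$ is $\mathcal{G}^\infty$-hypoelliptic then $$\mathrm{v}(|\mathrm{Re}\,\zeta|)\ge0\qquad\text{for all }\zeta\in N(P).$$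
   Context: All nets are indexed by $\varepsilon\in(0,1]$; $O(\cdot)$ is as $\varepsilon\to0$. $\widetilde{\mathbb{C}}$ (resp. $\widetilde{\mathbb{R}}$) is the ring of complex (resp. real) nets that are moderate ($\exists N\in\mathbb{N}$: $|r_\varepsilon|=O(\varepsilon^{-N})$) modulo negligible nets ($\forall q\in\mathbb{N}$: $|r_\varepsilon|=O(\varepsilon^{q})$). The valuation of $r=[(r_\varepsilon)_\varepsilon]$ is $\mathrm{v}(r)=\sup\{b\in\mathbb{R}:|r_\varepsilon|=O(\varepsilon^b)\}$, and $|r|_{\rm e}=e^{-\mathrm{v}(r)}$. A point $\xi\in\widetilde{\mathbb{R}}^n$ is of log-type if it has a representative with $|\xi_\varepsilon|=O(\log(1/\varepsilon))$; then $e^{a|\xi|}:=[(e^{a|\xi_\varepsilon|})_\varepsilon]\in\widetilde{\mathbb{R}}$ is well-defined for $a>0$. $\mathcal{G}(\Omega)$ ($\Omega\subseteq\mathbb{R}^n$ open) is the Colombeau algebra: nets $(u_\varepsilon)_\varepsilon$ in $C^\infty(\Omega)$ with $\forall K\Subset\Omega\,\forall\alpha\,\exists N$: $\sup_K|\partial^\alpha u_\varepsilon|=O(\varepsilon^{-N})$, modulo nets with $\forall K\,\forall\alpha\,\forall q$: $\sup_K|\partial^\alpha u_\varepsilon|=O(\varepsilon^q)$. $\mathcal{G}^\infty(\Omega)\subseteq\mathcal{G}(\Omega)$ is the subalgebra of elements having a representative with $\forall K\,\exists N\,\forall\alpha$: $\sup_K|\partial^\alpha u_\varepsilon|=O(\varepsilon^{-N})$.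 $\mathcal{G}_c(\Omega)$ consists of the elements with compact support (representatives are chosen with supports in one compact set independent of $\varepsilon$). Topology: for $K\Subset\Omega$, $\mathcal{G}_K(\Omega)=\{u\in\mathcal{G}_c(\Omega):\mathrm{supp}\,u\subseteq K\}$ carries the ultra-pseudo-seminorms $e^{-\mathrm{v}_{K,j}(u)}$, $\mathrm{v}_{K,j}(u)=\sup\{b\in\mathbb{R}:\sup_{x\in K',|\alpha|\le j}|\partial^\alpha u_\varepsilon(x)|=O(\varepsilon^b)\}$, with $K'\Subset\Omega$ a compact neighbourhood of $K$ (choice irrelevant); $\mathcal{G}_c(\Omega)$ is the strict inductive limit of the $\mathcal{G}_{K}(\Omega)$; $\widetilde{\mathbb{C}}$ carries $|\cdot|_{\rm e}$. $\mathcal{L}(\mathcal{G}_c(\Omega),\widetilde{\mathbb{C}})$ is the set of continuous $\widetilde{\mathbb{C}}$-linear functionals. Such a $T$ is basic if there is a net $(T_\varepsilon)_\varepsilon$ in $\mathcal{D}'(\Omega)$ such that $\forall K\Subset\Omega\ \exists j,N\in\mathbb{N},c>0,\eta\in(0,1]$ with $|T_\varepsilon(f)|\le c\,\varepsilon^{-N}\sup_{x\in K,|\alpha|\le j}|\partial^\alpha f(x)|$ for all $f\in C^\infty_K(\Omega)$, $\varepsilon\in(0,\eta]$, and $T(u)=[(T_\varepsilon(u_\varepsilon))_\varepsilon]$ for all $u\in\mathcal{G}_c(\Omega)$. $\mathcal{G}(\Omega)$ is embedded in $\mathcal{L}(\mathcal{G}_c(\Omega),\widetilde{\mathbb{C}})$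 by $u\mapsto(v\mapsto\int uv\,dx)$. $\mathrm{sing\,supp}_{\mathcal{G}}T$ (resp. $\mathrm{sing\,supp}_{\mathcal{G}^\infty}T$) is the complement of the set of points $x\in\Omega$ having an open neighbourhood $V$ with $T|_V\in\mathcal{G}(V)$ (resp. $\mathcal{G}^\infty(V)$), where $T|_V$ is the restriction of $T$ to $\mathcal{G}_c(V)$. For $P(D)=\sum_{|\alpha|\le m}c_\alpha D^\alpha$, $D^\alpha=(-i)^{|\alpha|}\partial^\alpha$: $P(\zeta)=\sum c_\alpha\zeta^\alpha$; $P(D)T(u)=T({}^tP(D)u)$, ${}^tP(D)=\sum(-1)^{|\alpha|}c_\alpha D^\alpha$. For representatives $(c_{\alpha,\varepsilon})_\varepsilon$ put $P_\varepsilon(\xi)=\sum c_{\alpha,\varepsilon}\xi^\alpha$, $\widetilde{P_\varepsilon}(\xi)=(\sum_{|\alpha|\le m}|\partial^\alpha P_\varepsilon(\xi)|^2)^{1/2}$, $\widetilde{P}(\xi)=[(\widetilde{P_\varepsilon}(\xi))_\varepsilon]\in\widetilde{\mathbb{R}}$. $P(D)$ is $\mathcal{G}$-hypoelliptic if for every open $\Omega\subseteq\mathbb{R}^n$, $\mathrm{sing\,supp}_{\mathcal{G}}P(D)T=\mathrm{sing\,supp}_{\mathcal{G}}T$ for all basic $T\in\mathcal{L}(\mathcal{G}_c(\Omega),\widetilde{\mathbb{C}})$; $\mathcal{G}^\infty$-hypoelliptic is defined in the same way with $\mathrm{sing\,supp}_{\mathcal{G}^\infty}$. *)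

theory Defs
  imports "HOL-Analysis.Analysis" "HOL-Library.Landau_Symbols"
begin

section \<open>Generalized numbers\<close>

text \<open>Nets are functions of \<open>\<epsilon> :: real\<close>; only the values for \<open>\<epsilon> \<in> {0<..1}\<close> matter, and
  asymptotic conditions are stated along the filter \<^term>\<open>at_right (0::real)\<close>.\<close>

definition moderate_net :: "(real \<Rightarrow> 'a::real_normed_vector) \<Rightarrow> bool" where
  "moderate_net r \<longleftrightarrow>
     (\<exists>N::nat. (\<lambda>\<epsilon>. norm (r \<epsilon>)) \<in> O[at_right 0](\<lambda>\<epsilon>. \<epsilon> powr (- real N)))"

definition negligible_net :: "(real \<Rightarrow> 'a::real_normed_vector) \<Rightarrow> bool" where
  "negligible_net r \<longleftrightarrow>
     (\<forall>q::nat. (\<lambda>\<epsilon>. norm (r \<epsilon>)) \<in> O[at_right 0](\<lambda>\<epsilon>. \<epsilon> powr (real q)))"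

definition gnum_rel :: "(real \<Rightarrow> 'a::real_normed_vector) \<Rightarrow> (real \<Rightarrow> 'a) \<Rightarrow> bool" where
  "gnum_rel r s \<longleftrightarrow> moderate_net r \<and> moderate_net s \<and> negligible_net (\<lambda>\<epsilon>. r \<epsilon> - s \<epsilon>)"

lemma powr_bigo_mono:
  assumes "b \<le> c"
  shows "(\<lambda>\<epsilon>::real. \<epsilon> powr c) \<in> O[at_right 0](\<lambda>\<epsilon>. \<epsilon> powr b)"
proof (rule bigoI[where c = 1])
  have "eventually (\<lambda>\<epsilon>::real. \<epsilon> \<in> {0<..<1}) (at_right 0)"
    by (rule eventually_at_right_real) simp
  then show "\<forall>\<^sub>F \<epsilon> in at_right (0::real). norm (\<epsilon> powr c) \<le> 1 * norm (\<epsilon> powr b)"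
    by eventually_elim (use assms in \<open>auto intro: powr_mono'\<close>)
qed

lemma norm_bigo_weaken:
  assumes "(\<lambda>\<epsilon>. norm (r \<epsilon>)) \<in> O[at_right 0](\<lambda>\<epsilon>::real. \<epsilon> powr c)" "b \<le> c"
  shows "(\<lambda>\<epsilon>. norm (r \<epsilon>)) \<in> O[at_right 0](\<lambda>\<epsilon>. \<epsilon> powr b)"
  using landau_o.big_trans[OF assms(1) powr_bigo_mono[OF assms(2)]] .

lemma norm_add_bigo:
  fixes r s :: "real \<Rightarrow> 'a::real_normed_vector"
  assumes "(\<lambda>\<epsilon>. norm (r \<epsilon>)) \<in> O[F](g)" "(\<lambda>\<epsilon>. norm (s \<epsilon>)) \<in> O[F](g)"
  shows "(\<lambda>\<epsilon>. norm (r \<epsilon> + s \<epsilon>)) \<in> O[F](g :: real \<Rightarrow> real)"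
proof -
  have "(\<lambda>\<epsilon>. norm (r \<epsilon> + s \<epsilon>)) \<in> O[F](\<lambda>\<epsilon>. norm (r \<epsilon>) + norm (s \<epsilon>))"
    by (rule bigoI[where c = 1]) (auto intro!: always_eventually norm_triangle_ineq)
  then show ?thesis
    using sum_in_bigo(1)[OF assms] landau_o.big_trans by blast
qed

lemma norm_mult_bigo:
  fixes r s :: "real \<Rightarrow> 'a::real_normed_field"
  assumes "(\<lambda>\<epsilon>. norm (r \<epsilon>)) \<in> O[at_right 0](\<lambda>\<epsilon>. \<epsilon> powr b)"
    and "(\<lambda>\<epsilon>. norm (s \<epsilon>)) \<in> O[at_right 0](\<lambda>\<epsilon>. \<epsilon> powr c)"
  shows "(\<lambda>\<epsilon>. norm (r \<epsilon> * s \<epsilon>)) \<in> O[at_right 0](\<lambda>\<epsilon>. \<epsilon> powr (b + c))"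
  using landau_o.big.mult[OF assms] by (simp add: norm_mult powr_add)

lemma moderate_net_add:
  assumes "moderate_net r" "moderate_net s"
  shows "moderate_net (\<lambda>\<epsilon>. r \<epsilon> + s \<epsilon>)"
proof -
  obtain M N where
    "(\<lambda>\<epsilon>. norm (r \<epsilon>)) \<in> O[at_right 0](\<lambda>\<epsilon>. \<epsilon> powr (- real M))"
    "(\<lambda>\<epsilon>. norm (s \<epsilon>)) \<in> O[at_right 0](\<lambda>\<epsilon>. \<epsilon> powr (- real N))"
    using assms unfolding moderate_net_def by blast
  then have
    "(\<lambda>\<epsilon>. norm (r \<epsilon>)) \<in> O[at_right 0](\<lambda>\<epsilon>. \<epsilon> powr (- real (max M N)))"
    "(\<lambda>\<epsilon>. norm (s \<epsilon>)) \<in> O[at_right 0](\<lambda>\<epsilon>. \<epsilon> powr (- real (max M N)))"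
    by (auto elim!: norm_bigo_weaken)
  then show ?thesis
    unfolding moderate_net_def by (blast intro: norm_add_bigo)
qed

lemma moderate_net_mult:
  fixes r s :: "real \<Rightarrow> 'a::real_normed_field"
  assumes "moderate_net r" "moderate_net s"
  shows "moderate_net (\<lambda>\<epsilon>. r \<epsilon> * s \<epsilon>)"
proof -
  obtain M N where
    "(\<lambda>\<epsilon>. norm (r \<epsilon>)) \<in> O[at_right 0](\<lambda>\<epsilon>. \<epsilon> powr (- real M))"
    "(\<lambda>\<epsilon>. norm (s \<epsilon>)) \<in> O[at_right 0](\<lambda>\<epsilon>. \<epsilon> powr (- real N))"
    using assms unfolding moderate_net_def by blast
  from norm_mult_bigo[OF this]
  have "(\<lambda>\<epsilon>. norm (r \<epsilon> * s \<epsilon>)) \<in> O[at_right 0](\<lambda>\<epsilon>. \<epsilon> powr (- real (M + N)))"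
    by simp
  then show ?thesis unfolding moderate_net_def by blast
qed

lemma moderate_net_uminus: "moderate_net r \<Longrightarrow> moderate_net (\<lambda>\<epsilon>. - r \<epsilon>)"
  by (simp add: moderate_net_def)

lemma moderate_net_diff:
  "moderate_net r \<Longrightarrow> moderate_net s \<Longrightarrow> moderate_net (\<lambda>\<epsilon>. r \<epsilon> - s \<epsilon>)"
  using moderate_net_add[of r "\<lambda>\<epsilon>. - s \<epsilon>"] moderate_net_uminus[of s] by simp

lemma moderate_net_const: "moderate_net (\<lambda>\<epsilon>. c)"
proof -
  have "(\<lambda>\<epsilon>::real. norm c) \<in> O[at_right 0](\<lambda>\<epsilon>. \<epsilon> powr (- real 0))"
  proof (rule bigoI[where c = "norm c"])
    have "eventually (\<lambda>\<epsilon>::real. \<epsilon> \<in> {0<..<1}) (at_right 0)"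
      by (rule eventually_at_right_real) simp
    then show "\<forall>\<^sub>F \<epsilon> in at_right (0::real). norm (norm c) \<le> norm c * norm (\<epsilon> powr (- real 0))"
      by eventually_elim auto
  qed
  then show ?thesis unfolding moderate_net_def by blast
qed

lemma negligible_net_add:
  "negligible_net r \<Longrightarrow> negligible_net s \<Longrightarrow> negligible_net (\<lambda>\<epsilon>. r \<epsilon> + s \<epsilon>)"
  by (simp add: negligible_net_def norm_add_bigo)

lemma negligible_net_uminus: "negligible_net r \<Longrightarrow> negligible_net (\<lambda>\<epsilon>. - r \<epsilon>)"
  by (simp add: negligible_net_def)

lemma negligible_net_zero: "negligible_net (\<lambda>\<epsilon>. 0)"
  by (simp add: negligible_net_def)

lemma negligible_net_mult:
  fixes r s :: "real \<Rightarrow> 'a::real_normed_field"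
  assumes "moderate_net r" "negligible_net s"
  shows "negligible_net (\<lambda>\<epsilon>. r \<epsilon> * s \<epsilon>)"
  unfolding negligible_net_def
proof
  fix q :: nat
  obtain M where M: "(\<lambda>\<epsilon>. norm (r \<epsilon>)) \<in> O[at_right 0](\<lambda>\<epsilon>. \<epsilon> powr (- real M))"
    using assms(1) unfolding moderate_net_def by blast
  have "(\<lambda>\<epsilon>. norm (s \<epsilon>)) \<in> O[at_right 0](\<lambda>\<epsilon>. \<epsilon> powr (real (M + q)))"
    using assms(2) unfolding negligible_net_def by blast
  from norm_mult_bigo[OF M this]
  show "(\<lambda>\<epsilon>. norm (r \<epsilon> * s \<epsilon>)) \<in> O[at_right 0](\<lambda>\<epsilon>. \<epsilon> powr real q)" by simp
qed

lemma not_negligible_net_one: "\<not> negligible_net (\<lambda>\<epsilon>. 1 :: 'a::real_normed_field)"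
proof
  assume "negligible_net (\<lambda>\<epsilon>. 1 :: 'a)"
  then have "(\<lambda>\<epsilon>::real. norm (1 :: 'a)) \<in> O[at_right 0](\<lambda>\<epsilon>. \<epsilon> powr (real 1))"
    unfolding negligible_net_def by blast
  then have "(\<lambda>\<epsilon>::real. 1 :: real) \<in> O[at_right 0](\<lambda>\<epsilon>. \<epsilon> powr 1)" by simp
  then obtain C where C: "C > 0" "eventually (\<lambda>\<epsilon>::real. 1 \<le> C * norm (\<epsilon> powr 1)) (at_right 0)"
    by (auto elim!: landau_o.bigE)
  have "eventually (\<lambda>\<epsilon>::real. \<epsilon> \<in> {0<..<1 / C}) (at_right 0)"
    by (rule eventually_at_right_real) (use C in simp)
  with C(2) have "eventually (\<lambda>\<epsilon>::real. False) (at_right 0)"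
    by eventually_elim (use C(1) in \<open>auto simp: field_simps\<close>)
  then show False by simp
qed

lemma gnum_rel_refl_iff: "gnum_rel r r \<longleftrightarrow> moderate_net r"
  by (simp add: gnum_rel_def negligible_net_zero)

lemma gnum_rel_sym: "gnum_rel r s \<Longrightarrow> gnum_rel s r"
  using negligible_net_uminus[of "\<lambda>\<epsilon>. r \<epsilon> - s \<epsilon>"] by (simp add: gnum_rel_def)

lemma gnum_rel_trans: "gnum_rel r s \<Longrightarrow> gnum_rel s t \<Longrightarrow> gnum_rel r t"
  using negligible_net_add[of "\<lambda>\<epsilon>. r \<epsilon> - s \<epsilon>" "\<lambda>\<epsilon>. s \<epsilon> - t \<epsilon>"] by (simp add: gnum_rel_def)

text \<open>\<open>complex gnum\<close> and \<open>real gnum\<close> are the rings of generalized complex and real numbers.\<close>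

quotient_type (overloaded) 'a gnum = "real \<Rightarrow> 'a::real_normed_field" / partial: gnum_rel
proof (rule part_equivpI)
  show "\<exists>r :: real \<Rightarrow> 'a. gnum_rel r r"
    using moderate_net_const gnum_rel_refl_iff by blast
  show "symp (gnum_rel :: (real \<Rightarrow> 'a) \<Rightarrow> _)"
    using gnum_rel_sym by (rule sympI)
  show "transp (gnum_rel :: (real \<Rightarrow> 'a) \<Rightarrow> _)"
    using gnum_rel_trans by (rule transpI)
qed

instantiation gnum :: (real_normed_field) comm_ring_1
begin

lift_definition zero_gnum :: "'a gnum" is "\<lambda>\<epsilon>. 0"
  by (simp add: gnum_rel_refl_iff moderate_net_const)

lift_definition one_gnum :: "'a gnum" is "\<lambda>\<epsilon>. 1"
  by (simp add: gnum_rel_refl_iff moderate_net_const)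

lift_definition plus_gnum :: "'a gnum \<Rightarrow> 'a gnum \<Rightarrow> 'a gnum" is "\<lambda>r s \<epsilon>. r \<epsilon> + s \<epsilon>"
  subgoal for r r' s s'
    using negligible_net_add[of "\<lambda>\<epsilon>. r \<epsilon> - r' \<epsilon>" "\<lambda>\<epsilon>. s \<epsilon> - s' \<epsilon>"]
    by (simp add: gnum_rel_def moderate_net_add algebra_simps)
  done

lift_definition uminus_gnum :: "'a gnum \<Rightarrow> 'a gnum" is "\<lambda>r \<epsilon>. - r \<epsilon>"
  subgoal for r r'
    using negligible_net_uminus[of "\<lambda>\<epsilon>. r \<epsilon> - r' \<epsilon>"]
    by (simp add: gnum_rel_def moderate_net_uminus algebra_simps)
  done

lift_definition minus_gnum :: "'a gnum \<Rightarrow> 'a gnum \<Rightarrow> 'a gnum" is "\<lambda>r s \<epsilon>. r \<epsilon> - s \<epsilon>"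
  subgoal for r r' s s'
    using negligible_net_add[of "\<lambda>\<epsilon>. r \<epsilon> - r' \<epsilon>" "\<lambda>\<epsilon>. - (s \<epsilon> - s' \<epsilon>)"]
      negligible_net_uminus[of "\<lambda>\<epsilon>. s \<epsilon> - s' \<epsilon>"]
    by (simp add: gnum_rel_def moderate_net_diff algebra_simps)
  done

lift_definition times_gnum :: "'a gnum \<Rightarrow> 'a gnum \<Rightarrow> 'a gnum" is "\<lambda>r s \<epsilon>. r \<epsilon> * s \<epsilon>"
  subgoal for r r' s s'
    using negligible_net_add[of "\<lambda>\<epsilon>. s \<epsilon> * (r \<epsilon> - r' \<epsilon>)" "\<lambda>\<epsilon>. r' \<epsilon> * (s \<epsilon> - s' \<epsilon>)"]
      negligible_net_mult[of s "\<lambda>\<epsilon>. r \<epsilon> - r' \<epsilon>"] negligible_net_mult[of r' "\<lambda>\<epsilon>. s \<epsilon> - s' \<epsilon>"]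
    by (simp add: gnum_rel_def moderate_net_mult algebra_simps)
  done

instance
proof
  fix a b c :: "'a gnum"
  show "a * b * c = a * (b * c)" "a * b = b * a" "1 * a = a" "(a + b) * c = a * c + b * c"
    "a + b + c = a + (b + c)" "a + b = b + a" "0 + a = a" "- a + a = 0" "a - b = a + - b"
    by (transfer; simp add: gnum_rel_refl_iff algebra_simps moderate_net_add moderate_net_mult
          moderate_net_uminus moderate_net_diff moderate_net_const)+
  show "(0 :: 'a gnum) \<noteq> 1"
    using negligible_net_uminus[of "\<lambda>\<epsilon>. - 1 :: 'a"] not_negligible_net_one[where 'a = 'a]
    by transfer (auto simp: gnum_rel_def)
qed

end

lemma gnum_rel_bigo:
  assumes "gnum_rel r s" "(\<lambda>\<epsilon>. norm (r \<epsilon>)) \<in> O[at_right 0](\<lambda>\<epsilon>. \<epsilon> powr b)"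
  shows "(\<lambda>\<epsilon>. norm (s \<epsilon>)) \<in> O[at_right 0](\<lambda>\<epsilon>. \<epsilon> powr b)"
proof -
  obtain q :: nat where q: "b \<le> real q" using real_arch_simple by blast
  have "(\<lambda>\<epsilon>. norm (s \<epsilon> - r \<epsilon>)) \<in> O[at_right 0](\<lambda>\<epsilon>. \<epsilon> powr (real q))"
    using gnum_rel_sym[OF assms(1)] by (auto simp: gnum_rel_def negligible_net_def)
  from norm_add_bigo[OF norm_bigo_weaken[OF this q] assms(2)] show ?thesis by simp
qed

lift_definition valuation :: "'a::real_normed_field gnum \<Rightarrow> ereal" is
  "\<lambda>r. Sup {ereal b | b. (\<lambda>\<epsilon>. norm (r \<epsilon>)) \<in> O[at_right 0](\<lambda>\<epsilon>. \<epsilon> powr b)}"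
proof -
  fix r s :: "real \<Rightarrow> 'a"
  assume "gnum_rel r s"
  then have "(\<lambda>\<epsilon>. norm (r \<epsilon>)) \<in> O[at_right 0](\<lambda>\<epsilon>. \<epsilon> powr b) \<longleftrightarrow>
      (\<lambda>\<epsilon>. norm (s \<epsilon>)) \<in> O[at_right 0](\<lambda>\<epsilon>. \<epsilon> powr b)" for b
    using gnum_rel_bigo gnum_rel_sym by blast
  then show "Sup {ereal b | b. (\<lambda>\<epsilon>. norm (r \<epsilon>)) \<in> O[at_right 0](\<lambda>\<epsilon>. \<epsilon> powr b)} =
      Sup {ereal b | b. (\<lambda>\<epsilon>. norm (s \<epsilon>)) \<in> O[at_right 0](\<lambda>\<epsilon>. \<epsilon> powr b)}"
    by simp
qed

text \<open>\<open>e\<^sup>-\<^sup>v\<close> with \<open>e\<^sup>-\<^sup>\<infinity> = 0\<close>; the value \<open>-\<infinity>\<close> is not attained on moderate nets.\<close>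

definition exp_neg :: "ereal \<Rightarrow> real" where
  "exp_neg v = (if \<bar>v\<bar> = \<infinity> then 0 else exp (- real_of_ereal v))"

definition abs_e :: "'a::real_normed_field gnum \<Rightarrow> real" where
  "abs_e r = exp_neg (valuation r)"

lemma gnum_rel_norm_le:
  assumes "gnum_rel r s" "\<And>x. norm (f x) \<le> norm x" "\<And>x y. f (x - y) = f x - f y"
  shows "gnum_rel (\<lambda>\<epsilon>. f (r \<epsilon>)) (\<lambda>\<epsilon>. f (s \<epsilon>))"
proof -
  have *: "(\<lambda>\<epsilon>. norm (f (t \<epsilon>))) \<in> O[at_right 0](g)"
    if "(\<lambda>\<epsilon>. norm (t \<epsilon>)) \<in> O[at_right 0](g)" for t and g :: "real \<Rightarrow> real"
  proof -
    have "(\<lambda>\<epsilon>. norm (f (t \<epsilon>))) \<in> O[at_right 0](\<lambda>\<epsilon>. norm (t \<epsilon>))"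
      by (rule bigoI[where c = 1]) (auto intro!: always_eventually assms(2))
    then show ?thesis using that landau_o.big_trans by blast
  qed
  show ?thesis
    using assms(1) * assms(3)[symmetric]
    unfolding gnum_rel_def moderate_net_def negligible_net_def by fastforce
qed

lift_definition gRe :: "complex gnum \<Rightarrow> real gnum" is "\<lambda>r \<epsilon>. Re (r \<epsilon>)"
  using gnum_rel_norm_le[of _ _ Re] by (simp add: abs_Re_le_cmod)

lift_definition gIm :: "complex gnum \<Rightarrow> real gnum" is "\<lambda>r \<epsilon>. Im (r \<epsilon>)"
  using gnum_rel_norm_le[of _ _ Im] by (simp add: abs_Im_le_cmod)

definition vec_Re :: "(complex gnum)^'n \<Rightarrow> (real gnum)^'n" where
  "vec_Re \<zeta> = (\<chi> i. gRe (\<zeta> $ i))"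

definition vec_Im :: "(complex gnum)^'n \<Rightarrow> (real gnum)^'n" where
  "vec_Im \<zeta> = (\<chi> i. gIm (\<zeta> $ i))"

definition represents :: "(real \<Rightarrow> 'a::real_normed_field) \<Rightarrow> 'a gnum \<Rightarrow> bool" where
  "represents r x \<longleftrightarrow> moderate_net r \<and> abs_gnum r = x"

definition vec_represents :: "(real \<Rightarrow> real^'n) \<Rightarrow> (real gnum)^'n \<Rightarrow> bool" where
  "vec_represents x \<xi> \<longleftrightarrow> (\<forall>i. represents (\<lambda>\<epsilon>. x \<epsilon> $ i) (\<xi> $ i))"

definition vec_rep :: "(real gnum)^'n \<Rightarrow> real \<Rightarrow> real^'n" where
  "vec_rep \<xi> \<epsilon> = (\<chi> i. rep_gnum (\<xi> $ i) \<epsilon>)"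

definition gnorm :: "(real gnum)^'n \<Rightarrow> real gnum" where
  "gnorm \<xi> = abs_gnum (\<lambda>\<epsilon>. norm (vec_rep \<xi> \<epsilon>))"

definition log_type :: "(real gnum)^'n \<Rightarrow> bool" where
  "log_type \<xi> \<longleftrightarrow>
     (\<exists>x. vec_represents x \<xi> \<and> (\<lambda>\<epsilon>. norm (x \<epsilon>)) \<in> O[at_right 0](\<lambda>\<epsilon>. ln (1 / \<epsilon>)))"

text \<open>\<open>e\<^bsup>a|\<xi>|\<^esup>\<close>, meaningful for \<open>\<xi>\<close> of log-type: if one representative of \<open>\<xi>\<close> satisfies
  the logarithmic bound then so does every other one, and the class does not depend on it.\<close>

definition gexp_norm :: "real \<Rightarrow> (real gnum)^'n \<Rightarrow> real gnum" where
  "gexp_norm a \<xi> = abs_gnum (\<lambda>\<epsilon>. exp (a * norm (vec_rep \<xi> \<epsilon>)))"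


section \<open>Partial derivatives and smooth functions\<close>

type_synonym 'n multi_index = "'n \<Rightarrow> nat"

definition mi_abs :: "'n::finite multi_index \<Rightarrow> nat" where
  "mi_abs \<alpha> = (\<Sum>i\<in>UNIV. \<alpha> i)"

definition mi_upto :: "nat \<Rightarrow> 'n::finite multi_index set" where
  "mi_upto m = {\<alpha>. mi_abs \<alpha> \<le> m}"

lemma finite_mi_upto: "finite (mi_upto m :: 'n::finite multi_index set)"
proof (rule finite_subset)
  show "mi_upto m \<subseteq> {\<alpha> :: 'n multi_index. range \<alpha> \<subseteq> {..m}}"
  proof (safe, simp)
    fix \<alpha> :: "'n multi_index" and i
    assume "\<alpha> \<in> mi_upto m"
    then have "sum \<alpha> UNIV \<le> m" by (simp add: mi_upto_def mi_abs_def)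
    moreover have "\<alpha> i \<le> sum \<alpha> UNIV" by (rule member_le_sum) auto
    ultimately show "\<alpha> i \<le> m" by simp
  qed
  show "finite {\<alpha> :: 'n multi_index. range \<alpha> \<subseteq> {..m}}"
    using finite_set_of_finite_funs[of "UNIV :: 'n set" "{..m}" 0]
    by (rule rev_finite_subset) auto
qed

definition mi_power :: "'a::comm_semiring_1 ^ 'n \<Rightarrow> 'n::finite multi_index \<Rightarrow> 'a" where
  "mi_power \<zeta> \<alpha> = (\<Prod>i\<in>UNIV. (\<zeta> $ i) ^ \<alpha> i)"

definition pd :: "'n::finite \<Rightarrow> (real^'n \<Rightarrow> complex) \<Rightarrow> real^'n \<Rightarrow> complex" where
  "pd i f x = vector_derivative (\<lambda>t. f (x + t *\<^sub>R axis i 1)) (at 0)"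

text \<open>\<open>\<partial>\<^sup>\<alpha> f\<close> iterates the partial derivatives in some order in which direction \<open>i\<close> occurs
  \<open>\<alpha> i\<close> times. It is only used for smooth \<open>f\<close>, where the order is immaterial.\<close>

definition mpd :: "'n::finite multi_index \<Rightarrow> (real^'n \<Rightarrow> complex) \<Rightarrow> real^'n \<Rightarrow> complex" where
  "mpd \<alpha> f = foldr pd (SOME is. \<forall>i. count_list is i = \<alpha> i) f"

text \<open>\<open>C\<^sup>\<infinity>(\<Omega>)\<close> for open \<open>\<Omega>\<close>: all iterated partial derivatives exist and are differentiable
  (hence continuous) on \<open>\<Omega>\<close>. Values outside \<open>\<Omega>\<close> are irrelevant.\<close>

definition smooth_on :: "(real^'n::finite) set \<Rightarrow> (real^'n \<Rightarrow> complex) \<Rightarrow> bool" where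
  "smooth_on \<Omega> f \<longleftrightarrow> (\<forall>is. \<forall>x\<in>\<Omega>. foldr pd is f differentiable (at x))"

text \<open>Suprema of nonnegative quantities; inserting \<open>0\<close> makes the supremum over \<open>\<emptyset>\<close> equal to \<open>0\<close>.\<close>

definition sup_abs :: "(real^'n) set \<Rightarrow> (real^'n \<Rightarrow> complex) \<Rightarrow> real" where
  "sup_abs K f = Sup (insert 0 {norm (f x) | x. x \<in> K})"

definition sup_deriv :: "(real^'n::finite) set \<Rightarrow> nat \<Rightarrow> (real^'n \<Rightarrow> complex) \<Rightarrow> real" where
  "sup_deriv K j f = Sup (insert 0 {norm (mpd \<alpha> f x) | x \<alpha>. x \<in> K \<and> mi_abs \<alpha> \<le> j})"


section \<open>The Colombeau algebra\<close>

type_synonym 'n fnet = "real \<Rightarrow> real^'n \<Rightarrow> complex"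

text \<open>A generalized function on \<open>\<Omega>\<close> is an equivalence class of nets.\<close>

type_synonym 'n gfun = "'n fnet set"

definition moderate_on :: "(real^'n::finite) set \<Rightarrow> 'n fnet \<Rightarrow> bool" where
  "moderate_on \<Omega> u \<longleftrightarrow>
     (\<forall>\<epsilon>\<in>{0<..1}. smooth_on \<Omega> (u \<epsilon>)) \<and>
     (\<forall>K. compact K \<and> K \<subseteq> \<Omega> \<longrightarrow> (\<forall>\<alpha>. \<exists>N::nat.
        (\<lambda>\<epsilon>. sup_abs K (mpd \<alpha> (u \<epsilon>))) \<in> O[at_right 0](\<lambda>\<epsilon>. \<epsilon> powr (- real N))))"

definition negligible_on :: "(real^'n::finite) set \<Rightarrow> 'n fnet \<Rightarrow> bool" where
  "negligible_on \<Omega> u \<longleftrightarrow>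
     (\<forall>\<epsilon>\<in>{0<..1}. smooth_on \<Omega> (u \<epsilon>)) \<and>
     (\<forall>K. compact K \<and> K \<subseteq> \<Omega> \<longrightarrow> (\<forall>\<alpha>. \<forall>q::nat.
        (\<lambda>\<epsilon>. sup_abs K (mpd \<alpha> (u \<epsilon>))) \<in> O[at_right 0](\<lambda>\<epsilon>. \<epsilon> powr (real q))))"

definition regular_on :: "(real^'n::finite) set \<Rightarrow> 'n fnet \<Rightarrow> bool" where
  "regular_on \<Omega> u \<longleftrightarrow>
     (\<forall>\<epsilon>\<in>{0<..1}. smooth_on \<Omega> (u \<epsilon>)) \<and>
     (\<forall>K. compact K \<and> K \<subseteq> \<Omega> \<longrightarrow> (\<exists>N::nat. \<forall>\<alpha>.
        (\<lambda>\<epsilon>. sup_abs K (mpd \<alpha> (u \<epsilon>))) \<in> O[at_right 0](\<lambda>\<epsilon>. \<epsilon> powr (- real N))))"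

definition colombeau_rel :: "(real^'n::finite) set \<Rightarrow> ('n fnet \<times> 'n fnet) set" where
  "colombeau_rel \<Omega> = {(u, v). moderate_on \<Omega> u \<and> moderate_on \<Omega> v \<and>
     negligible_on \<Omega> (\<lambda>\<epsilon> x. u \<epsilon> x - v \<epsilon> x)}"

definition gclass :: "(real^'n::finite) set \<Rightarrow> 'n fnet \<Rightarrow> 'n gfun" where
  "gclass \<Omega> u = colombeau_rel \<Omega> `` {u}"

definition grep :: "'n gfun \<Rightarrow> 'n fnet" where
  "grep U = (SOME u. u \<in> U)"

definition \<G> :: "(real^'n::finite) set \<Rightarrow> 'n gfun set" where
  "\<G> \<Omega> = {u. moderate_on \<Omega> u} // colombeau_rel \<Omega>"

definition \<G>_inf :: "(real^'n::finite) set \<Rightarrow> 'n gfun set" where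
  "\<G>_inf \<Omega> = {U \<in> \<G> \<Omega>. \<exists>u\<in>U. regular_on \<Omega> u}"

definition gadd :: "(real^'n::finite) set \<Rightarrow> 'n gfun \<Rightarrow> 'n gfun \<Rightarrow> 'n gfun" where
  "gadd \<Omega> U V = gclass \<Omega> (\<lambda>\<epsilon> x. grep U \<epsilon> x + grep V \<epsilon> x)"

definition gsub :: "(real^'n::finite) set \<Rightarrow> 'n gfun \<Rightarrow> 'n gfun \<Rightarrow> 'n gfun" where
  "gsub \<Omega> U V = gclass \<Omega> (\<lambda>\<epsilon> x. grep U \<epsilon> x - grep V \<epsilon> x)"

definition gsmult :: "(real^'n::finite) set \<Rightarrow> complex gnum \<Rightarrow> 'n gfun \<Rightarrow> 'n gfun" where
  "gsmult \<Omega> a U = gclass \<Omega> (\<lambda>\<epsilon> x. rep_gnum a \<epsilon> * grep U \<epsilon> x)"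

definition gsupp :: "(real^'n::finite) set \<Rightarrow> 'n gfun \<Rightarrow> (real^'n) set" where
  "gsupp \<Omega> U = \<Omega> - \<Union>{V. open V \<and> V \<subseteq> \<Omega> \<and> negligible_on V (grep U)}"

definition \<G>_c :: "(real^'n::finite) set \<Rightarrow> 'n gfun set" where
  "\<G>_c \<Omega> = {U \<in> \<G> \<Omega>. compact (gsupp \<Omega> U)}"

definition \<G>_K :: "(real^'n::finite) set \<Rightarrow> (real^'n) set \<Rightarrow> 'n gfun set" where
  "\<G>_K \<Omega> K = {U \<in> \<G>_c \<Omega>. gsupp \<Omega> U \<subseteq> K}"

text \<open>Representatives with supports in one compact subset of \<open>\<Omega>\<close>; they vanish also outside
  \<open>\<Omega>\<close>, so that they are nets of test functions.\<close>

definition compact_rep :: "(real^'n::finite) set \<Rightarrow> 'n gfun \<Rightarrow> 'n fnet \<Rightarrow> bool" where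
  "compact_rep \<Omega> U u \<longleftrightarrow> u \<in> U \<and>
     (\<exists>K. compact K \<and> K \<subseteq> \<Omega> \<and> (\<forall>\<epsilon>\<in>{0<..1}. \<forall>x. x \<notin> K \<longrightarrow> u \<epsilon> x = 0))"

definition crep :: "(real^'n::finite) set \<Rightarrow> 'n gfun \<Rightarrow> 'n fnet" where
  "crep \<Omega> U = (SOME u. compact_rep \<Omega> U u)"


section \<open>Topologies and continuous functionals\<close>

text \<open>The topology on \<open>A\<close> defined by a family \<open>P\<close> of ultra-pseudo-seminorms.\<close>

definition seminorm_topology :: "'v set \<Rightarrow> ('v \<Rightarrow> 'v \<Rightarrow> 'v) \<Rightarrow> ('v \<Rightarrow> real) set \<Rightarrow> 'v topology" where
  "seminorm_topology A sub P = topology_generated_by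
     {B. \<exists>p\<in>P. \<exists>u\<in>A. \<exists>r>0. B = {v \<in> A. p (sub v u) < r}}"

definition gnum_topology :: "'a::real_normed_field gnum topology" where
  "gnum_topology = seminorm_topology UNIV (-) {abs_e}"

definition gval :: "(real^'n::finite) set \<Rightarrow> nat \<Rightarrow> 'n gfun \<Rightarrow> ereal" where
  "gval K' j U = Sup {ereal b | b.
     (\<lambda>\<epsilon>. sup_deriv K' j (grep U \<epsilon>)) \<in> O[at_right 0](\<lambda>\<epsilon>. \<epsilon> powr b)}"

text \<open>On \<open>\<G>\<^sub>K(\<Omega>)\<close> the choice of the compact neighbourhood \<open>K'\<close> of \<open>K\<close> is irrelevant;
  all choices are admitted.\<close>

definition \<G>_K_topology :: "(real^'n::finite) set \<Rightarrow> (real^'n) set \<Rightarrow> 'n gfun topology" where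
  "\<G>_K_topology \<Omega> K = seminorm_topology (\<G>_K \<Omega> K) (gsub \<Omega>)
     {\<lambda>U. exp_neg (gval K' j U) | K' j. compact K' \<and> K' \<subseteq> \<Omega> \<and> K \<subseteq> interior K'}"

definition ultra_pseudo_seminorm :: "(real^'n::finite) set \<Rightarrow> ('n gfun \<Rightarrow> real) \<Rightarrow> bool" where
  "ultra_pseudo_seminorm \<Omega> p \<longleftrightarrow>
     (\<forall>U\<in>\<G>_c \<Omega>. 0 \<le> p U) \<and>
     (\<forall>U\<in>\<G>_c \<Omega>. \<forall>a. p (gsmult \<Omega> a U) \<le> abs_e a * p U) \<and>
     (\<forall>U\<in>\<G>_c \<Omega>. \<forall>V\<in>\<G>_c \<Omega>. p (gadd \<Omega> U V) \<le> max (p U) (p V))"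

text \<open>The inductive limit topology, i.e. the finest locally convex one for which the inclusions
  \<open>\<G>\<^sub>K(\<Omega>) \<subseteq> \<G>\<^sub>c(\<Omega>)\<close> are continuous: it is defined by all ultra-pseudo-seminorms whose
  restrictions to the \<open>\<G>\<^sub>K(\<Omega>)\<close> are continuous.\<close>

definition \<G>_c_topology :: "(real^'n::finite) set \<Rightarrow> 'n gfun topology" where
  "\<G>_c_topology \<Omega> = seminorm_topology (\<G>_c \<Omega>) (gsub \<Omega>)
     {p. ultra_pseudo_seminorm \<Omega> p \<and>
         (\<forall>K. compact K \<and> K \<subseteq> \<Omega> \<longrightarrow> continuous_map (\<G>_K_topology \<Omega> K) euclideanreal p)}"

text \<open>Functionals are total functions on classes; only their values on \<open>\<G>\<^sub>c(\<Omega>)\<close> matter.\<close>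

type_synonym 'n gfunctional = "'n gfun \<Rightarrow> complex gnum"

definition dual :: "(real^'n::finite) set \<Rightarrow> 'n gfunctional set" where
  "dual \<Omega> = {T.
     (\<forall>U\<in>\<G>_c \<Omega>. \<forall>V\<in>\<G>_c \<Omega>. T (gadd \<Omega> U V) = T U + T V) \<and>
     (\<forall>U\<in>\<G>_c \<Omega>. \<forall>a. T (gsmult \<Omega> a U) = a * T U) \<and>
     continuous_map (\<G>_c_topology \<Omega>) gnum_topology T}"

definition test_functions :: "(real^'n::finite) set \<Rightarrow> (real^'n \<Rightarrow> complex) set" where
  "test_functions K = {f. smooth_on UNIV f \<and> (\<forall>x. x \<notin> K \<longrightarrow> f x = 0)}"

definition distribution :: "(real^'n::finite) set \<Rightarrow> ((real^'n \<Rightarrow> complex) \<Rightarrow> complex) \<Rightarrow> bool" where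
  "distribution \<Omega> t \<longleftrightarrow> (\<forall>K. compact K \<and> K \<subseteq> \<Omega> \<longrightarrow>
     (\<forall>f\<in>test_functions K. \<forall>g\<in>test_functions K. t (\<lambda>x. f x + g x) = t f + t g) \<and>
     (\<forall>f\<in>test_functions K. \<forall>a. t (\<lambda>x. a * f x) = a * t f) \<and>
     (\<exists>j C. \<forall>f\<in>test_functions K. norm (t f) \<le> C * sup_deriv K j f))"

definition basic :: "(real^'n::finite) set \<Rightarrow> 'n gfunctional \<Rightarrow> bool" where
  "basic \<Omega> T \<longleftrightarrow> T \<in> dual \<Omega> \<and>
     (\<exists>t :: real \<Rightarrow> (real^'n \<Rightarrow> complex) \<Rightarrow> complex.
        (\<forall>\<epsilon>\<in>{0<..1}. distribution \<Omega> (t \<epsilon>)) \<and>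
        (\<forall>K. compact K \<and> K \<subseteq> \<Omega> \<longrightarrow>
           (\<exists>j N::nat. \<exists>c>0. \<exists>\<eta>\<in>{0<..1}. \<forall>f\<in>test_functions K. \<forall>\<epsilon>\<in>{0<..\<eta>}.
              norm (t \<epsilon> f) \<le> c * \<epsilon> powr (- real N) * sup_deriv K j f)) \<and>
        (\<forall>U\<in>\<G>_c \<Omega>. \<forall>u. compact_rep \<Omega> U u \<longrightarrow> T U = abs_gnum (\<lambda>\<epsilon>. t \<epsilon> (u \<epsilon>))))"

definition embed :: "(real^'n::finite) set \<Rightarrow> 'n gfun \<Rightarrow> 'n gfunctional" where
  "embed \<Omega> W U =
     abs_gnum (\<lambda>\<epsilon>. set_lebesgue_integral lborel \<Omega> (\<lambda>x. grep W \<epsilon> x * crep \<Omega> U \<epsilon> x))"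

text \<open>Restriction of a functional on \<open>\<G>\<^sub>c(\<Omega>)\<close> to \<open>\<G>\<^sub>c(V)\<close>, \<open>V \<subseteq> \<Omega>\<close> open, along the
  extension of elements of \<open>\<G>\<^sub>c(V)\<close> by zero.\<close>

definition restrict_functional ::
  "(real^'n::finite) set \<Rightarrow> (real^'n) set \<Rightarrow> 'n gfunctional \<Rightarrow> 'n gfunctional" where
  "restrict_functional \<Omega> V T U = T (gclass \<Omega> (crep V U))"

text \<open>The singular support with respect to \<open>A\<close>, to be used for \<open>A = \<G>\<close> and \<open>A = \<G>_inf\<close>.\<close>

definition sing_supp ::
  "((real^'n::finite) set \<Rightarrow> 'n gfun set) \<Rightarrow> (real^'n) set \<Rightarrow> 'n gfunctional \<Rightarrow> (real^'n) set" where
  "sing_supp A \<Omega> T = \<Omega> - {x. \<exists>V. open V \<and> x \<in> V \<and> V \<subseteq> \<Omega> \<and>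
     (\<exists>W\<in>A V. \<forall>U\<in>\<G>_c V. restrict_functional \<Omega> V T U = embed V W U)}"


section \<open>Differential operators with generalized constant coefficients\<close>

text \<open>An operator \<open>P(D)\<close> of order \<open>m\<close> is given by its coefficients \<open>c \<alpha>\<close>, \<open>|\<alpha>| \<le> m\<close>;
  \<open>c \<alpha>\<close> is ignored for \<open>|\<alpha>| > m\<close>.\<close>

type_synonym 'n coeffs = "'n multi_index \<Rightarrow> complex gnum"

definition symbol :: "nat \<Rightarrow> 'n::finite coeffs \<Rightarrow> (complex gnum)^'n \<Rightarrow> complex gnum" where
  "symbol m c \<zeta> = (\<Sum>\<alpha>\<in>mi_upto m. c \<alpha> * mi_power \<zeta> \<alpha>)"

definition symbol_net :: "nat \<Rightarrow> 'n::finite coeffs \<Rightarrow> real \<Rightarrow> real^'n \<Rightarrow> complex" where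
  "symbol_net m c \<epsilon> \<xi> =
     (\<Sum>\<alpha>\<in>mi_upto m. rep_gnum (c \<alpha>) \<epsilon> * complex_of_real (mi_power \<xi> \<alpha>))"

definition symbol_tilde :: "nat \<Rightarrow> 'n::finite coeffs \<Rightarrow> real^'n \<Rightarrow> real gnum" where
  "symbol_tilde m c \<xi> =
     abs_gnum (\<lambda>\<epsilon>. sqrt (\<Sum>\<alpha>\<in>mi_upto m. (norm (mpd \<alpha> (symbol_net m c \<epsilon>) \<xi>))\<^sup>2))"

definition diff_op :: "(real^'n::finite) set \<Rightarrow> nat \<Rightarrow> 'n coeffs \<Rightarrow> 'n gfun \<Rightarrow> 'n gfun" where
  "diff_op \<Omega> m c U = gclass \<Omega> (\<lambda>\<epsilon> x.
     \<Sum>\<alpha>\<in>mi_upto m. rep_gnum (c \<alpha>) \<epsilon> * ((- \<i>) ^ mi_abs \<alpha> * mpd \<alpha> (grep U \<epsilon>) x))"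

definition transpose_coeffs :: "'n::finite coeffs \<Rightarrow> 'n coeffs" where
  "transpose_coeffs c \<alpha> = (- 1) ^ mi_abs \<alpha> * c \<alpha>"

definition apply_op ::
  "(real^'n::finite) set \<Rightarrow> nat \<Rightarrow> 'n coeffs \<Rightarrow> 'n gfunctional \<Rightarrow> 'n gfunctional" where
  "apply_op \<Omega> m c T U = T (diff_op \<Omega> m (transpose_coeffs c) U)"

definition hypoelliptic ::
  "((real^'n::finite) set \<Rightarrow> 'n gfun set) \<Rightarrow> nat \<Rightarrow> 'n coeffs \<Rightarrow> bool" where
  "hypoelliptic A m c \<longleftrightarrow> (\<forall>\<Omega>. open \<Omega> \<longrightarrow> (\<forall>T. basic \<Omega> T \<longrightarrow>
     sing_supp A \<Omega> (apply_op \<Omega> m c T) = sing_supp A \<Omega> T))"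

definition log_zeros :: "nat \<Rightarrow> 'n::finite coeffs \<Rightarrow> ((complex gnum)^'n) set" where
  "log_zeros m c = {\<zeta>. symbol m c \<zeta> = 0 \<and> log_type (vec_Im \<zeta>)}"

end

theory Submission
  imports Defs
begin

text \<open>
  If \<open>P(\<zeta>) = 0\<close> then \<open>e\<^bsup>ix\<zeta>\<^esup>\<close> solves \<open>P(D)u = 0\<close>, and its derivatives at \<open>0\<close> grow with \<open>|\<zeta>|\<close>. The
  proof feeds hypoellipticity with functionals that are made of such exponentials only: for a net
  \<open>z\<close> of points of \<open>\<complex>\<^sup>n\<close> and a set \<open>A\<close> of parameters, let \<open>T\<close> be the functional with
  \<open>T\<^sub>\<epsilon>(f) = \<integral>e\<^bsup>ixz\<^esup> f(x) dx\<close>, \<open>z = z\<^sub>\<epsilon>\<close>, for \<open>\<epsilon> \<in> A\<close> and \<open>T\<^sub>\<epsilon> = 0\<close> otherwise. Three facts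
  carry the argument.

  First, \<open>T\<close> is basic as soon as \<open>e\<^bsup>|Im z|\<^esup> \<le> \<epsilon>\<^bsup>-M\<^esup>(1 + |z|)\<close> on \<open>A\<close>
  (\<open>moderate_distributions_osc_net\<close>, \<open>basic_gfunctional_of\<close>): on a ball of radius \<open>r\<close> the
  exponential is at most \<open>e\<^bsup>r|Im z|\<^esup>\<close>, hence of the size \<open>\<epsilon>\<^bsup>-Mr\<^esup>|z|\<^sup>r\<close>, and \<open>r\<close> integrations by
  parts gain the factor \<open>|z|\<^bsup>-r\<^esup>\<close>. So \<open>|Re z|\<close> may grow faster than any power of \<open>1/\<epsilon>\<close>.

  Second, if \<open>P\<^sub>\<epsilon>(z\<^sub>\<epsilon>)\<close> is negligible on \<open>A\<close> then \<open>P(D)T = 0\<close>, and hypoellipticity gives an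
  element \<open>W\<close> of \<open>\<G>(V)\<close> or \<open>\<G>\<^sup>\<infinity>(V)\<close>, \<open>V\<close> a neighbourhood of \<open>0\<close>, that represents \<open>T\<close> on \<open>V\<close>
  (\<open>apply_op_osc_eq_0\<close>, \<open>hypoelliptic_osc\<close>).

  Third, on a subset \<open>A'\<close> of \<open>A\<close> on which \<open>z\<close> is moderate and \<open>Im z\<close> is of logarithmic type,
  \<open>W\<close> may be tested against \<open>\<phi> e\<^bsup>-ixz\<^esup>\<close> with a bump function \<open>\<phi>\<close>. As \<open>W\<close> acts like \<open>T\<close>, the result
  \<open>\<integral>W \<phi> e\<^bsup>-ixz\<^esup> dx\<close> differs from \<open>\<integral>\<phi> dx \<noteq> 0\<close> by a negligible net; integrating by parts \<open>j\<close> times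
  bounds it by \<open>|z|\<^bsup>-j\<^esup> e\<^bsup>|Im z|\<^esup>\<close> times the derivatives of \<open>\<phi>W\<close> of order \<open>j\<close>. Hence
  \<open>|z|\<^sup>j \<le> C \<epsilon>\<^bsup>-N\<^esup> e\<^bsup>|Im z|\<^esup>\<close> on \<open>A'\<close>, where \<open>\<epsilon>\<^bsup>-N\<^esup>\<close> bounds the derivatives of \<open>W\<close> of order at most
  \<open>j\<close> near \<open>0\<close> (\<open>osc_growth\<close>).

  For the \<open>\<G>\<^sup>\<infinity>\<close> statement take for \<open>z\<close> a representative of one zero. Now \<open>N\<close> does not depend on
  \<open>j\<close>, and taking \<open>j\<close>-th roots with \<open>j \<rightarrow> \<infinity>\<close> gives \<open>|z| = O(\<epsilon>\<^sup>b)\<close> for every \<open>b < 0\<close>.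

  For the \<open>\<G>\<close> statement suppose that no constants work. Then for every \<open>k\<close> there is a zero \<open>\<zeta>\<^sub>k\<close>
  such that \<open>|\<zeta>\<^sub>k| \<ge> \<epsilon>\<^bsup>-k\<^esup> e\<^bsup>k|Im \<zeta>\<^sub>k|\<^esup>\<close> for arbitrarily small \<open>\<epsilon>\<close>
  (\<open>frequently_large_zero\<close>). Let \<open>A\<close> be a sequence of such \<open>\<epsilon>\<close> tending to \<open>0\<close> in which each \<open>k\<close>
  is served infinitely often, and let \<open>z\<^sub>\<epsilon>\<close> be the value of \<open>\<zeta>\<^sub>k\<close> at the \<open>\<epsilon>\<close> serving \<open>k\<close>. The factor
  \<open>e\<^bsup>k|Im \<zeta>\<^sub>k|\<^esup>\<close> makes the resulting functional basic, although the zeros have no common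
  logarithmic bound. The third fact with \<open>j = 1\<close>, applied to the \<open>\<epsilon>\<close> serving one \<open>k\<close>, gives
  \<open>|\<zeta>\<^sub>k| \<le> C \<epsilon>\<^bsup>-N\<^esup> e\<^bsup>|Im \<zeta>\<^sub>k|\<^esup>\<close> with an \<open>N\<close> that does not depend on \<open>k\<close>; this is absurd for
  \<open>k > N\<close>.
\<close>

section \<open>Iterated partial derivatives\<close>

text \<open>The operator \<open>mpd\<close> follows one chosen list of directions. The product rule, however, leads to
  sublists of it, which need not be the lists chosen for their own multi-indices; therefore estimates
  are stated for all lists of directions.\<close>

abbreviation pds :: "'n::finite list \<Rightarrow> (real^'n \<Rightarrow> complex) \<Rightarrow> real^'n \<Rightarrow> complex" where
  "pds is f \<equiv> foldr pd is f"

lemma has_vector_derivative_along_axis: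
  fixes f :: "real^'n::finite \<Rightarrow> complex"
  assumes "(f has_derivative f') (at (x + s *\<^sub>R axis i 1))"
  shows "((\<lambda>t. f (x + t *\<^sub>R axis i 1)) has_vector_derivative f' (axis i 1)) (at s)"
proof -
  have 1: "((\<lambda>t. x + t *\<^sub>R axis i (1::real)) has_derivative (\<lambda>t. t *\<^sub>R axis i (1::real))) (at s)"
    by (auto intro!: derivative_eq_intros)
  have "((\<lambda>t. f (x + t *\<^sub>R axis i 1)) has_derivative (\<lambda>t. f' (t *\<^sub>R axis i 1))) (at s)"
    by (rule has_derivative_compose[OF 1]) (use assms in simp)
  moreover have "f' (t *\<^sub>R axis i 1) = t *\<^sub>R f' (axis i 1)" for t
    using assms by (simp add: has_derivative_linear linear_scale)
  ultimately show ?thesis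
    by (simp add: has_vector_derivative_def)
qed

lemma has_derivative_imp_pd:
  assumes "(f has_derivative f') (at x)"
  shows "pd i f x = f' (axis i 1)"
  using has_vector_derivative_along_axis[of f f' x 0 i] assms
  by (simp add: pd_def vector_derivative_at)

lemma has_vector_derivative_pd:
  assumes "f differentiable (at (x + s *\<^sub>R axis i 1))"
  shows "((\<lambda>t. f (x + t *\<^sub>R axis i 1)) has_vector_derivative pd i f (x + s *\<^sub>R axis i 1)) (at s)"
proof -
  obtain f' where f': "(f has_derivative f') (at (x + s *\<^sub>R axis i 1))"
    using assms by (auto simp: differentiable_def)
  show ?thesis
    using has_vector_derivative_along_axis[OF f'] has_derivative_imp_pd[OF f', of i] by simp
qed

lemma pd_cong:
  assumes "open \<Omega>" "\<And>x. x \<in> \<Omega> \<Longrightarrow> f x = g x" "x \<in> \<Omega>"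
  shows "pd i f x = pd i g x"
proof -
  have "open ((\<lambda>t. x + t *\<^sub>R axis i (1::real)) -` \<Omega>)"
    by (rule open_vimage) (auto intro!: continuous_intros assms)
  then have "eventually (\<lambda>t. t \<in> (\<lambda>t. x + t *\<^sub>R axis i (1::real)) -` \<Omega>) (nhds 0)"
    by (rule eventually_nhds_in_open) (use assms in simp)
  then show ?thesis unfolding pd_def
    by (intro vector_derivative_cong_eq) (auto elim!: eventually_mono intro: assms)
qed

lemma pds_cong:
  assumes "open \<Omega>" "\<And>x. x \<in> \<Omega> \<Longrightarrow> f x = g x" "x \<in> \<Omega>"
  shows "pds is f x = pds is g x"
  using assms(3)
proof (induction "is" arbitrary: x)
  case (Cons i "is")
  then show ?case using pd_cong[OF assms(1), of "pds is f" "pds is g"] by simp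
qed (use assms in simp)

lemma differentiable_cong_open:
  assumes "open \<Omega>" "\<And>x. x \<in> \<Omega> \<Longrightarrow> f x = g x" "x \<in> \<Omega>" "f differentiable (at x)"
  shows "g differentiable (at x)"
  using assms by (auto simp: differentiable_def intro: has_derivative_transform_within_open)

lemma pds_zero: "pds is (\<lambda>x. 0) = (\<lambda>x. 0)"
proof (induction "is")
  case (Cons i "is")
  have "pd i (\<lambda>x. 0) = (\<lambda>x. 0)"
    by (simp add: pd_def fun_eq_iff)
  with Cons show ?case by simp
qed simp

lemma pd_const: "pd i (\<lambda>x. c) = (\<lambda>x. 0)"
  by (simp add: pd_def fun_eq_iff)

lemma pd_add:
  assumes "f differentiable (at x)" "g differentiable (at x)"
  shows "pd i (\<lambda>x. f x + g x) x = pd i f x + pd i g x"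
proof -
  obtain f' g' where *: "(f has_derivative f') (at x)" "(g has_derivative g') (at x)"
    using assms by (auto simp: differentiable_def)
  show ?thesis
    using has_derivative_imp_pd[OF has_derivative_add[OF *], of i]
      has_derivative_imp_pd[OF *(1), of i] has_derivative_imp_pd[OF *(2), of i] by simp
qed

lemma pd_mult:
  assumes "f differentiable (at x)" "g differentiable (at x)"
  shows "pd i (\<lambda>x. f x * g x) x = pd i f x * g x + f x * pd i g x"
proof -
  obtain f' g' where *: "(f has_derivative f') (at x)" "(g has_derivative g') (at x)"
    using assms by (auto simp: differentiable_def)
  show ?thesis
    using has_derivative_imp_pd[OF has_derivative_mult[OF *], of i]
      has_derivative_imp_pd[OF *(1), of i] has_derivative_imp_pd[OF *(2), of i] by simp
qed

lemma pd_cmult: "f differentiable (at x) \<Longrightarrow> pd i (\<lambda>x. c * f x) x = c * pd i f x"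
  using pd_mult[of "\<lambda>x. c" x f i] by (simp add: pd_const)

text \<open>Closure properties of smooth functions are proved by induction on the number of derivatives,
  which \<open>smooth_on\<close> does not bound.\<close>

definition diff_upto :: "nat \<Rightarrow> (real^'n::finite) set \<Rightarrow> (real^'n \<Rightarrow> complex) \<Rightarrow> bool" where
  "diff_upto n \<Omega> f \<longleftrightarrow> (\<forall>is. length is \<le> n \<longrightarrow> (\<forall>x\<in>\<Omega>. pds is f differentiable (at x)))"

lemma smooth_on_iff_diff_upto: "smooth_on \<Omega> f \<longleftrightarrow> (\<forall>n. diff_upto n \<Omega> f)"
  unfolding smooth_on_def diff_upto_def by blast

lemma diff_upto_0: "diff_upto 0 \<Omega> f \<longleftrightarrow> (\<forall>x\<in>\<Omega>. f differentiable (at x))"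
  by (simp add: diff_upto_def)

text \<open>The derivative that is taken first is the last entry of the list.\<close>

lemma diff_upto_Suc:
  "diff_upto (Suc n) \<Omega> f \<longleftrightarrow> (\<forall>x\<in>\<Omega>. f differentiable (at x)) \<and> (\<forall>i. diff_upto n \<Omega> (pd i f))"
  (is "?L \<longleftrightarrow> ?R")
proof
  assume L: ?L
  have "f differentiable (at x)" if "x \<in> \<Omega>" for x
    using L[unfolded diff_upto_def, rule_format, of "[]"] that by simp
  moreover have "diff_upto n \<Omega> (pd i f)" for i
    unfolding diff_upto_def
  proof (intro allI impI ballI)
    fix "is" :: "'a list" and x assume "length is \<le> n" "x \<in> \<Omega>"
    then show "pds is (pd i f) differentiable (at x)"
      using L[unfolded diff_upto_def, rule_format, of "is @ [i]" x] by simp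
  qed
  ultimately show ?R by blast
next
  assume R: ?R
  show ?L unfolding diff_upto_def
  proof (intro allI impI ballI)
    fix "is" :: "'a list" and x assume *: "length is \<le> Suc n" "x \<in> \<Omega>"
    show "pds is f differentiable (at x)"
      using * R by (cases "is" rule: rev_cases) (auto simp: diff_upto_def)
  qed
qed

lemma smooth_on_pd: "smooth_on \<Omega> f \<Longrightarrow> smooth_on \<Omega> (pd i f)"
  by (meson smooth_on_iff_diff_upto diff_upto_Suc)

lemma smooth_on_pds: "smooth_on \<Omega> f \<Longrightarrow> smooth_on \<Omega> (pds is f)"
  by (induction "is") (auto intro: smooth_on_pd)

lemma smooth_on_imp_differentiable: "smooth_on \<Omega> f \<Longrightarrow> x \<in> \<Omega> \<Longrightarrow> f differentiable (at x)"
  using smooth_on_iff_diff_upto diff_upto_0 by blast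

lemma smooth_on_imp_continuous_on: "smooth_on \<Omega> f \<Longrightarrow> continuous_on \<Omega> f"
  by (meson continuous_at_imp_continuous_on differentiable_imp_continuous_within
      smooth_on_imp_differentiable)

lemma smooth_on_subset: "smooth_on \<Omega> f \<Longrightarrow> V \<subseteq> \<Omega> \<Longrightarrow> smooth_on V f"
  by (auto simp: smooth_on_def)

lemma smooth_on_Un: "smooth_on V f \<Longrightarrow> smooth_on W f \<Longrightarrow> smooth_on (V \<union> W) f"
  by (auto simp: smooth_on_def)

lemma diff_upto_cong:
  assumes "open \<Omega>" "\<And>x. x \<in> \<Omega> \<Longrightarrow> f x = g x" "diff_upto n \<Omega> f"
  shows "diff_upto n \<Omega> g"
  unfolding diff_upto_def
proof (intro allI impI ballI)
  fix "is" :: "'a list" and x assume *: "length is \<le> n" "x \<in> \<Omega>"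
  show "pds is g differentiable (at x)"
    by (rule differentiable_cong_open[OF assms(1) pds_cong[OF assms(1,2)]])
       (use * assms(3) in \<open>auto simp: diff_upto_def\<close>)
qed

lemma smooth_on_cong:
  assumes "open \<Omega>" "\<And>x. x \<in> \<Omega> \<Longrightarrow> f x = g x" "smooth_on \<Omega> f"
  shows "smooth_on \<Omega> g"
  using assms diff_upto_cong unfolding smooth_on_iff_diff_upto by blast

lemma diff_upto_lower: "diff_upto (Suc n) \<Omega> f \<Longrightarrow> diff_upto n \<Omega> f"
  by (simp add: diff_upto_def)

lemma diff_upto_const: "diff_upto n \<Omega> (\<lambda>x. c)"
  by (induction n arbitrary: c) (simp_all add: diff_upto_0 diff_upto_Suc pd_const)

lemma diff_upto_add:
  assumes "open \<Omega>" "diff_upto n \<Omega> f" "diff_upto n \<Omega> g"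
  shows "diff_upto n \<Omega> (\<lambda>x. f x + g x)"
  using assms(2,3)
proof (induction n arbitrary: f g)
  case 0
  then show ?case by (auto simp: diff_upto_0)
next
  case (Suc n)
  show ?case unfolding diff_upto_Suc
  proof (intro conjI ballI allI)
    fix i
    have "diff_upto n \<Omega> (\<lambda>x. pd i f x + pd i g x)"
      using Suc by (auto simp: diff_upto_Suc)
    then show "diff_upto n \<Omega> (pd i (\<lambda>x. f x + g x))"
      by (rule diff_upto_cong[OF assms(1), rotated])
         (use Suc.prems in \<open>simp add: pd_add diff_upto_Suc\<close>)
  qed (use Suc.prems in \<open>auto simp: diff_upto_Suc\<close>)
qed

lemma diff_upto_mult:
  assumes "open \<Omega>" "diff_upto n \<Omega> f" "diff_upto n \<Omega> g"
  shows "diff_upto n \<Omega> (\<lambda>x. f x * g x)"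
  using assms(2,3)
proof (induction n arbitrary: f g)
  case 0
  then show ?case by (auto simp: diff_upto_0)
next
  case (Suc n)
  show ?case unfolding diff_upto_Suc
  proof (intro conjI ballI allI)
    fix i
    have "diff_upto n \<Omega> (\<lambda>x. pd i f x * g x + f x * pd i g x)"
      using Suc by (intro diff_upto_add[OF assms(1)] Suc.IH) (auto intro: diff_upto_lower simp: diff_upto_Suc)
    then show "diff_upto n \<Omega> (pd i (\<lambda>x. f x * g x))"
      by (rule diff_upto_cong[OF assms(1), rotated])
         (use Suc.prems in \<open>simp add: pd_mult diff_upto_Suc\<close>)
  qed (use Suc.prems in \<open>auto simp: diff_upto_Suc\<close>)
qed

lemma smooth_on_const: "smooth_on \<Omega> (\<lambda>x. c)"
  using diff_upto_const smooth_on_iff_diff_upto by blast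

lemma smooth_on_add: "open \<Omega> \<Longrightarrow> smooth_on \<Omega> f \<Longrightarrow> smooth_on \<Omega> g \<Longrightarrow> smooth_on \<Omega> (\<lambda>x. f x + g x)"
  by (simp add: smooth_on_iff_diff_upto diff_upto_add)

lemma smooth_on_mult: "open \<Omega> \<Longrightarrow> smooth_on \<Omega> f \<Longrightarrow> smooth_on \<Omega> g \<Longrightarrow> smooth_on \<Omega> (\<lambda>x. f x * g x)"
  by (simp add: smooth_on_iff_diff_upto diff_upto_mult)

lemma smooth_on_cmult: "open \<Omega> \<Longrightarrow> smooth_on \<Omega> f \<Longrightarrow> smooth_on \<Omega> (\<lambda>x. c * f x)"
  by (intro smooth_on_mult smooth_on_const)

lemma smooth_on_diff:
  assumes "open \<Omega>" "smooth_on \<Omega> f" "smooth_on \<Omega> g"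
  shows "smooth_on \<Omega> (\<lambda>x. f x - g x)"
  using smooth_on_add[OF assms(1,2) smooth_on_cmult[OF assms(1,3), of "-1"]] by simp

lemma smooth_on_sum:
  assumes "open \<Omega>" "\<And>a. a \<in> I \<Longrightarrow> smooth_on \<Omega> (f a)"
  shows "smooth_on \<Omega> (\<lambda>x. \<Sum>a\<in>I. f a x)"
  using assms(2)
  by (induction I rule: infinite_finite_induct) (auto intro: smooth_on_const smooth_on_add assms(1))

lemma pds_add:
  assumes "open \<Omega>" "smooth_on \<Omega> f" "smooth_on \<Omega> g" "x \<in> \<Omega>"
  shows "pds is (\<lambda>x. f x + g x) x = pds is f x + pds is g x"
  using assms(4)
proof (induction "is" arbitrary: x)
  case (Cons i "is")
  have "pds (i # is) (\<lambda>x. f x + g x) x = pd i (\<lambda>x. pds is f x + pds is g x) x"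
    by (simp, rule pd_cong[OF assms(1)]) (use Cons in auto)
  also have "\<dots> = pds (i # is) f x + pds (i # is) g x"
    using Cons.prems assms by (simp add: pd_add smooth_on_imp_differentiable[OF smooth_on_pds])
  finally show ?case .
qed simp

lemma pds_cmult:
  assumes "open \<Omega>" "smooth_on \<Omega> f" "x \<in> \<Omega>"
  shows "pds is (\<lambda>x. c * f x) x = c * pds is f x"
  using assms(3)
proof (induction "is" arbitrary: x)
  case (Cons i "is")
  have "pds (i # is) (\<lambda>x. c * f x) x = pd i (\<lambda>x. c * pds is f x) x"
    by (simp, rule pd_cong[OF assms(1)]) (use Cons in auto)
  also have "\<dots> = c * pds (i # is) f x"
    using Cons.prems assms by (simp add: pd_cmult smooth_on_imp_differentiable[OF smooth_on_pds])
  finally show ?case .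
qed simp

lemma pds_diff:
  assumes "open \<Omega>" "smooth_on \<Omega> f" "smooth_on \<Omega> g" "x \<in> \<Omega>"
  shows "pds is (\<lambda>x. f x - g x) x = pds is f x - pds is g x"
  using pds_add[OF assms(1,2) smooth_on_cmult[OF assms(1,3), of "-1"] assms(4), of "is"]
    pds_cmult[OF assms(1,3,4), of "is" "-1"] by simp

section \<open>Symmetry of iterated derivatives\<close>

text \<open>The theorem of Schwarz. The second difference of \<open>U\<close> over a square of side \<open>h\<close> is, by the mean
  value theorem in the one and in the other order, \<open>h\<^sup>2\<close> times a value of either mixed derivative in
  this square; both are continuous at the corner.\<close>

lemma mixed_derivatives_eq:
  fixes U A B AB BA :: "real \<Rightarrow> real \<Rightarrow> real"
  assumes d: "d > 0"
    and A: "\<And>s t. \<bar>s\<bar> < d \<Longrightarrow> \<bar>t\<bar> < d \<Longrightarrow> ((\<lambda>s. U s t) has_real_derivative A s t) (at s)"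
    and B: "\<And>s t. \<bar>s\<bar> < d \<Longrightarrow> \<bar>t\<bar> < d \<Longrightarrow> ((\<lambda>t. U s t) has_real_derivative B s t) (at t)"
    and AB: "\<And>s t. \<bar>s\<bar> < d \<Longrightarrow> \<bar>t\<bar> < d \<Longrightarrow> ((\<lambda>t. A s t) has_real_derivative AB s t) (at t)"
    and BA: "\<And>s t. \<bar>s\<bar> < d \<Longrightarrow> \<bar>t\<bar> < d \<Longrightarrow> ((\<lambda>s. B s t) has_real_derivative BA s t) (at s)"
    and c: "isCont (\<lambda>p. AB (fst p) (snd p)) (0, 0)" "isCont (\<lambda>p. BA (fst p) (snd p)) (0, 0)"
  shows "AB 0 0 = BA 0 0"
proof -
  have ex: "\<exists>s t s' t'. \<bar>s\<bar> < h \<and> \<bar>t\<bar> < h \<and> \<bar>s'\<bar> < h \<and> \<bar>t'\<bar> < h \<and> AB s t = BA s' t'"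
    if h: "0 < h" "h < d" for h
  proof -
    let ?D = "U h h - U 0 h - (U h 0 - U 0 0)"
    have "\<exists>s>0. s < h \<and> (U h h - U h 0) - (U 0 h - U 0 0) = (h - 0) * (A s h - A s 0)"
      by (rule MVT2[of 0 h "\<lambda>s. U s h - U s 0"]) (use h in \<open>auto intro!: DERIV_diff A\<close>)
    then obtain s where s: "0 < s" "s < h" "?D = h * (A s h - A s 0)"
      by (auto simp: algebra_simps)
    have "\<exists>t>0. t < h \<and> A s h - A s 0 = (h - 0) * AB s t"
      by (rule MVT2[of 0 h "\<lambda>t. A s t"]) (use h s in \<open>auto intro!: AB\<close>)
    then obtain t where t: "0 < t" "t < h" "?D = h * (h * AB s t)"
      using s by auto
    have "\<exists>t>0. t < h \<and> (U h h - U 0 h) - (U h 0 - U 0 0) = (h - 0) * (B h t - B 0 t)"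
      by (rule MVT2[of 0 h "\<lambda>t. U h t - U 0 t"]) (use h in \<open>auto intro!: DERIV_diff B\<close>)
    then obtain t' where t': "0 < t'" "t' < h" "?D = h * (B h t' - B 0 t')"
      by (auto simp: algebra_simps)
    have "\<exists>s>0. s < h \<and> B h t' - B 0 t' = (h - 0) * BA s t'"
      by (rule MVT2[of 0 h "\<lambda>s. B s t'"]) (use h t' in \<open>auto intro!: BA\<close>)
    then obtain s' where s': "0 < s'" "s' < h" "?D = h * (h * BA s' t')"
      using t' by auto
    from t(3) s'(3) h have "AB s t = BA s' t'" by simp
    then show ?thesis using s t s' t' by (intro exI[of _ s] exI[of _ t] exI[of _ s'] exI[of _ t']) auto
  qed
  show ?thesis
  proof (rule ccontr)
    assume "AB 0 0 \<noteq> BA 0 0"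
    define e where "e = dist (AB 0 0) (BA 0 0) / 2"
    have e: "e > 0" using \<open>AB 0 0 \<noteq> BA 0 0\<close> by (simp add: e_def)
    obtain d1 where d1: "d1 > 0" "\<And>p. dist p (0,0) < d1 \<Longrightarrow> dist (AB (fst p) (snd p)) (AB 0 0) < e"
      using c(1) e unfolding continuous_at_eps_delta by (auto; metis)
    obtain d2 where d2: "d2 > 0" "\<And>p. dist p (0,0) < d2 \<Longrightarrow> dist (BA (fst p) (snd p)) (BA 0 0) < e"
      using c(2) e unfolding continuous_at_eps_delta by (auto; metis)
    define h where "h = min (min d1 d2) d / 2"
    have h: "0 < h" "h < d" "2 * h \<le> d1" "2 * h \<le> d2" using d d1 d2 by (auto simp: h_def)
    obtain s t s' t' where st: "\<bar>s\<bar> < h" "\<bar>t\<bar> < h" "\<bar>s'\<bar> < h" "\<bar>t'\<bar> < h" "AB s t = BA s' t'"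
      using ex[OF h(1,2)] by auto
    have near: "dist (a, b) (0, 0) < 2 * h" if "\<bar>a\<bar> < h" "\<bar>b\<bar> < h" for a b :: real
    proof -
      have "dist (a, b) (0, 0) \<le> \<bar>a\<bar> + \<bar>b\<bar>"
        by (simp add: dist_Pair_Pair dist_real_def sqrt_sum_squares_le_sum_abs)
      then show ?thesis using that by linarith
    qed
    have "dist (AB s t) (AB 0 0) < e" using d1(2)[of "(s, t)"] near[OF st(1,2)] h by simp
    moreover have "dist (BA s' t') (BA 0 0) < e" using d2(2)[of "(s', t')"] near[OF st(3,4)] h by simp
    ultimately have "dist (AB 0 0) (BA 0 0) < 2 * e"
      using st(5) dist_triangle2[of "AB 0 0" "BA 0 0" "AB s t"] by (simp add: dist_commute)
    then show False by (simp add: e_def)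
  qed
qed

lemma pd_commute:
  assumes \<Omega>: "open \<Omega>" "smooth_on \<Omega> f" "x \<in> \<Omega>"
  shows "pd i (pd j f) x = pd j (pd i f) x"
proof -
  define \<gamma> where "\<gamma> s t = x + s *\<^sub>R axis i (1::real) + t *\<^sub>R axis j 1" for s t
  have "open ((\<lambda>p. \<gamma> (fst p) (snd p)) -` \<Omega>)"
    unfolding \<gamma>_def by (rule open_vimage) (auto intro!: continuous_intros \<Omega>)
  then obtain e where e: "e > 0" "ball (0,0) e \<subseteq> (\<lambda>p. \<gamma> (fst p) (snd p)) -` \<Omega>"
    using \<Omega>(3) unfolding open_contains_ball
    by (metis (mono_tags, lifting) \<gamma>_def add.right_neutral fst_conv scaleR_zero_left snd_conv vimageI2)
  define d where "d = e / 2"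
  have d: "d > 0" using e by (simp add: d_def)
  have in\<Omega>: "\<gamma> s t \<in> \<Omega>" if "\<bar>s\<bar> < d" "\<bar>t\<bar> < d" for s t
  proof -
    have "dist (s, t) (0, 0) \<le> \<bar>s\<bar> + \<bar>t\<bar>"
      by (simp add: dist_Pair_Pair dist_real_def sqrt_sum_squares_le_sum_abs)
    then have "(s, t) \<in> ball (0,0) e" using that by (simp add: d_def dist_commute)
    then show ?thesis using e(2) by auto
  qed
  have sd: "((\<lambda>s. g (\<gamma> s t)) has_vector_derivative pd i g (\<gamma> s t)) (at s)"
    if "smooth_on \<Omega> g" "\<bar>s\<bar> < d" "\<bar>t\<bar> < d" for g s t
    using has_vector_derivative_pd[of g "x + t *\<^sub>R axis j 1" s i]
      smooth_on_imp_differentiable[OF that(1) in\<Omega>[OF that(2,3)]]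
    by (simp add: \<gamma>_def algebra_simps)
  have td: "((\<lambda>t. g (\<gamma> s t)) has_vector_derivative pd j g (\<gamma> s t)) (at t)"
    if "smooth_on \<Omega> g" "\<bar>s\<bar> < d" "\<bar>t\<bar> < d" for g s t
    using has_vector_derivative_pd[of g "x + s *\<^sub>R axis i 1" t j]
      smooth_on_imp_differentiable[OF that(1) in\<Omega>[OF that(2,3)]]
    by (simp add: \<gamma>_def algebra_simps)
  have ct: "isCont (\<lambda>p. g (\<gamma> (fst p) (snd p))) (0, 0)" if "smooth_on \<Omega> g" for g
  proof -
    have "isCont g (\<gamma> 0 0)"
      using smooth_on_imp_differentiable[OF that in\<Omega>[of 0 0]] d
      by (auto simp: differentiable_imp_continuous_within)
    moreover have "isCont (\<lambda>p. \<gamma> (fst p) (snd p)) (0, 0)"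
      unfolding \<gamma>_def by (auto intro!: continuous_intros)
    ultimately show ?thesis
      using isCont_o2[of "(0,0)" "\<lambda>p. \<gamma> (fst p) (snd p)" g] by simp
  qed
  have Re': "((\<lambda>s. Re (g s)) has_real_derivative Re D) (at s)"
    and Im': "((\<lambda>s. Im (g s)) has_real_derivative Im D) (at s)"
    if "(g has_vector_derivative D) (at s)" for g D s
    using bounded_linear.has_vector_derivative[OF bounded_linear_Re that]
      bounded_linear.has_vector_derivative[OF bounded_linear_Im that]
    by (simp_all add: has_real_derivative_iff_has_vector_derivative)
  note sm = \<Omega>(2) smooth_on_pd[OF \<Omega>(2)]
  have "Re (pd j (pd i f) (\<gamma> 0 0)) = Re (pd i (pd j f) (\<gamma> 0 0))"
    by (rule mixed_derivatives_eq[OF d, where U = "\<lambda>s t. Re (f (\<gamma> s t))" and A = "\<lambda>s t. Re (pd i f (\<gamma> s t))"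
          and B = "\<lambda>s t. Re (pd j f (\<gamma> s t))"])
       (auto intro!: Re' sd td sm continuous_Re ct smooth_on_pd)
  moreover have "Im (pd j (pd i f) (\<gamma> 0 0)) = Im (pd i (pd j f) (\<gamma> 0 0))"
    by (rule mixed_derivatives_eq[OF d, where U = "\<lambda>s t. Im (f (\<gamma> s t))" and A = "\<lambda>s t. Im (pd i f (\<gamma> s t))"
          and B = "\<lambda>s t. Im (pd j f (\<gamma> s t))"])
       (auto intro!: Im' sd td sm continuous_Im ct smooth_on_pd)
  ultimately show ?thesis
    by (simp add: complex_eq_iff \<gamma>_def)
qed

lemma pd_pds_commute:
  assumes "open \<Omega>" "smooth_on \<Omega> f" "x \<in> \<Omega>"
  shows "pd i (pds is f) x = pds is (pd i f) x"
  using assms(3)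
proof (induction "is" arbitrary: x)
  case (Cons j "is")
  have "pd i (pds (j # is) f) x = pd j (pd i (pds is f)) x"
    using pd_commute[OF assms(1) smooth_on_pds[OF assms(2)] Cons.prems] by simp
  also have "\<dots> = pd j (pds is (pd i f)) x"
    by (rule pd_cong[OF assms(1)]) (use Cons in auto)
  finally show ?case by simp
qed simp

lemma pds_perm:
  assumes "open \<Omega>" "smooth_on \<Omega> f" "x \<in> \<Omega>" "mset is = mset js"
  shows "pds is f x = pds js f x"
  using assms(2-)
proof (induction "is" arbitrary: js f rule: rev_induct)
  case (snoc i "is")
  obtain as bs where js: "js = as @ i # bs" "mset is = mset (as @ bs)"
  proof -
    have "i \<in> set js" using snoc.prems(3) by (metis in_set_conv_decomp set_mset_mset)
    then obtain as bs where "js = as @ i # bs" by (meson split_list)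
    then show thesis using snoc.prems(3) by (intro that[of as bs]) auto
  qed
  have "pds (is @ [i]) f x = pds is (pd i f) x" by simp
  also have "\<dots> = pds (as @ bs) (pd i f) x"
    by (rule snoc.IH) (use snoc.prems js smooth_on_pd in auto)
  also have "\<dots> = pds as (pds bs (pd i f)) x" by simp
  also have "\<dots> = pds as (pd i (pds bs f)) x"
    by (rule pds_cong[OF assms(1)]) (use pd_pds_commute[OF assms(1) snoc.prems(1)] snoc.prems in auto)
  finally show ?case by (simp add: js)
qed auto

text \<open>The list chosen in the definition of \<open>mpd\<close>.\<close>

definition mi_list :: "'n::finite multi_index \<Rightarrow> 'n list" where
  "mi_list \<alpha> = (SOME is. \<forall>i. count_list is i = \<alpha> i)"

lemma mpd_eq_pds: "mpd \<alpha> f = pds (mi_list \<alpha>) f"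
  by (simp add: mpd_def mi_list_def)

lemma count_list_eq_count_mset: "count_list is i = count (mset is) i"
  by (induction "is") auto

lemma count_list_mi_list: "count_list (mi_list \<alpha>) i = \<alpha> i"
proof -
  obtain js where js: "mset js = Abs_multiset \<alpha>" using ex_mset by blast
  have "count (Abs_multiset \<alpha>) = \<alpha>"
    by (rule Abs_multiset_inverse) simp
  then have "\<forall>i. count_list js i = \<alpha> i" by (simp add: count_list_eq_count_mset js)
  then have "\<forall>i. count_list (mi_list \<alpha>) i = \<alpha> i"
    unfolding mi_list_def by (rule someI)
  then show ?thesis by simp
qed

lemma mi_list_eqI: "(\<And>i. count_list is i = \<alpha> i) \<Longrightarrow> mset (mi_list \<alpha>) = mset is"
  by (rule multiset_eqI) (simp add: count_list_mi_list flip: count_list_eq_count_mset)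

lemma length_mi_list: "length (mi_list \<alpha>) = mi_abs \<alpha>"
proof -
  have "length is = (\<Sum>i\<in>UNIV. count_list is i)" for "is" :: "'a list"
  proof (induction "is")
    case (Cons a "is")
    have "(\<Sum>i\<in>UNIV. count_list (a # is) i) = (\<Sum>i\<in>UNIV. (if a = i then 1 else 0) + count_list is i)"
      by (rule sum.cong) auto
    then show ?case using Cons by (simp add: sum.distrib)
  qed simp
  then show ?thesis by (simp add: mi_abs_def count_list_mi_list)
qed

lemma pds_eq_mpd:
  assumes "open \<Omega>" "smooth_on \<Omega> f" "x \<in> \<Omega>"
  shows "pds is f x = mpd (count_list is) f x"
  unfolding mpd_eq_pds by (rule pds_perm[OF assms]) (simp add: mi_list_eqI)

section \<open>Smooth cutoff functions\<close>

lemma smooth_on_component: fixes i :: "'n::finite" shows "smooth_on \<Omega> (\<lambda>x. complex_of_real (x $ i))"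
  unfolding smooth_on_iff_diff_upto
proof
  fix n
  have d: "((\<lambda>x. complex_of_real (x $ i)) has_derivative (\<lambda>h. complex_of_real (h $ i))) (at x)" for x :: "real^'n"
    by (auto intro!: derivative_eq_intros bounded_linear_imp_has_derivative
        bounded_linear_compose[OF bounded_linear_of_real] bounded_linear_vec_nth)
  have "pd j (\<lambda>x. complex_of_real (x $ i)) = (\<lambda>x. complex_of_real (axis j 1 $ i))" for j :: 'n
    using has_derivative_imp_pd[OF d] by (simp add: fun_eq_iff)
  then have "diff_upto (Suc n) \<Omega> (\<lambda>x. complex_of_real (x $ i))"
    using d by (auto simp: diff_upto_Suc diff_upto_const differentiable_def)
  then show "diff_upto n \<Omega> (\<lambda>x. complex_of_real (x $ i))" by (rule diff_upto_lower)
qed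

text \<open>The chain rule expresses the first derivatives of \<open>g k \<circ> q\<close> by \<open>g (Suc k) \<circ> q\<close>, so that the
  order of differentiability increases for all members of the sequence \<open>g\<close> at once.\<close>

lemma smooth_on_comp_real:
  fixes g :: "nat \<Rightarrow> real \<Rightarrow> real" and q :: "real^'n::finite \<Rightarrow> real"
  assumes g: "\<And>k t. (g k has_real_derivative g (Suc k) t) (at t)"
    and "open \<Omega>" "smooth_on \<Omega> (\<lambda>x. complex_of_real (q x))"
  shows "smooth_on \<Omega> (\<lambda>x. complex_of_real (g k (q x)))"
  unfolding smooth_on_iff_diff_upto
proof
  fix n
  have d: "((\<lambda>x. complex_of_real (g k (q x))) has_derivative
        (\<lambda>h. complex_of_real (g (Suc k) (q x)) * q' h)) (at x)"
    if q': "((\<lambda>x. complex_of_real (q x)) has_derivative q') (at x)" for k x q'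
  proof -
    have q: "(q has_derivative (\<lambda>h. Re (q' h))) (at x)"
      using has_derivative_Re[OF q'] by simp
    have "((\<lambda>x. g k (q x)) has_derivative (\<lambda>h. g (Suc k) (q x) * Re (q' h))) (at x)"
      using DERIV_compose_FDERIV[OF g q, of k] by (simp add: mult.commute)
    then have "((\<lambda>x. complex_of_real (g k (q x))) has_derivative
        (\<lambda>h. complex_of_real (g (Suc k) (q x) * Re (q' h)))) (at x)"
      by (rule has_derivative_of_real)
    moreover have "complex_of_real (Re (q' h)) = q' h" for h
      using has_derivative_unique[OF has_derivative_of_real[OF q] q'] by metis
    ultimately show ?thesis by simp
  qed
  show "diff_upto n \<Omega> (\<lambda>x. complex_of_real (g k (q x)))"
  proof (induction n arbitrary: k)
    case 0
    then show ?case
      using d smooth_on_imp_differentiable[OF assms(3)] by (auto simp: diff_upto_0 differentiable_def; blast)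
  next
    case (Suc n)
    show ?case unfolding diff_upto_Suc
    proof (intro conjI ballI allI)
      fix x assume "x \<in> \<Omega>"
      then show "(\<lambda>x. complex_of_real (g k (q x))) differentiable at x"
        using d smooth_on_imp_differentiable[OF assms(3)] by (auto simp: differentiable_def; blast)
    next
      fix i
      have "diff_upto n \<Omega> (\<lambda>x. complex_of_real (g (Suc k) (q x)) * pd i (\<lambda>x. complex_of_real (q x)) x)"
        using Suc assms smooth_on_pd[OF assms(3)] by (intro diff_upto_mult) (auto simp: smooth_on_iff_diff_upto)
      moreover have "complex_of_real (g (Suc k) (q x)) * pd i (\<lambda>x. complex_of_real (q x)) x =
          pd i (\<lambda>x. complex_of_real (g k (q x))) x" if x: "x \<in> \<Omega>" for x
      proof -
        obtain q' where q': "((\<lambda>x. complex_of_real (q x)) has_derivative q') (at x)"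
          using smooth_on_imp_differentiable[OF assms(3) x] by (auto simp: differentiable_def)
        show ?thesis
          using has_derivative_imp_pd[OF q'] has_derivative_imp_pd[OF d[OF q']] by simp
      qed
      ultimately show "diff_upto n \<Omega> (pd i (\<lambda>x. complex_of_real (g k (q x))))"
        by (rule diff_upto_cong[OF assms(2), rotated])
    qed
  qed
qed

text \<open>The function \<open>e\<^bsup>-1/t\<^esup>\<close>, continued by \<open>0\<close> to \<open>t \<le> 0\<close>, and its derivatives, which are
  \<open>p(1/t) e\<^bsup>-1/t\<^esup>\<close> with polynomials \<open>p\<close>.\<close>

fun flat_poly :: "nat \<Rightarrow> real poly" where
  "flat_poly 0 = 1"
| "flat_poly (Suc k) = [:0, 0, 1:] * (flat_poly k - pderiv (flat_poly k))"

definition flat :: "nat \<Rightarrow> real \<Rightarrow> real" where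
  "flat k t = (if t > 0 then poly (flat_poly k) (1 / t) * exp (- (1 / t)) else 0)"

lemma poly_exp_tendsto_0:
  "((\<lambda>t. poly p (1 / t) * exp (- (1 / t))) \<longlongrightarrow> (0::real)) (at_right 0)"
proof -
  have "((\<lambda>x. \<Sum>i\<le>degree p. coeff p i * (x ^ i / exp x)) \<longlongrightarrow> (\<Sum>i\<le>degree p. coeff p i * 0)) at_top"
    by (intro tendsto_intros tendsto_power_div_exp_0)
  then have "((\<lambda>x::real. poly p x * exp (- x)) \<longlongrightarrow> 0) at_top"
    by (simp add: poly_altdef exp_minus sum_distrib_right divide_inverse mult.assoc)
  from filterlim_compose[OF this filterlim_inverse_at_top_right] show ?thesis
    by (simp add: inverse_eq_divide)
qed

lemma flat_DERIV: "(flat k has_real_derivative flat (Suc k) t) (at t)"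
proof -
  consider "t > 0" | "t < 0" | "t = 0" by linarith
  then show ?thesis
  proof cases
    case 1
    have "((\<lambda>t. poly (flat_poly k) (1 / t) * exp (- (1 / t))) has_real_derivative flat (Suc k) t) (at t)"
      using 1 by (auto intro!: derivative_eq_intros DERIV_chain2[OF poly_DERIV]
          simp: flat_def field_simps power2_eq_square)
    then show ?thesis
      by (rule has_field_derivative_transform_within_open[where S = "{0<..}"]) (use 1 in \<open>auto simp: flat_def\<close>)
  next
    case 2
    have "((\<lambda>t. 0) has_real_derivative flat (Suc k) t) (at t)"
      using 2 by (auto simp: flat_def)
    then show ?thesis
      by (rule has_field_derivative_transform_within_open[where S = "{..<0}"]) (use 2 in \<open>auto simp: flat_def\<close>)
  next
    case 3
    have "((\<lambda>h. flat k h / h) \<longlongrightarrow> 0) (at_right 0)"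
    proof (rule Lim_transform_eventually[OF poly_exp_tendsto_0[of "[:0, 1:] * flat_poly k"]])
      show "\<forall>\<^sub>F t in at_right 0. poly ([:0, 1:] * flat_poly k) (1 / t) * exp (- (1 / t)) = flat k t / t"
        using eventually_at_right_less[of "0::real"] by eventually_elim (auto simp: flat_def)
    qed
    moreover have "((\<lambda>h. flat k h / h) \<longlongrightarrow> 0) (at_left 0)"
    proof (rule Lim_transform_eventually[OF tendsto_const])
      show "\<forall>\<^sub>F t in at_left 0. 0 = flat k t / t"
        unfolding eventually_at_filter by (auto simp: flat_def)
    qed
    ultimately have "((\<lambda>h. flat k h / h) \<longlongrightarrow> 0) (at 0)"
      by (simp add: filterlim_split_at)
    then show ?thesis
      using 3 by (simp add: has_field_derivative_def has_derivative_at flat_def DERIV_def flip: has_field_derivative_def)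
  qed
qed

lemma flat_0: "flat 0 t = (if t > 0 then exp (- (1 / t)) else 0)"
  by (simp add: flat_def)

lemma smooth_on_flat:
  "open \<Omega> \<Longrightarrow> smooth_on \<Omega> (\<lambda>x. complex_of_real (q x)) \<Longrightarrow> smooth_on \<Omega> (\<lambda>x. complex_of_real (flat 0 (q x)))"
  by (rule smooth_on_comp_real[where g = flat and k = 0, OF flat_DERIV])

text \<open>The functions \<open>flat 0 (r\<^sup>2 - |x - a|\<^sup>2)\<close> are smooth and positive exactly on the balls of radius
  \<open>r\<close> about \<open>a\<close>. Finitely many of them have a sum \<open>\<Psi>\<close> that is at least some \<open>\<delta> > 0\<close> on \<open>K\<close>; it
  remains to compose \<open>\<Psi>\<close> with a smooth step.\<close>

lemma smooth_cutoff:
  fixes K :: "(real^'n::finite) set"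
  assumes K: "compact K" and \<Omega>: "open \<Omega>" "K \<subseteq> \<Omega>"
  obtains \<phi> :: "real^'n \<Rightarrow> real" and L V where
    "smooth_on UNIV (\<lambda>x. complex_of_real (\<phi> x))" "compact L" "L \<subseteq> \<Omega>" "\<And>x. x \<notin> L \<Longrightarrow> \<phi> x = 0"
    "open V" "K \<subseteq> V" "\<And>x. x \<in> V \<Longrightarrow> \<phi> x = 1" "\<And>x. 0 \<le> \<phi> x"
proof -
  have "\<exists>r>0. cball x r \<subseteq> \<Omega>" if "x \<in> K" for x
    using that \<Omega> open_contains_cball by blast
  then obtain r where r: "\<And>x. x \<in> K \<Longrightarrow> r x > 0 \<and> cball x (r x) \<subseteq> \<Omega>" by metis
  obtain D where D: "D \<subseteq> K" "finite D" "K \<subseteq> (\<Union>x\<in>D. ball x (r x))"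
    using compactE_image[OF K, of K "\<lambda>x. ball x (r x)"] r by (metis (no_types, lifting) UN_iff centre_in_ball open_ball subsetI)
  define \<psi> where "\<psi> a x = flat 0 ((r a)\<^sup>2 - (\<Sum>i\<in>UNIV. (x $ i - a $ i)\<^sup>2))" for a x
  define \<Psi> where "\<Psi> x = (\<Sum>a\<in>D. \<psi> a x)" for x
  have sq: "(\<Sum>i\<in>UNIV. (x $ i - a $ i)\<^sup>2) = (dist x a)\<^sup>2" for a x :: "real^'n"
  proof -
    have "(norm (x - a))\<^sup>2 = (\<Sum>i\<in>UNIV. (norm ((x - a) $ i))\<^sup>2)"
      unfolding norm_vec_def L2_set_def by (rule real_sqrt_pow2) (intro sum_nonneg zero_le_power2)
    then show ?thesis unfolding dist_norm by simp
  qed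
  have \<psi>_pos: "\<psi> a x > 0 \<longleftrightarrow> x \<in> ball a (r a)" if "a \<in> D" for a x
  proof -
    have "r a > 0" using r D(1) that by auto
    then have "(dist a x)\<^sup>2 < (r a)\<^sup>2 \<longleftrightarrow> dist a x < r a"
      by (metis less_eq_real_def power2_less_imp_less power_strict_mono zero_le_dist pos2)
    then show ?thesis unfolding \<psi>_def flat_0 sq dist_commute[of x a] by simp
  qed
  have \<psi>_nonneg: "\<psi> a x \<ge> 0" for a x by (simp add: \<psi>_def flat_0)
  have "smooth_on UNIV (\<lambda>x. complex_of_real (\<psi> a x))" for a
  proof -
    have "smooth_on UNIV (\<lambda>x. complex_of_real ((r a)\<^sup>2) -
        (\<Sum>i\<in>UNIV. (complex_of_real (x $ i) - complex_of_real (a $ i)) * (complex_of_real (x $ i) - complex_of_real (a $ i))))"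
      by (intro smooth_on_diff smooth_on_sum smooth_on_mult smooth_on_const smooth_on_component open_UNIV)
    then show ?thesis unfolding \<psi>_def
      by (intro smooth_on_flat) (simp_all add: power2_eq_square)
  qed
  then have sm: "smooth_on UNIV (\<lambda>x. complex_of_real (\<Psi> x))"
    unfolding \<Psi>_def of_real_sum by (intro smooth_on_sum open_UNIV)
  have cont: "continuous_on UNIV \<Psi>"
    using continuous_on_Re[OF smooth_on_imp_continuous_on[OF sm]] by simp
  have \<Psi>_nonneg: "\<Psi> x \<ge> 0" for x unfolding \<Psi>_def by (intro sum_nonneg \<psi>_nonneg)
  have \<Psi>_pos: "\<Psi> x > 0 \<longleftrightarrow> x \<in> (\<Union>a\<in>D. ball a (r a))" for x
  proof -
    have "\<Psi> x = 0 \<longleftrightarrow> (\<forall>a\<in>D. \<psi> a x = 0)"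
      unfolding \<Psi>_def using D(2) \<psi>_nonneg by (intro sum_nonneg_eq_0_iff) auto
    moreover have "\<psi> a x = 0 \<longleftrightarrow> \<not> x \<in> ball a (r a)" if "a \<in> D" for a
      using \<psi>_nonneg[of a x] \<psi>_pos[OF that, of x] by linarith
    ultimately show ?thesis using \<Psi>_nonneg[of x] by (auto simp: less_le)
  qed
  obtain \<delta> where \<delta>: "\<delta> > 0" "\<And>x. x \<in> K \<Longrightarrow> \<Psi> x \<ge> \<delta>"
  proof (cases "K = {}")
    case False
    obtain x0 where "x0 \<in> K" "\<And>x. x \<in> K \<Longrightarrow> \<Psi> x0 \<le> \<Psi> x"
      using continuous_attains_inf[OF K False continuous_on_subset[OF cont]] by auto
    moreover have "\<Psi> x0 > 0" using \<Psi>_pos[of x0] D(3) \<open>x0 \<in> K\<close> by blast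
    ultimately show ?thesis using that[of "\<Psi> x0"] by blast
  qed (use that[of 1] in auto)
  \<comment> \<open>With \<open>g = flat 0\<close> the function \<open>t \<mapsto> g (g 1 - g (1 - t))\<close> vanishes for \<open>t \<le> 0\<close>, because then
    \<open>g (1 - t) \<ge> g 1\<close>, and is the constant \<open>g (g 1)\<close> for \<open>t \<ge> 1\<close>.\<close>
  define \<phi> where "\<phi> x = flat 0 (flat 0 1 - flat 0 (1 - 2 / \<delta> * \<Psi> x)) * (1 / flat 0 (flat 0 1))" for x
  have p: "flat 0 (flat 0 1) > 0" "flat 0 1 > 0" by (simp_all add: flat_0)
  show thesis
  proof (rule that[of \<phi> "\<Union>a\<in>D. cball a (r a)" "{x. \<Psi> x > \<delta> / 2}"])
    have "smooth_on UNIV (\<lambda>x. complex_of_real 1 - complex_of_real (2 / \<delta>) * complex_of_real (\<Psi> x))"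
      by (intro smooth_on_diff smooth_on_cmult smooth_on_const sm open_UNIV)
    then have "smooth_on UNIV (\<lambda>x. complex_of_real (flat 0 (1 - 2 / \<delta> * \<Psi> x)))"
      by (intro smooth_on_flat) simp_all
    then have "smooth_on UNIV (\<lambda>x. complex_of_real (flat 0 1) - complex_of_real (flat 0 (1 - 2 / \<delta> * \<Psi> x)))"
      by (intro smooth_on_diff smooth_on_const open_UNIV)
    then have "smooth_on UNIV (\<lambda>x. complex_of_real (flat 0 (flat 0 1 - flat 0 (1 - 2 / \<delta> * \<Psi> x))))"
      by (intro smooth_on_flat) simp_all
    then show "smooth_on UNIV (\<lambda>x. complex_of_real (\<phi> x))"
      unfolding \<phi>_def of_real_mult by (intro smooth_on_mult smooth_on_const open_UNIV)
    show "compact (\<Union>a\<in>D. cball a (r a))" by (intro compact_UN D compact_cball)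
    show "(\<Union>a\<in>D. cball a (r a)) \<subseteq> \<Omega>" using r D(1) by auto
    show "\<phi> x = 0" if "x \<notin> (\<Union>a\<in>D. cball a (r a))" for x
    proof -
      have "\<Psi> x = 0" using that \<Psi>_pos[of x] \<Psi>_nonneg[of x] by (force simp: not_less)
      then show ?thesis by (simp add: \<phi>_def flat_0)
    qed
    show "open {x. \<Psi> x > \<delta> / 2}"
      by (rule open_Collect_less) (auto intro: cont continuous_intros)
    show "K \<subseteq> {x. \<Psi> x > \<delta> / 2}" using \<delta> by fastforce
    show "\<phi> x = 1" if "x \<in> {x. \<Psi> x > \<delta> / 2}" for x
    proof -
      have "flat 0 (1 - 2 / \<delta> * \<Psi> x) = 0" using that \<delta>(1) by (simp add: flat_0 field_simps)
      then show ?thesis using p by (simp add: \<phi>_def)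
    qed
    show "0 \<le> \<phi> x" for x by (simp add: \<phi>_def flat_0)
  qed
qed

section \<open>Exponential functions\<close>

text \<open>The function \<open>e\<^bsup>ixz\<^esup>\<close> on \<open>\<real>\<^sup>n\<close>, for \<open>z \<in> \<complex>\<^sup>n\<close>.\<close>

definition cexp :: "complex^'n::finite \<Rightarrow> real^'n \<Rightarrow> complex" where
  "cexp z x = exp (\<i> * (\<Sum>j\<in>UNIV. complex_of_real (x $ j) * z $ j))"

definition Im_vec :: "complex^'n \<Rightarrow> real^'n" where "Im_vec z = (\<chi> j. Im (z $ j))"

lemma norm_cexp: "norm (cexp z x) = exp (- (x \<bullet> Im_vec z))"
  by (simp add: cexp_def norm_exp_eq_Re sum_negf Im_vec_def inner_vec_def)

lemma norm_cexp_le: "norm x \<le> r \<Longrightarrow> norm (cexp z x) \<le> exp (r * norm (Im_vec z))"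
proof -
  assume "norm x \<le> r"
  then have "norm x * norm (Im_vec z) \<le> r * norm (Im_vec z)" by (rule mult_right_mono) simp
  moreover have "- (x \<bullet> Im_vec z) \<le> norm x * norm (Im_vec z)"
    using Cauchy_Schwarz_ineq2[of x "Im_vec z"] by linarith
  ultimately show ?thesis by (simp add: norm_cexp)
qed

lemma cexp_minus: "cexp z x * cexp (- z) x = 1"
  by (simp add: cexp_def sum_negf flip: exp_add)

lemma cexp_has_derivative:
  "(cexp z has_derivative (\<lambda>h. \<i> * (\<Sum>j\<in>UNIV. complex_of_real (h $ j) * z $ j) * cexp z x)) (at x)"
proof -
  have "((\<lambda>x. \<i> * (\<Sum>j\<in>UNIV. complex_of_real (x $ j) * z $ j)) has_derivative
      (\<lambda>h. \<i> * (\<Sum>j\<in>UNIV. complex_of_real (h $ j) * z $ j))) (at x)"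
    by (intro bounded_linear_imp_has_derivative bounded_linear_mult_right[THEN bounded_linear_compose]
        bounded_linear_sum bounded_linear_mult_left[THEN bounded_linear_compose]
        bounded_linear_of_real[THEN bounded_linear_compose] bounded_linear_vec_nth)
  from has_derivative_compose[OF this DERIV_exp[unfolded has_field_derivative_def]] show ?thesis
    unfolding cexp_def by (simp add: algebra_simps)
qed

lemma pd_cexp: "pd i (cexp z) x = \<i> * z $ i * cexp z x"
  using has_derivative_imp_pd[OF cexp_has_derivative, of i z x]
  by (simp add: axis_def if_distrib if_distribR cong: if_cong)

lemma pd_cmult_cexp: "pd i (\<lambda>x. c * cexp z x) = (\<lambda>x. (\<i> * z $ i * c) * cexp z x)"
proof
  fix x
  have "cexp z differentiable at x" using cexp_has_derivative by (auto simp: differentiable_def)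
  then show "pd i (\<lambda>x. c * cexp z x) x = (\<i> * z $ i * c) * cexp z x"
    by (simp add: pd_cmult pd_cexp)
qed

lemma pds_cexp: "pds is (cexp z) = (\<lambda>x. prod_list (map (\<lambda>i. \<i> * z $ i) is) * cexp z x)"
  by (induction "is") (simp_all add: pd_cmult_cexp)

lemma smooth_on_cexp: "smooth_on \<Omega> (cexp z)"
  unfolding smooth_on_def pds_cexp
  using cexp_has_derivative by (auto simp: differentiable_def intro!: exI has_derivative_mult_right)

lemma prod_list_mi_list: "prod_list (map (\<lambda>i. f i) (mi_list \<alpha>)) = (\<Prod>i\<in>UNIV. f i ^ \<alpha> i)"
  for f :: "'n::finite \<Rightarrow> complex"
proof -
  have "prod_list (map f is) = (\<Prod>i\<in>UNIV. f i ^ count_list is i)" for "is"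
  proof (induction "is")
    case (Cons a "is")
    have "(\<Prod>i\<in>UNIV. f i ^ count_list (a # is) i) = (\<Prod>i\<in>UNIV. (if a = i then f i else 1) * f i ^ count_list is i)"
      by (rule prod.cong) auto
    also have "\<dots> = f a * (\<Prod>i\<in>UNIV. f i ^ count_list is i)"
      by (simp add: prod.distrib)
    finally show ?case using Cons by simp
  qed simp
  then show ?thesis by (simp add: count_list_mi_list)
qed

section \<open>Growth of nets\<close>

lemma eventually_unit: "eventually (\<lambda>\<epsilon>::real. \<epsilon> \<in> {0<..1}) (at_right 0)"
  using eventually_at_right_real[of 0 1] by (auto elim: eventually_mono)

text \<open>Unlike estimates of \<open>sup_abs\<close>, this uniform estimate passes to sums and products without regard
  to the existence of suprema.\<close>

definition bigo_on :: "(real^'n) set \<Rightarrow> real \<Rightarrow> 'n fnet \<Rightarrow> bool" where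
  "bigo_on K p u \<longleftrightarrow> (\<exists>C. \<forall>\<^sub>F \<epsilon> in at_right 0. \<forall>x\<in>K. norm (u \<epsilon> x) \<le> C * \<epsilon> powr p)"

lemma bigo_on_cong:
  assumes "bigo_on K p u" "\<And>\<epsilon> x. \<epsilon> \<in> {0<..1} \<Longrightarrow> x \<in> K \<Longrightarrow> norm (v \<epsilon> x) \<le> norm (u \<epsilon> x)"
  shows "bigo_on K p v"
proof -
  obtain C where "\<forall>\<^sub>F \<epsilon> in at_right 0. \<forall>x\<in>K. norm (u \<epsilon> x) \<le> C * \<epsilon> powr p"
    using assms(1) by (auto simp: bigo_on_def)
  then have "\<forall>\<^sub>F \<epsilon> in at_right 0. \<forall>x\<in>K. norm (v \<epsilon> x) \<le> C * \<epsilon> powr p"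
    using eventually_unit by eventually_elim (use assms(2) order_trans in blast)
  then show ?thesis by (auto simp: bigo_on_def)
qed

lemma bigo_on_pos:
  assumes "bigo_on K p u"
  obtains C where "C > 0" "\<forall>\<^sub>F \<epsilon> in at_right 0. \<forall>x\<in>K. norm (u \<epsilon> x) \<le> C * \<epsilon> powr p"
proof -
  obtain C where C: "\<forall>\<^sub>F \<epsilon> in at_right 0. \<forall>x\<in>K. norm (u \<epsilon> x) \<le> C * \<epsilon> powr p"
    using assms by (auto simp: bigo_on_def)
  have "\<forall>\<^sub>F \<epsilon> in at_right 0. \<forall>x\<in>K. norm (u \<epsilon> x) \<le> (\<bar>C\<bar> + 1) * \<epsilon> powr p"
    using C
  proof eventually_elim
    case (elim \<epsilon>)
    have "C * \<epsilon> powr p \<le> (\<bar>C\<bar> + 1) * \<epsilon> powr p" by (rule mult_right_mono) auto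
    then show ?case using elim by force
  qed
  then show thesis by (intro that[of "\<bar>C\<bar> + 1"]) auto
qed

lemma bigo_on_weaken:
  assumes "bigo_on K p u" "q \<le> p" "K' \<subseteq> K"
  shows "bigo_on K' q u"
proof -
  obtain C where C: "C > 0" "\<forall>\<^sub>F \<epsilon> in at_right 0. \<forall>x\<in>K. norm (u \<epsilon> x) \<le> C * \<epsilon> powr p"
    using assms(1) by (rule bigo_on_pos)
  have "\<forall>\<^sub>F \<epsilon> in at_right 0. \<forall>x\<in>K'. norm (u \<epsilon> x) \<le> C * \<epsilon> powr q"
    using C(2) eventually_unit
  proof eventually_elim
    case (elim \<epsilon>)
    have "C * \<epsilon> powr p \<le> C * \<epsilon> powr q"
      using C(1) elim(2) assms(2) by (intro mult_left_mono powr_mono') auto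
    then show ?case using elim assms(3) by force
  qed
  then show ?thesis by (auto simp: bigo_on_def)
qed

lemma bigo_on_Un: "bigo_on K p u \<Longrightarrow> bigo_on K' p u \<Longrightarrow> bigo_on (K \<union> K') p u"
proof -
  assume "bigo_on K p u" "bigo_on K' p u"
  then obtain C C' where C: "\<forall>\<^sub>F \<epsilon> in at_right 0. \<forall>x\<in>K. norm (u \<epsilon> x) \<le> C * \<epsilon> powr p"
    "\<forall>\<^sub>F \<epsilon> in at_right 0. \<forall>x\<in>K'. norm (u \<epsilon> x) \<le> C' * \<epsilon> powr p"
    by (auto simp: bigo_on_def)
  have "\<forall>\<^sub>F \<epsilon> in at_right 0. \<forall>x\<in>K \<union> K'. norm (u \<epsilon> x) \<le> max C C' * \<epsilon> powr p"
    using C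
  proof eventually_elim
    case (elim \<epsilon>)
    have "C * \<epsilon> powr p \<le> max C C' * \<epsilon> powr p" "C' * \<epsilon> powr p \<le> max C C' * \<epsilon> powr p"
      by (auto intro!: mult_right_mono)
    then show ?case using elim by force
  qed
  then show ?thesis by (auto simp: bigo_on_def)
qed

lemma bigo_on_zero: "bigo_on K p (\<lambda>\<epsilon> x. 0)"
  by (auto simp: bigo_on_def intro!: exI[of _ 0])

lemma bigo_on_add:
  assumes "bigo_on K p u" "bigo_on K p v"
  shows "bigo_on K p (\<lambda>\<epsilon> x. u \<epsilon> x + v \<epsilon> x)"
proof -
  obtain C C' where C: "\<forall>\<^sub>F \<epsilon> in at_right 0. \<forall>x\<in>K. norm (u \<epsilon> x) \<le> C * \<epsilon> powr p"
    "\<forall>\<^sub>F \<epsilon> in at_right 0. \<forall>x\<in>K. norm (v \<epsilon> x) \<le> C' * \<epsilon> powr p"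
    using assms by (auto simp: bigo_on_def)
  have "\<forall>\<^sub>F \<epsilon> in at_right 0. \<forall>x\<in>K. norm (u \<epsilon> x + v \<epsilon> x) \<le> (C + C') * \<epsilon> powr p"
    using C by eventually_elim (auto simp: distrib_right intro!: norm_triangle_le add_mono)
  then show ?thesis by (auto simp: bigo_on_def)
qed

lemma bigo_on_mult:
  assumes "bigo_on K p u" "bigo_on K q v"
  shows "bigo_on K (p + q) (\<lambda>\<epsilon> x. u \<epsilon> x * v \<epsilon> x)"
proof -
  obtain C where C: "C > 0" "\<forall>\<^sub>F \<epsilon> in at_right 0. \<forall>x\<in>K. norm (u \<epsilon> x) \<le> C * \<epsilon> powr p"
    using assms(1) by (rule bigo_on_pos)
  obtain C' where C': "C' > 0" "\<forall>\<^sub>F \<epsilon> in at_right 0. \<forall>x\<in>K. norm (v \<epsilon> x) \<le> C' * \<epsilon> powr q"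
    using assms(2) by (rule bigo_on_pos)
  have "\<forall>\<^sub>F \<epsilon> in at_right 0. \<forall>x\<in>K. norm (u \<epsilon> x * v \<epsilon> x) \<le> (C * C') * \<epsilon> powr (p + q)"
    using C(2) C'(2)
  proof eventually_elim
    case (elim \<epsilon>)
    have "norm (u \<epsilon> x) * norm (v \<epsilon> x) \<le> (C * \<epsilon> powr p) * (C' * \<epsilon> powr q)" if "x \<in> K" for x
      using elim that C(1) C'(1) by (intro mult_mono) auto
    then show ?case by (simp add: norm_mult powr_add algebra_simps)
  qed
  then show ?thesis by (auto simp: bigo_on_def)
qed

lemma bdd_above_sup_abs:
  assumes "compact K" "continuous_on K f"
  shows "bdd_above (insert 0 {norm (f x) | x. x \<in> K})"
proof -
  have "bdd_above ((\<lambda>x. norm (f x)) ` K)"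
    by (intro bounded_imp_bdd_above compact_imp_bounded compact_continuous_image continuous_intros assms)
  then show ?thesis by (simp add: Setcompr_eq_image)
qed

lemma sup_abs_ge:
  assumes "compact K" "continuous_on K f" "x \<in> K"
  shows "norm (f x) \<le> sup_abs K f"
  unfolding sup_abs_def by (rule cSup_upper[OF _ bdd_above_sup_abs[OF assms(1,2)]]) (use assms in auto)

lemma sup_abs_le:
  assumes "\<And>x. x \<in> K \<Longrightarrow> norm (f x) \<le> C" "0 \<le> C"
  shows "sup_abs K f \<le> C"
  unfolding sup_abs_def by (rule cSup_least) (use assms in auto)

lemma sup_abs_nonneg:
  assumes "compact K" "continuous_on K f"
  shows "0 \<le> sup_abs K f"
  unfolding sup_abs_def by (rule cSup_upper[OF _ bdd_above_sup_abs[OF assms]]) auto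

lemma sup_abs_bigo_iff:
  assumes "compact K" "\<And>\<epsilon>. \<epsilon> \<in> {0<..1} \<Longrightarrow> continuous_on K (u \<epsilon>)"
  shows "(\<lambda>\<epsilon>. sup_abs K (u \<epsilon>)) \<in> O[at_right 0](\<lambda>\<epsilon>. \<epsilon> powr p) \<longleftrightarrow> bigo_on K p u"
proof
  assume "(\<lambda>\<epsilon>. sup_abs K (u \<epsilon>)) \<in> O[at_right 0](\<lambda>\<epsilon>. \<epsilon> powr p)"
  then obtain C where "\<forall>\<^sub>F \<epsilon> in at_right 0. norm (sup_abs K (u \<epsilon>)) \<le> C * norm (\<epsilon> powr p)"
    by (auto elim!: landau_o.bigE)
  then have "\<forall>\<^sub>F \<epsilon> in at_right 0. \<forall>x\<in>K. norm (u \<epsilon> x) \<le> C * \<epsilon> powr p"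
    using eventually_unit
  proof eventually_elim
    case (elim \<epsilon>)
    then show ?case using sup_abs_ge[OF assms(1) assms(2)[of \<epsilon>]] by force
  qed
  then show "bigo_on K p u" by (auto simp: bigo_on_def)
next
  assume "bigo_on K p u"
  then obtain C where C: "C > 0" "\<forall>\<^sub>F \<epsilon> in at_right 0. \<forall>x\<in>K. norm (u \<epsilon> x) \<le> C * \<epsilon> powr p"
    by (rule bigo_on_pos)
  show "(\<lambda>\<epsilon>. sup_abs K (u \<epsilon>)) \<in> O[at_right 0](\<lambda>\<epsilon>. \<epsilon> powr p)"
  proof (rule bigoI[where c = C])
    show "\<forall>\<^sub>F \<epsilon> in at_right 0. norm (sup_abs K (u \<epsilon>)) \<le> C * norm (\<epsilon> powr p)"
      using C(2) eventually_unit
    proof eventually_elim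
      case (elim \<epsilon>)
      then show ?case
        using sup_abs_nonneg[OF assms(1) assms(2)[of \<epsilon>]] sup_abs_le[of K "u \<epsilon>" "C * \<epsilon> powr p"] C(1)
        by simp
    qed
  qed
qed

lemma sup_abs_mpd_bigo_iff:
  assumes "open \<Omega>" "\<And>\<epsilon>. \<epsilon> \<in> {0<..1} \<Longrightarrow> smooth_on \<Omega> (u \<epsilon>)" "compact K" "K \<subseteq> \<Omega>"
  shows "(\<lambda>\<epsilon>. sup_abs K (mpd \<alpha> (u \<epsilon>))) \<in> O[at_right 0](\<lambda>\<epsilon>. \<epsilon> powr p) \<longleftrightarrow>
    bigo_on K p (\<lambda>\<epsilon>. mpd \<alpha> (u \<epsilon>))"
proof (rule sup_abs_bigo_iff[OF assms(3)])
  fix \<epsilon> :: real assume "\<epsilon> \<in> {0<..1}"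
  then show "continuous_on K (mpd \<alpha> (u \<epsilon>))"
    unfolding mpd_eq_pds
    using assms by (meson continuous_on_subset smooth_on_imp_continuous_on smooth_on_pds)
qed

lemma bigo_on_mpd_iff_pds:
  assumes "open \<Omega>" "\<And>\<epsilon>. \<epsilon> \<in> {0<..1} \<Longrightarrow> smooth_on \<Omega> (u \<epsilon>)" "K \<subseteq> \<Omega>"
  shows "bigo_on K p (\<lambda>\<epsilon>. pds is (u \<epsilon>)) \<longleftrightarrow> bigo_on K p (\<lambda>\<epsilon>. mpd (count_list is) (u \<epsilon>))"
  using assms pds_eq_mpd[OF assms(1,2)]
  by (intro iffI; elim bigo_on_cong) (auto simp: subset_iff)

text \<open>By symmetry of the derivatives, the list chosen by \<open>mpd\<close> may be replaced by any other.\<close>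

lemma moderate_on_iff:
  assumes "open \<Omega>"
  shows "moderate_on \<Omega> u \<longleftrightarrow> (\<forall>\<epsilon>\<in>{0<..1}. smooth_on \<Omega> (u \<epsilon>)) \<and>
    (\<forall>K is. compact K \<and> K \<subseteq> \<Omega> \<longrightarrow> (\<exists>N::nat. bigo_on K (- real N) (\<lambda>\<epsilon>. pds is (u \<epsilon>))))"
  (is "_ \<longleftrightarrow> ?S \<and> _")
proof (cases ?S)
  case True
  then have s: "\<And>\<epsilon>. \<epsilon> \<in> {0<..1} \<Longrightarrow> smooth_on \<Omega> (u \<epsilon>)" by blast
  have "moderate_on \<Omega> u \<longleftrightarrow> (\<forall>K. compact K \<and> K \<subseteq> \<Omega> \<longrightarrow> (\<forall>\<alpha>. \<exists>N::nat. bigo_on K (- real N) (\<lambda>\<epsilon>. mpd \<alpha> (u \<epsilon>))))"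
    using True sup_abs_mpd_bigo_iff[OF assms s] unfolding moderate_on_def by (simp cong: conj_cong imp_cong)
  also have "\<dots> \<longleftrightarrow> (\<forall>K is. compact K \<and> K \<subseteq> \<Omega> \<longrightarrow> (\<exists>N::nat. bigo_on K (- real N) (\<lambda>\<epsilon>. pds is (u \<epsilon>))))"
    (is "?A \<longleftrightarrow> ?B")
  proof
    show ?B if ?A
      using that bigo_on_mpd_iff_pds[OF assms s] by (simp cong: conj_cong imp_cong)
    show ?A if ?B
      using that by (simp add: mpd_eq_pds)
  qed
  finally show ?thesis using True by blast
qed (auto simp: moderate_on_def)

lemma negligible_on_iff:
  assumes "open \<Omega>"
  shows "negligible_on \<Omega> u \<longleftrightarrow> (\<forall>\<epsilon>\<in>{0<..1}. smooth_on \<Omega> (u \<epsilon>)) \<and>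
    (\<forall>K is. compact K \<and> K \<subseteq> \<Omega> \<longrightarrow> (\<forall>q::nat. bigo_on K (real q) (\<lambda>\<epsilon>. pds is (u \<epsilon>))))"
  (is "_ \<longleftrightarrow> ?S \<and> _")
proof (cases ?S)
  case True
  then have s: "\<And>\<epsilon>. \<epsilon> \<in> {0<..1} \<Longrightarrow> smooth_on \<Omega> (u \<epsilon>)" by blast
  have "negligible_on \<Omega> u \<longleftrightarrow> (\<forall>K. compact K \<and> K \<subseteq> \<Omega> \<longrightarrow> (\<forall>\<alpha>. \<forall>q::nat. bigo_on K (real q) (\<lambda>\<epsilon>. mpd \<alpha> (u \<epsilon>))))"
    using True sup_abs_mpd_bigo_iff[OF assms s] unfolding negligible_on_def by (simp cong: conj_cong imp_cong)
  also have "\<dots> \<longleftrightarrow> (\<forall>K is. compact K \<and> K \<subseteq> \<Omega> \<longrightarrow> (\<forall>q::nat. bigo_on K (real q) (\<lambda>\<epsilon>. pds is (u \<epsilon>))))"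
    (is "?A \<longleftrightarrow> ?B")
  proof
    show ?B if ?A
      using that bigo_on_mpd_iff_pds[OF assms s] by (simp cong: conj_cong imp_cong)
    show ?A if ?B
      using that by (simp add: mpd_eq_pds)
  qed
  finally show ?thesis using True by blast
qed (auto simp: negligible_on_def)

lemma regular_on_imp:
  assumes "open \<Omega>" "regular_on \<Omega> u" "compact K" "K \<subseteq> \<Omega>"
  obtains N :: nat where "\<And>is. bigo_on K (- real N) (\<lambda>\<epsilon>. pds is (u \<epsilon>))"
proof -
  have s: "\<And>\<epsilon>. \<epsilon> \<in> {0<..1} \<Longrightarrow> smooth_on \<Omega> (u \<epsilon>)" using assms(2) by (auto simp: regular_on_def)
  obtain N :: nat where
    "\<And>\<alpha>. (\<lambda>\<epsilon>. sup_abs K (mpd \<alpha> (u \<epsilon>))) \<in> O[at_right 0](\<lambda>\<epsilon>. \<epsilon> powr (- real N))"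
    using assms unfolding regular_on_def by blast
  then show thesis
    by (intro that[of N]) (simp only: sup_abs_mpd_bigo_iff[OF assms(1) s assms(3,4)] bigo_on_mpd_iff_pds[OF assms(1) s assms(4)])
qed

lemma moderate_onD:
  assumes "open \<Omega>" "moderate_on \<Omega> u" "compact K" "K \<subseteq> \<Omega>"
  obtains N :: nat where "\<And>is. length is \<le> k \<Longrightarrow> bigo_on K (- real N) (\<lambda>\<epsilon>. pds is (u \<epsilon>))"
proof -
  have "\<forall>is. \<exists>N::nat. bigo_on K (- real N) (\<lambda>\<epsilon>. pds is (u \<epsilon>))"
    using assms(2-) unfolding moderate_on_iff[OF assms(1)] by simp
  then obtain N :: "'a list \<Rightarrow> nat" where N: "\<And>is. bigo_on K (- real (N is)) (\<lambda>\<epsilon>. pds is (u \<epsilon>))" by metis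
  have fin: "finite {is :: 'a list. length is \<le> k}"
    using finite_lists_length_le[of "UNIV :: 'a set" k] by simp
  show thesis
  proof (rule that[of "Max (N ` {is. length is \<le> k})"])
    fix "is" :: "'a list" assume "length is \<le> k"
    then have "N is \<le> Max (N ` {is. length is \<le> k})" using fin by (intro Max_ge) auto
    then show "bigo_on K (- real (Max (N ` {is. length is \<le> k}))) (\<lambda>\<epsilon>. pds is (u \<epsilon>))"
      by (intro bigo_on_weaken[OF N]) auto
  qed
qed

lemma moderate_onI:
  assumes "open \<Omega>" "\<And>\<epsilon>. \<epsilon> \<in> {0<..1} \<Longrightarrow> smooth_on \<Omega> (u \<epsilon>)"
    "\<And>K is. compact K \<Longrightarrow> K \<subseteq> \<Omega> \<Longrightarrow> \<exists>N::nat. bigo_on K (- real N) (\<lambda>\<epsilon>. pds is (u \<epsilon>))"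
  shows "moderate_on \<Omega> u"
  unfolding moderate_on_iff[OF assms(1)] by (intro conjI ballI allI impI assms) auto

lemma negligible_onI:
  assumes "open \<Omega>" "\<And>\<epsilon>. \<epsilon> \<in> {0<..1} \<Longrightarrow> smooth_on \<Omega> (u \<epsilon>)"
    "\<And>K is q. compact K \<Longrightarrow> K \<subseteq> \<Omega> \<Longrightarrow> bigo_on K (real q) (\<lambda>\<epsilon>. pds is (u \<epsilon>))"
  shows "negligible_on \<Omega> u"
  unfolding negligible_on_iff[OF assms(1)] by (intro conjI ballI allI impI assms) auto

lemma negligible_onD:
  assumes "open \<Omega>" "negligible_on \<Omega> u" "compact K" "K \<subseteq> \<Omega>"
  shows "bigo_on K p (\<lambda>\<epsilon>. pds is (u \<epsilon>))"
proof -
  obtain q :: nat where "p \<le> real q" using real_arch_simple by blast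
  then show ?thesis
    using assms(2-) unfolding negligible_on_iff[OF assms(1)] by (intro bigo_on_weaken[of K "real q" _ p K]) simp_all
qed

lemma moderate_on_smooth: "moderate_on \<Omega> u \<Longrightarrow> \<epsilon> \<in> {0<..1} \<Longrightarrow> smooth_on \<Omega> (u \<epsilon>)"
  by (auto simp: moderate_on_def)

lemma negligible_on_smooth: "negligible_on \<Omega> u \<Longrightarrow> \<epsilon> \<in> {0<..1} \<Longrightarrow> smooth_on \<Omega> (u \<epsilon>)"
  by (auto simp: negligible_on_def)

text \<open>The Leibniz rule in the form of an estimate: one derivative is moved to either factor, and the
  rest is induction. The exponents are the same for all orders up to \<open>k\<close>, because for regular nets the
  estimate must not deteriorate with the order.\<close>

lemma bigo_on_pds_mult:
  assumes "open \<Omega>" "K \<subseteq> \<Omega>"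
    and "\<And>\<epsilon>. \<epsilon> \<in> {0<..1} \<Longrightarrow> smooth_on \<Omega> (u \<epsilon>)" "\<And>\<epsilon>. \<epsilon> \<in> {0<..1} \<Longrightarrow> smooth_on \<Omega> (v \<epsilon>)"
    and "\<And>is. length is \<le> k \<Longrightarrow> bigo_on K p (\<lambda>\<epsilon>. pds is (u \<epsilon>))"
    and "\<And>is. length is \<le> k \<Longrightarrow> bigo_on K q (\<lambda>\<epsilon>. pds is (v \<epsilon>))"
    and "length is \<le> k"
  shows "bigo_on K (p + q) (\<lambda>\<epsilon>. pds is (\<lambda>x. u \<epsilon> x * v \<epsilon> x))"
  using assms(3-)
proof (induction "is" arbitrary: u v k rule: rev_induct)
  case Nil
  then show ?case using Nil.prems(3)[of "[]"] Nil.prems(4)[of "[]"] by (simp add: bigo_on_mult)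
next
  case (snoc i "is")
  obtain l where l: "k = Suc l" using snoc.prems(5) by (cases k) auto
  have u': "bigo_on K p (\<lambda>\<epsilon>. pds js (pd i (u \<epsilon>)))" if "length js \<le> l" for js
    using snoc.prems(3)[of "js @ [i]"] that l by simp
  have v': "bigo_on K q (\<lambda>\<epsilon>. pds js (pd i (v \<epsilon>)))" if "length js \<le> l" for js
    using snoc.prems(4)[of "js @ [i]"] that l by simp
  have "bigo_on K (p + q) (\<lambda>\<epsilon>. pds is (\<lambda>x. pd i (u \<epsilon>) x * v \<epsilon> x))"
    using snoc.prems u' l by (intro snoc.IH[where k = l] smooth_on_pd) auto
  moreover have "bigo_on K (p + q) (\<lambda>\<epsilon>. pds is (\<lambda>x. u \<epsilon> x * pd i (v \<epsilon>) x))"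
    using snoc.prems v' l by (intro snoc.IH[where k = l] smooth_on_pd) auto
  ultimately have "bigo_on K (p + q) (\<lambda>\<epsilon> x. pds is (\<lambda>x. pd i (u \<epsilon>) x * v \<epsilon> x) x + pds is (\<lambda>x. u \<epsilon> x * pd i (v \<epsilon>) x) x)"
    by (rule bigo_on_add)
  then show ?case
  proof (rule bigo_on_cong)
    fix \<epsilon> :: real and x assume e: "\<epsilon> \<in> {0<..1}" and x: "x \<in> K"
    note sm = snoc.prems(1,2)[OF e]
    have "pds (is @ [i]) (\<lambda>x. u \<epsilon> x * v \<epsilon> x) x = pds is (pd i (\<lambda>x. u \<epsilon> x * v \<epsilon> x)) x" by simp
    also have "\<dots> = pds is (\<lambda>x. pd i (u \<epsilon>) x * v \<epsilon> x + u \<epsilon> x * pd i (v \<epsilon>) x) x"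
      using x assms(2) sm by (intro pds_cong[OF assms(1)] pd_mult smooth_on_imp_differentiable) auto
    also have "\<dots> = pds is (\<lambda>x. pd i (u \<epsilon>) x * v \<epsilon> x) x + pds is (\<lambda>x. u \<epsilon> x * pd i (v \<epsilon>) x) x"
      using x assms(1,2) sm by (intro pds_add[OF assms(1)] smooth_on_mult smooth_on_pd) auto
    finally show "norm (pds (is @ [i]) (\<lambda>x. u \<epsilon> x * v \<epsilon> x) x) \<le>
        norm (pds is (\<lambda>x. pd i (u \<epsilon>) x * v \<epsilon> x) x + pds is (\<lambda>x. u \<epsilon> x * pd i (v \<epsilon>) x) x)" by simp
  qed
qed

lemma moderate_on_mult:
  fixes u v :: "'n::finite fnet"
  assumes "open \<Omega>" "moderate_on \<Omega> u" "moderate_on \<Omega> v"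
  shows "moderate_on \<Omega> (\<lambda>\<epsilon> x. u \<epsilon> x * v \<epsilon> x)"
proof (rule moderate_onI[OF assms(1)])
  fix K and "is" :: "'n list" assume K: "compact K" "K \<subseteq> \<Omega>"
  obtain M :: nat where M: "\<And>js. length js \<le> length is \<Longrightarrow> bigo_on K (- real M) (\<lambda>\<epsilon>. pds js (u \<epsilon>))"
    using moderate_onD[OF assms(1,2) K] by blast
  obtain N :: nat where N: "\<And>js. length js \<le> length is \<Longrightarrow> bigo_on K (- real N) (\<lambda>\<epsilon>. pds js (v \<epsilon>))"
    using moderate_onD[OF assms(1,3) K] by blast
  have "bigo_on K (- real M + - real N) (\<lambda>\<epsilon>. pds is (\<lambda>x. u \<epsilon> x * v \<epsilon> x))"
    using assms moderate_on_smooth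
    by (intro bigo_on_pds_mult[OF assms(1) K(2) _ _ M N order_refl]) auto
  then show "\<exists>N::nat. bigo_on K (- real N) (\<lambda>\<epsilon>. pds is (\<lambda>x. u \<epsilon> x * v \<epsilon> x))"
    by (intro exI[of _ "M + N"]) simp
qed (use assms moderate_on_smooth in \<open>auto intro!: smooth_on_mult\<close>)

lemma negligible_on_mult:
  fixes u v :: "'n::finite fnet"
  assumes "open \<Omega>" "moderate_on \<Omega> u" "negligible_on \<Omega> v"
  shows "negligible_on \<Omega> (\<lambda>\<epsilon> x. u \<epsilon> x * v \<epsilon> x)"
proof (rule negligible_onI[OF assms(1)])
  fix K and "is" :: "'n list" and q :: nat assume K: "compact K" "K \<subseteq> \<Omega>"
  obtain M :: nat where M: "\<And>js. length js \<le> length is \<Longrightarrow> bigo_on K (- real M) (\<lambda>\<epsilon>. pds js (u \<epsilon>))"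
    using moderate_onD[OF assms(1,2) K] by blast
  have "bigo_on K (- real M + (real M + real q)) (\<lambda>\<epsilon>. pds is (\<lambda>x. u \<epsilon> x * v \<epsilon> x))"
    by (intro bigo_on_pds_mult[OF assms(1) K(2) _ _ M negligible_onD[OF assms(1,3) K] order_refl]
        moderate_on_smooth[OF assms(2)] negligible_on_smooth[OF assms(3)])
  then show "bigo_on K (real q) (\<lambda>\<epsilon>. pds is (\<lambda>x. u \<epsilon> x * v \<epsilon> x))" by simp
qed (intro smooth_on_mult assms(1) moderate_on_smooth[OF assms(2)] negligible_on_smooth[OF assms(3)])

lemma moderate_on_add:
  assumes "open \<Omega>" "moderate_on \<Omega> u" "moderate_on \<Omega> v"
  shows "moderate_on \<Omega> (\<lambda>\<epsilon> x. u \<epsilon> x + v \<epsilon> x)"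
proof (rule moderate_onI[OF assms(1)])
  fix K "is" assume K: "compact K" "K \<subseteq> \<Omega>"
  obtain M :: nat where M: "bigo_on K (- real M) (\<lambda>\<epsilon>. pds is (u \<epsilon>))"
    using moderate_onD[OF assms(1,2) K, of "length is"] by blast
  obtain N :: nat where N: "bigo_on K (- real N) (\<lambda>\<epsilon>. pds is (v \<epsilon>))"
    using moderate_onD[OF assms(1,3) K, of "length is"] by blast
  have "bigo_on K (- real (max M N)) (\<lambda>\<epsilon> x. pds is (u \<epsilon>) x + pds is (v \<epsilon>) x)"
    by (intro bigo_on_add bigo_on_weaken[OF M] bigo_on_weaken[OF N]) auto
  then have "bigo_on K (- real (max M N)) (\<lambda>\<epsilon>. pds is (\<lambda>x. u \<epsilon> x + v \<epsilon> x))"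
    using K(2) assms moderate_on_smooth by (elim bigo_on_cong, subst pds_add[OF assms(1)]) auto
  then show "\<exists>N::nat. bigo_on K (- real N) (\<lambda>\<epsilon>. pds is (\<lambda>x. u \<epsilon> x + v \<epsilon> x))" by blast
qed (use assms moderate_on_smooth in \<open>auto intro!: smooth_on_add\<close>)

lemma negligible_on_add:
  assumes "open \<Omega>" "negligible_on \<Omega> u" "negligible_on \<Omega> v"
  shows "negligible_on \<Omega> (\<lambda>\<epsilon> x. u \<epsilon> x + v \<epsilon> x)"
proof (rule negligible_onI[OF assms(1)])
  fix K "is" and q :: nat assume K: "compact K" "K \<subseteq> \<Omega>"
  have "bigo_on K (real q) (\<lambda>\<epsilon> x. pds is (u \<epsilon>) x + pds is (v \<epsilon>) x)"
    by (intro bigo_on_add negligible_onD[OF assms(1) _ K] assms)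
  then show "bigo_on K (real q) (\<lambda>\<epsilon>. pds is (\<lambda>x. u \<epsilon> x + v \<epsilon> x))"
    using K(2) assms negligible_on_smooth by (elim bigo_on_cong, subst pds_add[OF assms(1)]) auto
qed (use assms negligible_on_smooth in \<open>auto intro!: smooth_on_add\<close>)

lemma norm_bigo_iff_bigo_on:
  assumes "K \<noteq> {}"
  shows "(\<lambda>\<epsilon>. norm (a \<epsilon>)) \<in> O[at_right 0](\<lambda>\<epsilon>. \<epsilon> powr p) \<longleftrightarrow> bigo_on K p (\<lambda>\<epsilon> x. a \<epsilon>)"
  using assms unfolding bigo_on_def by (auto elim!: landau_o.bigE intro: bigoI)

lemma bigo_on_if_norm_bigo:
  "(\<lambda>\<epsilon>. norm (a \<epsilon>)) \<in> O[at_right 0](\<lambda>\<epsilon>. \<epsilon> powr p) \<Longrightarrow> bigo_on K p (\<lambda>\<epsilon> x. a \<epsilon>)"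
  using norm_bigo_iff_bigo_on[of UNIV a p] bigo_on_weaken[of UNIV p "\<lambda>\<epsilon> x. a \<epsilon>" p K] by auto

lemma pds_const: "pds is (\<lambda>x. c) = (\<lambda>x. if is = [] then c else 0)"
proof (cases "is" rule: rev_cases)
  case (snoc js i)
  then show ?thesis by (simp add: pd_const pds_zero)
qed simp

lemma moderate_on_const:
  assumes "open \<Omega>" "moderate_net a"
  shows "moderate_on \<Omega> (\<lambda>\<epsilon> x. a \<epsilon>)"
proof (rule moderate_onI[OF assms(1)])
  fix K "is"
  obtain N :: nat where "(\<lambda>\<epsilon>. norm (a \<epsilon>)) \<in> O[at_right 0](\<lambda>\<epsilon>. \<epsilon> powr (- real N))"
    using assms(2) moderate_net_def by blast
  from bigo_on_if_norm_bigo[OF this] show "\<exists>N::nat. bigo_on K (- real N) (\<lambda>\<epsilon>. pds is (\<lambda>x. a \<epsilon>))"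
    by (cases "is = []") (auto simp: pds_const bigo_on_zero)
qed (simp add: smooth_on_const)

lemma negligible_on_const:
  assumes "open \<Omega>" "negligible_net a"
  shows "negligible_on \<Omega> (\<lambda>\<epsilon> x. a \<epsilon>)"
proof (rule negligible_onI[OF assms(1)])
  fix K "is" and q :: nat
  have "(\<lambda>\<epsilon>. norm (a \<epsilon>)) \<in> O[at_right 0](\<lambda>\<epsilon>. \<epsilon> powr (real q))"
    using assms(2) negligible_net_def by blast
  from bigo_on_if_norm_bigo[OF this] show "bigo_on K (real q) (\<lambda>\<epsilon>. pds is (\<lambda>x. a \<epsilon>))"
    by (cases "is = []") (auto simp: pds_const bigo_on_zero)
qed (simp add: smooth_on_const)

lemma moderate_on_cmult:
  "open \<Omega> \<Longrightarrow> moderate_net a \<Longrightarrow> moderate_on \<Omega> u \<Longrightarrow> moderate_on \<Omega> (\<lambda>\<epsilon> x. a \<epsilon> * u \<epsilon> x)"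
  by (intro moderate_on_mult moderate_on_const)

lemma negligible_on_cmult:
  "open \<Omega> \<Longrightarrow> moderate_net a \<Longrightarrow> negligible_on \<Omega> u \<Longrightarrow> negligible_on \<Omega> (\<lambda>\<epsilon> x. a \<epsilon> * u \<epsilon> x)"
  by (intro negligible_on_mult moderate_on_const)

lemma moderate_on_diff:
  "open \<Omega> \<Longrightarrow> moderate_on \<Omega> u \<Longrightarrow> moderate_on \<Omega> v \<Longrightarrow> moderate_on \<Omega> (\<lambda>\<epsilon> x. u \<epsilon> x - v \<epsilon> x)"
  using moderate_on_add[of \<Omega> u "\<lambda>\<epsilon> x. - 1 * v \<epsilon> x"] moderate_on_cmult[OF _ moderate_net_const[of "-1"], of \<Omega> v] by simp

lemma negligible_on_diff:
  "open \<Omega> \<Longrightarrow> negligible_on \<Omega> u \<Longrightarrow> negligible_on \<Omega> v \<Longrightarrow> negligible_on \<Omega> (\<lambda>\<epsilon> x. u \<epsilon> x - v \<epsilon> x)"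
  using negligible_on_add[of \<Omega> u "\<lambda>\<epsilon> x. - 1 * v \<epsilon> x"] negligible_on_cmult[OF _ moderate_net_const[of "-1"], of \<Omega> v] by simp

lemma moderate_on_sum:
  assumes "open \<Omega>" "\<And>a. a \<in> I \<Longrightarrow> moderate_on \<Omega> (u a)"
  shows "moderate_on \<Omega> (\<lambda>\<epsilon> x. \<Sum>a\<in>I. u a \<epsilon> x)"
  using assms(2) moderate_on_const[OF assms(1) moderate_net_const[of 0]]
  by (induction I rule: infinite_finite_induct) (auto intro: moderate_on_add assms(1))

lemma negligible_on_sum:
  assumes "open \<Omega>" "\<And>a. a \<in> I \<Longrightarrow> negligible_on \<Omega> (u a)"
  shows "negligible_on \<Omega> (\<lambda>\<epsilon> x. \<Sum>a\<in>I. u a \<epsilon> x)"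
  using assms(2) negligible_on_const[OF assms(1) negligible_net_zero]
  by (induction I rule: infinite_finite_induct) (auto intro: negligible_on_add assms(1))

lemma moderate_on_pds:
  assumes "open \<Omega>" "moderate_on \<Omega> u"
  shows "moderate_on \<Omega> (\<lambda>\<epsilon>. pds is (u \<epsilon>))"
proof (rule moderate_onI[OF assms(1)])
  fix K js assume K: "compact K" "K \<subseteq> \<Omega>"
  obtain N :: nat where "bigo_on K (- real N) (\<lambda>\<epsilon>. pds (js @ is) (u \<epsilon>))"
    using moderate_onD[OF assms K, of "length (js @ is)"] by blast
  then show "\<exists>N::nat. bigo_on K (- real N) (\<lambda>\<epsilon>. pds js (pds is (u \<epsilon>)))" by auto
qed (use assms moderate_on_smooth smooth_on_pds in blast)

lemma negligible_on_pds:
  assumes "open \<Omega>" "negligible_on \<Omega> u"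
  shows "negligible_on \<Omega> (\<lambda>\<epsilon>. pds is (u \<epsilon>))"
proof (rule negligible_onI[OF assms(1)])
  fix K js and q :: nat assume K: "compact K" "K \<subseteq> \<Omega>"
  show "bigo_on K (real q) (\<lambda>\<epsilon>. pds js (pds is (u \<epsilon>)))"
    using negligible_onD[OF assms K, of "real q" "js @ is"] by simp
qed (use assms negligible_on_smooth smooth_on_pds in blast)

lemma moderate_on_subset: "moderate_on \<Omega> u \<Longrightarrow> V \<subseteq> \<Omega> \<Longrightarrow> moderate_on V u"
  unfolding moderate_on_def by (meson smooth_on_subset subset_trans)

lemma negligible_on_subset: "negligible_on \<Omega> u \<Longrightarrow> V \<subseteq> \<Omega> \<Longrightarrow> negligible_on V u"
  unfolding negligible_on_def by (meson smooth_on_subset subset_trans)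

lemma negligible_on_cong:
  assumes "open \<Omega>" "negligible_on \<Omega> u" "\<And>\<epsilon> x. \<epsilon> \<in> {0<..1} \<Longrightarrow> x \<in> \<Omega> \<Longrightarrow> u \<epsilon> x = v \<epsilon> x"
  shows "negligible_on \<Omega> v"
proof (rule negligible_onI[OF assms(1)])
  show "smooth_on \<Omega> (v \<epsilon>)" if "\<epsilon> \<in> {0<..1}" for \<epsilon>
    using that assms negligible_on_smooth smooth_on_cong by blast
  fix K "is" and q :: nat assume K: "compact K" "K \<subseteq> \<Omega>"
  show "bigo_on K (real q) (\<lambda>\<epsilon>. pds is (v \<epsilon>))"
    by (rule bigo_on_cong[OF negligible_onD[OF assms(1,2) K]])
       (use K(2) pds_cong[OF assms(1) assms(3)] in \<open>fastforce simp: subset_iff\<close>)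
qed

text \<open>Negligibility is a local property, by compactness.\<close>

lemma negligible_on_local:
  assumes "open \<Omega>" "\<And>x. x \<in> \<Omega> \<Longrightarrow> \<exists>V. open V \<and> x \<in> V \<and> negligible_on V u"
  shows "negligible_on \<Omega> u"
proof (rule negligible_onI[OF assms(1)])
  show "smooth_on \<Omega> (u \<epsilon>)" if e: "\<epsilon> \<in> {0<..1}" for \<epsilon>
    unfolding smooth_on_def
  proof (intro allI ballI)
    fix "is" x assume "x \<in> \<Omega>"
    then obtain V where "x \<in> V" "negligible_on V u" using assms(2) by blast
    then show "pds is (u \<epsilon>) differentiable (at x)"
      using negligible_on_smooth[OF _ e] by (auto simp: smooth_on_def)
  qed
  fix K "is" and q :: nat assume K: "compact K" "K \<subseteq> \<Omega>"
  have "\<exists>r>0. bigo_on (cball x r) (real q) (\<lambda>\<epsilon>. pds is (u \<epsilon>))" if "x \<in> K" for x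
  proof -
    have "x \<in> \<Omega>" using K(2) that by auto
    then obtain V where V: "open V" "x \<in> V" "negligible_on V u" using assms(2) by blast
    obtain r where r: "r > 0" "cball x r \<subseteq> V" using open_contains_cball_eq[OF V(1)] V(2) by blast
    show ?thesis using negligible_onD[OF V(1,3) compact_cball r(2)] r(1) by blast
  qed
  then obtain r where r: "\<And>x. x \<in> K \<Longrightarrow> r x > 0 \<and> bigo_on (cball x (r x)) (real q) (\<lambda>\<epsilon>. pds is (u \<epsilon>))" by metis
  obtain D where D: "D \<subseteq> K" "finite D" "K \<subseteq> (\<Union>x\<in>D. ball x (r x))"
    using compactE_image[OF K(1), of K "\<lambda>x. ball x (r x)"] r
    by (metis (no_types, lifting) UN_iff centre_in_ball open_ball subsetI)
  have "bigo_on (\<Union>x\<in>D. cball x (r x)) (real q) (\<lambda>\<epsilon>. pds is (u \<epsilon>))"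
    using D(2,1)
  proof (induction D rule: finite_induct)
    case empty
    then show ?case by (auto simp: bigo_on_def)
  next
    case (insert x D)
    then show ?case using r by (auto intro: bigo_on_Un)
  qed
  moreover have "K \<subseteq> (\<Union>x\<in>D. cball x (r x))"
    using D(3) by (rule subset_trans) (intro UN_mono subset_refl ball_subset_cball)
  ultimately show "bigo_on K (real q) (\<lambda>\<epsilon>. pds is (u \<epsilon>))"
    using bigo_on_weaken by blast
qed

text \<open>Nets vanishing outside of one compact subset of the domain extend by zero.\<close>

definition supported_in :: "(real^'n) set \<Rightarrow> 'n fnet \<Rightarrow> bool" where
  "supported_in L u \<longleftrightarrow> (\<forall>\<epsilon>\<in>{0<..1}. \<forall>x. x \<notin> L \<longrightarrow> u \<epsilon> x = 0)"

lemma smooth_on_extend: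
  assumes "open \<Omega>" "smooth_on \<Omega> f" "compact L" "L \<subseteq> \<Omega>" "\<And>x. x \<notin> L \<Longrightarrow> f x = 0"
  shows "smooth_on UNIV f"
proof -
  have "smooth_on (- L) f"
    by (rule smooth_on_cong[OF _ _ smooth_on_const[of _ 0]]) (use assms compact_imp_closed in auto)
  from smooth_on_Un[OF assms(2) this] show ?thesis
    by (rule smooth_on_subset) (use assms(4) in auto)
qed

lemma pds_outside_support:
  assumes "closed L" "\<And>x. x \<notin> L \<Longrightarrow> f x = 0" "x \<notin> L"
  shows "pds is f x = 0"
  using pds_cong[of "- L" f "\<lambda>x. 0" x "is"] assms by (auto simp: pds_zero)

lemma moderate_on_extend:
  fixes u :: "'n::finite fnet"
  assumes "open \<Omega>" "moderate_on \<Omega> u" "compact L" "L \<subseteq> \<Omega>" "supported_in L u"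
  shows "moderate_on UNIV u"
proof (rule moderate_onI)
  show "smooth_on UNIV (u \<epsilon>)" if "\<epsilon> \<in> {0<..1}" for \<epsilon>
    using that assms moderate_on_smooth[OF assms(2) that]
    by (intro smooth_on_extend[of \<Omega> _ L]) (auto simp: supported_in_def)
  fix K :: "(real^'n) set" and "is" assume K: "compact K"
  obtain N :: nat where N: "bigo_on L (- real N) (\<lambda>\<epsilon>. pds is (u \<epsilon>))"
    using moderate_onD[OF assms(1-4), of "length is"] by blast
  have "bigo_on K (- real N) (\<lambda>\<epsilon> x. if x \<in> L then pds is (u \<epsilon>) x else 0)"
    using N unfolding bigo_on_def
  proof (elim exE)
    fix C assume "\<forall>\<^sub>F \<epsilon> in at_right 0. \<forall>x\<in>L. cmod (pds is (u \<epsilon>) x) \<le> C * \<epsilon> powr - real N"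
    then have "\<forall>\<^sub>F \<epsilon> in at_right 0. \<forall>x\<in>K. cmod (if x \<in> L then pds is (u \<epsilon>) x else 0) \<le> \<bar>C\<bar> * \<epsilon> powr - real N"
      by eventually_elim (auto intro: order_trans[OF _ mult_right_mono[OF abs_ge_self]])
    then show "\<exists>C. \<forall>\<^sub>F \<epsilon> in at_right 0. \<forall>x\<in>K. cmod (if x \<in> L then pds is (u \<epsilon>) x else 0) \<le> C * \<epsilon> powr - real N"
      by blast
  qed
  then have "bigo_on K (- real N) (\<lambda>\<epsilon>. pds is (u \<epsilon>))"
    by (rule bigo_on_cong)
       (use assms(5) pds_outside_support[OF compact_imp_closed[OF assms(3)]] in \<open>auto simp: supported_in_def\<close>)
  then show "\<exists>N::nat. bigo_on K (- real N) (\<lambda>\<epsilon>. pds is (u \<epsilon>))" by blast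
qed simp

lemma negligible_on_extend:
  assumes "open \<Omega>" "negligible_on \<Omega> u" "compact L" "L \<subseteq> \<Omega>" "supported_in L u"
  shows "negligible_on UNIV u"
proof (rule negligible_on_local)
  fix x :: "real^'a"
  have op: "open (- L)" using assms(3) compact_imp_closed by auto
  moreover have "negligible_on (- L) u"
    by (rule negligible_on_cong[OF op negligible_on_const[OF op negligible_net_zero]])
       (use assms(5) in \<open>auto simp: supported_in_def\<close>)
  ultimately show "\<exists>V. open V \<and> x \<in> V \<and> negligible_on V u"
    using assms by (cases "x \<in> L") auto
qed simp

section \<open>Valuations of generalized numbers\<close>

lemma moderate_net_rep_gnum: "moderate_net (rep_gnum a)"
  using Quotient_rep_reflp[OF Quotient_gnum, of a] by (simp add: gnum_rel_refl_iff)

lemma abs_gnum_rep_gnum: "abs_gnum (rep_gnum a) = a"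
  by (rule Quotient_abs_rep[OF Quotient_gnum])

lemma abs_gnum_eq_iff:
  assumes "moderate_net r" "moderate_net s"
  shows "abs_gnum r = abs_gnum s \<longleftrightarrow> negligible_net (\<lambda>\<epsilon>. r \<epsilon> - s \<epsilon>)"
proof -
  have "gnum_rel r s \<longleftrightarrow> abs_gnum r = abs_gnum s"
    using Quotient_rel[OF Quotient_gnum, of r s] assms by (simp add: gnum_rel_refl_iff)
  then show ?thesis using assms by (simp add: gnum_rel_def)
qed

lemma abs_gnum_eqI:
  assumes "moderate_net r" "moderate_net s" "negligible_net (\<lambda>\<epsilon>. r \<epsilon> - s \<epsilon>)"
  shows "abs_gnum r = abs_gnum s"
  using assms abs_gnum_eq_iff by blast

lemma abs_gnum_add:
  "moderate_net r \<Longrightarrow> moderate_net s \<Longrightarrow> abs_gnum r + abs_gnum s = abs_gnum (\<lambda>\<epsilon>. r \<epsilon> + s \<epsilon>)"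
  by (simp add: plus_gnum.abs_eq gnum_rel_refl_iff)

lemma abs_gnum_diff:
  "moderate_net r \<Longrightarrow> moderate_net s \<Longrightarrow> abs_gnum r - abs_gnum s = abs_gnum (\<lambda>\<epsilon>. r \<epsilon> - s \<epsilon>)"
  by (simp add: minus_gnum.abs_eq gnum_rel_refl_iff)

lemma abs_gnum_mult:
  "moderate_net r \<Longrightarrow> moderate_net s \<Longrightarrow> abs_gnum r * abs_gnum s = abs_gnum (\<lambda>\<epsilon>. r \<epsilon> * s \<epsilon>)"
  by (simp add: times_gnum.abs_eq gnum_rel_refl_iff)

lemma valuation_abs_gnum:
  "moderate_net r \<Longrightarrow> valuation (abs_gnum r) =
     Sup {ereal b | b. (\<lambda>\<epsilon>. norm (r \<epsilon>)) \<in> O[at_right 0](\<lambda>\<epsilon>. \<epsilon> powr b)}"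
  by (simp add: valuation.abs_eq gnum_rel_refl_iff)

lemma le_valuation:
  assumes "moderate_net r" "(\<lambda>\<epsilon>. norm (r \<epsilon>)) \<in> O[at_right 0](\<lambda>\<epsilon>. \<epsilon> powr b)"
  shows "ereal b \<le> valuation (abs_gnum r)"
  unfolding valuation_abs_gnum[OF assms(1)] by (rule Sup_upper) (use assms in blast)

lemma bigo_if_less_valuation:
  assumes "moderate_net r" "ereal b < valuation (abs_gnum r)"
  shows "(\<lambda>\<epsilon>. norm (r \<epsilon>)) \<in> O[at_right 0](\<lambda>\<epsilon>. \<epsilon> powr b)"
proof -
  obtain c where "(\<lambda>\<epsilon>. norm (r \<epsilon>)) \<in> O[at_right 0](\<lambda>\<epsilon>. \<epsilon> powr c)" "b < c"
    using assms(2) unfolding valuation_abs_gnum[OF assms(1)] less_Sup_iff by auto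
  then show ?thesis by (intro norm_bigo_weaken[of r c b]) auto
qed

lemma gnum_cases:
  obtains r where "moderate_net r" "a = abs_gnum r"
  using moderate_net_rep_gnum abs_gnum_rep_gnum by metis

lemma valuation_neq_MInf: "valuation a \<noteq> -\<infinity>"
proof -
  obtain r where r: "moderate_net r" "a = abs_gnum r" by (rule gnum_cases)
  then obtain N :: nat where "(\<lambda>\<epsilon>. norm (r \<epsilon>)) \<in> O[at_right 0](\<lambda>\<epsilon>. \<epsilon> powr (- real N))"
    by (auto simp: moderate_net_def)
  from le_valuation[OF r(1) this] r(2) show ?thesis by auto
qed

lemma valuation_geI:
  assumes "moderate_net r" "\<And>b. ereal b < v \<Longrightarrow> (\<lambda>\<epsilon>. norm (r \<epsilon>)) \<in> O[at_right 0](\<lambda>\<epsilon>. \<epsilon> powr b)"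
  shows "v \<le> valuation (abs_gnum r)"
proof (rule dense_le)
  fix x assume "x < v"
  then show "x \<le> valuation (abs_gnum r)"
    using assms by (cases x) (auto intro: le_valuation)
qed

lemma valuation_add: "min (valuation a) (valuation b) \<le> valuation (a + b)"
proof -
  obtain r s where r: "moderate_net r" "a = abs_gnum r" and s: "moderate_net s" "b = abs_gnum s"
    by (meson gnum_cases)
  show ?thesis
    unfolding r(2) s(2) abs_gnum_add[OF r(1) s(1)]
    by (rule valuation_geI) (simp_all add: moderate_net_add norm_add_bigo bigo_if_less_valuation r(1) s(1))
qed

lemma valuation_minus: "valuation (- a) = valuation a"
proof -
  obtain r where r: "moderate_net r" "a = abs_gnum r" by (rule gnum_cases)
  then have "- a = abs_gnum (\<lambda>\<epsilon>. - r \<epsilon>)" by (simp add: uminus_gnum.abs_eq gnum_rel_refl_iff)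
  then show ?thesis using r by (simp add: valuation_abs_gnum moderate_net_uminus)
qed

lemma valuation_mult: "valuation a + valuation b \<le> valuation (a * b)"
proof -
  obtain r s where r: "moderate_net r" "a = abs_gnum r" and s: "moderate_net s" "b = abs_gnum s"
    by (meson gnum_cases)
  show ?thesis
    unfolding r(2) s(2) abs_gnum_mult[OF r(1) s(1)]
  proof (rule valuation_geI)
    show "moderate_net (\<lambda>\<epsilon>. r \<epsilon> * s \<epsilon>)" using r s by (simp add: moderate_net_mult)
    fix x assume x: "ereal x < valuation (abs_gnum r) + valuation (abs_gnum s)"
    obtain y z where yz: "ereal y < valuation (abs_gnum r)" "ereal z < valuation (abs_gnum s)" "x \<le> y + z"
    proof (cases "valuation (abs_gnum r)")
      case r': (real v)
      show thesis
      proof (cases "valuation (abs_gnum s)")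
        case (real w)
        define d where "d = (v + w - x) / 2"
        have "d > 0" using x r' real by (simp add: d_def)
        then show thesis using that[of "v - d" "w - d"] r' real by (simp add: d_def)
      next
        case PInf
        then show thesis using that[of "v - 1" "x - v + 1"] r' by simp
      qed (use valuation_neq_MInf in auto)
    next
      case PInf
      show thesis
      proof (cases "valuation (abs_gnum s)")
        case (real w)
        then show thesis using that[of "x - w + 1" "w - 1"] PInf by simp
      next
        case PInf': PInf
        then show thesis using that[of x 0] PInf by simp
      qed (use valuation_neq_MInf in auto)
    qed (use valuation_neq_MInf in auto)
    have "(\<lambda>\<epsilon>. norm (r \<epsilon> * s \<epsilon>)) \<in> O[at_right 0](\<lambda>\<epsilon>. \<epsilon> powr (y + z))"
      by (intro norm_mult_bigo bigo_if_less_valuation r s yz)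
    then show "(\<lambda>\<epsilon>. norm (r \<epsilon> * s \<epsilon>)) \<in> O[at_right 0](\<lambda>\<epsilon>. \<epsilon> powr x)"
      using yz(3) by (rule norm_bigo_weaken)
  qed
qed

lemma exp_neg_nonneg: "0 \<le> exp_neg v"
  by (simp add: exp_neg_def)

text \<open>The case \<open>v = -\<infinity>\<close> must be excluded, since \<open>exp_neg\<close> has the value \<open>0\<close> there.\<close>

lemma exp_neg_le:
  assumes "v \<noteq> -\<infinity>" "v + ereal c \<le> w"
  shows "exp_neg w \<le> exp (- c) * exp_neg v"
  using assms by (cases v; cases w) (auto simp: exp_neg_def simp flip: exp_add)

lemma exp_neg_antimono: "v \<noteq> -\<infinity> \<Longrightarrow> v \<le> w \<Longrightarrow> exp_neg w \<le> exp_neg v"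
  using exp_neg_le[of v 0 w] by simp

lemma abs_e_nonneg: "0 \<le> abs_e a"
  by (simp add: abs_e_def exp_neg_nonneg)

lemma abs_e_0: "abs_e 0 = 0"
proof -
  have "\<infinity> \<le> valuation (abs_gnum (\<lambda>\<epsilon>. 0::'a))"
    by (rule valuation_geI) (simp_all add: moderate_net_const)
  then have "valuation (0::'a gnum) = \<infinity>" by (simp add: zero_gnum.abs_eq)
  then show ?thesis by (simp add: abs_e_def exp_neg_def)
qed

lemma abs_e_add_le: "abs_e (a + b) \<le> max (abs_e a) (abs_e b)"
proof -
  have "exp_neg (valuation (a + b)) \<le> exp_neg (min (valuation a) (valuation b))"
    using valuation_neq_MInf[of a] valuation_neq_MInf[of b]
    by (intro exp_neg_antimono valuation_add) (simp add: min_def)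
  then show ?thesis by (auto simp: abs_e_def min_def split: if_splits)
qed

lemma abs_e_minus: "abs_e (- a) = abs_e a"
  by (simp add: abs_e_def valuation_minus)

lemma abs_e_mult_le: "abs_e (a * b) \<le> abs_e a * abs_e b"
proof -
  have "exp_neg (valuation (a * b)) \<le> exp_neg (valuation a + valuation b)"
    using valuation_neq_MInf[of a] valuation_neq_MInf[of b]
    by (intro exp_neg_antimono valuation_mult) simp
  also have "\<dots> = exp_neg (valuation a) * exp_neg (valuation b)"
    using valuation_neq_MInf[of a] valuation_neq_MInf[of b]
    by (cases "valuation a"; cases "valuation b") (auto simp: exp_neg_def simp flip: exp_add)
  finally show ?thesis by (simp add: abs_e_def)
qed

lemma abs_abs_e_diff_le: "\<bar>abs_e a - abs_e b\<bar> \<le> abs_e (a - b)"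
proof -
  have "abs_e a \<le> max (abs_e (a - b)) (abs_e b)" "abs_e b \<le> max (abs_e (b - a)) (abs_e a)"
    using abs_e_add_le[of "a - b" b] abs_e_add_le[of "b - a" a] by simp_all
  moreover have "abs_e (b - a) = abs_e (a - b)"
    using abs_e_minus[of "a - b"] by simp
  ultimately show ?thesis using abs_e_nonneg[of a] abs_e_nonneg[of b] abs_e_nonneg[of "a - b"] by auto
qed


section \<open>Classes of nets and their compactly supported representatives\<close>

lemma gclass_iff:
  "v \<in> gclass \<Omega> u \<longleftrightarrow> moderate_on \<Omega> u \<and> moderate_on \<Omega> v \<and> negligible_on \<Omega> (\<lambda>\<epsilon> x. u \<epsilon> x - v \<epsilon> x)"
  by (auto simp: gclass_def colombeau_rel_def)

lemma negligible_on_sym: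
  assumes "open \<Omega>" "negligible_on \<Omega> (\<lambda>\<epsilon> x. u \<epsilon> x - v \<epsilon> x)"
  shows "negligible_on \<Omega> (\<lambda>\<epsilon> x. v \<epsilon> x - u \<epsilon> x)"
  using negligible_on_cmult[OF assms(1) moderate_net_const assms(2), of "-1"] by simp

lemma negligible_on_trans:
  assumes "open \<Omega>" "negligible_on \<Omega> (\<lambda>\<epsilon> x. u \<epsilon> x - v \<epsilon> x)" "negligible_on \<Omega> (\<lambda>\<epsilon> x. v \<epsilon> x - w \<epsilon> x)"
  shows "negligible_on \<Omega> (\<lambda>\<epsilon> x. u \<epsilon> x - w \<epsilon> x)"
  using negligible_on_add[OF assms] by simp

lemma gclass_eqI:
  assumes "open \<Omega>" "v \<in> gclass \<Omega> u"
  shows "gclass \<Omega> v = gclass \<Omega> u"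
proof -
  have uv: "moderate_on \<Omega> u" "moderate_on \<Omega> v" "negligible_on \<Omega> (\<lambda>\<epsilon> x. u \<epsilon> x - v \<epsilon> x)"
    using assms(2) by (auto simp: gclass_iff)
  note vu = negligible_on_sym[OF assms(1) uv(3)]
  show ?thesis
  proof (intro set_eqI iffI)
    fix w assume "w \<in> gclass \<Omega> v"
    then show "w \<in> gclass \<Omega> u"
      using uv negligible_on_trans[OF assms(1) uv(3), of w] by (simp add: gclass_iff)
  next
    fix w assume "w \<in> gclass \<Omega> u"
    then show "w \<in> gclass \<Omega> v"
      using uv negligible_on_trans[OF assms(1) vu, of w] by (simp add: gclass_iff)
  qed
qed

lemma gclass_self: "open \<Omega> \<Longrightarrow> moderate_on \<Omega> u \<Longrightarrow> u \<in> gclass \<Omega> u"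
  by (simp add: gclass_iff negligible_on_const negligible_net_zero)

lemma gclass_in_G: "moderate_on \<Omega> u \<Longrightarrow> gclass \<Omega> u \<in> \<G> \<Omega>"
  unfolding \<G>_def gclass_def by (rule quotientI) simp

lemma G_cases:
  assumes "U \<in> \<G> \<Omega>"
  obtains u where "moderate_on \<Omega> u" "U = gclass \<Omega> u"
  using assms unfolding \<G>_def gclass_def by (auto elim!: quotientE)

lemma G_mem:
  assumes "open \<Omega>" "U \<in> \<G> \<Omega>" "u \<in> U"
  shows "moderate_on \<Omega> u" "U = gclass \<Omega> u"
proof -
  obtain v where v: "U = gclass \<Omega> v" using assms(2) by (rule G_cases)
  show "moderate_on \<Omega> u" using assms(3) unfolding v gclass_iff by blast
  show "U = gclass \<Omega> u" using gclass_eqI[OF assms(1)] assms(3) unfolding v by blast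
qed

lemma G_negligible_diff:
  assumes "open \<Omega>" "U \<in> \<G> \<Omega>" "u \<in> U" "v \<in> U"
  shows "negligible_on \<Omega> (\<lambda>\<epsilon> x. u \<epsilon> x - v \<epsilon> x)"
  using assms(4) unfolding G_mem(2)[OF assms(1-3)] gclass_iff by simp

lemma grep_in:
  assumes "open \<Omega>" "U \<in> \<G> \<Omega>"
  shows "grep U \<in> U"
proof -
  have "\<exists>u. u \<in> U" using assms(2) by (rule G_cases) (use gclass_self[OF assms(1)] in blast)
  then show ?thesis unfolding grep_def by (rule someI_ex)
qed

lemma moderate_on_grep: "open \<Omega> \<Longrightarrow> U \<in> \<G> \<Omega> \<Longrightarrow> moderate_on \<Omega> (grep U)"
  using G_mem grep_in by blast

lemma G_memI:
  assumes "open \<Omega>" "U \<in> \<G> \<Omega>" "u \<in> U" "moderate_on \<Omega> v" "negligible_on \<Omega> (\<lambda>\<epsilon> x. u \<epsilon> x - v \<epsilon> x)"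
  shows "v \<in> U"
  unfolding G_mem(2)[OF assms(1-3)] gclass_iff using G_mem(1)[OF assms(1-3)] assms(4,5) by simp

text \<open>Outside of \<open>L\<close> every representative of the class is negligible, so that the support is a closed
  part of \<open>L\<close>.\<close>

lemma gclass_in_G_c:
  assumes "open \<Omega>" "moderate_on \<Omega> u" "compact L" "L \<subseteq> \<Omega>" "supported_in L u"
  shows "gclass \<Omega> u \<in> \<G>_c \<Omega>" "compact_rep \<Omega> (gclass \<Omega> u) u"
proof -
  let ?U = "gclass \<Omega> u" and ?\<V> = "{V. open V \<and> V \<subseteq> \<Omega> \<and> negligible_on V (grep (gclass \<Omega> u))}"
  have U: "?U \<in> \<G> \<Omega>" by (rule gclass_in_G[OF assms(2)])
  have op: "open (\<Omega> - L)" using assms by (auto intro: compact_imp_closed)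
  have "negligible_on (\<Omega> - L) (\<lambda>\<epsilon> x. grep ?U \<epsilon> x - u \<epsilon> x)"
    using G_negligible_diff[OF assms(1) U grep_in[OF assms(1) U] gclass_self[OF assms(1,2)]]
    by (rule negligible_on_subset) auto
  then have "negligible_on (\<Omega> - L) (grep ?U)"
    by (rule negligible_on_cong[OF op]) (use assms(5) in \<open>auto simp: supported_in_def\<close>)
  then have "gsupp \<Omega> ?U \<subseteq> L" unfolding gsupp_def using op by blast
  then have "gsupp \<Omega> ?U = L - \<Union>?\<V>" unfolding gsupp_def using assms(4) by blast
  moreover have "open (\<Union>?\<V>)" by blast
  ultimately have "compact (gsupp \<Omega> ?U)" using compact_diff[OF assms(3)] by simp
  then show "?U \<in> \<G>_c \<Omega>" using U by (simp add: \<G>_c_def)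
  show "compact_rep \<Omega> ?U u"
    unfolding compact_rep_def using assms gclass_self[OF assms(1,2)] by (auto simp: supported_in_def)
qed

lemma bigo_on_pds_fixed:
  assumes "smooth_on UNIV f" "compact K"
  shows "bigo_on K 0 (\<lambda>\<epsilon>. pds is f)"
proof -
  have "bounded (pds is f ` K)"
    using smooth_on_imp_continuous_on[OF smooth_on_pds[OF assms(1)]]
    by (intro compact_imp_bounded compact_continuous_image[OF _ assms(2)]) (blast intro: continuous_on_subset)
  then obtain C where C: "\<And>x. x \<in> K \<Longrightarrow> norm (pds is f x) \<le> C"
    by (auto simp: bounded_iff)
  have "\<forall>\<^sub>F \<epsilon> in at_right 0. \<forall>x\<in>K. norm (pds is f x) \<le> C * \<epsilon> powr 0"
    using eventually_unit by eventually_elim (use C in auto)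
  then show ?thesis unfolding bigo_on_def by blast
qed

lemma moderate_on_fixed:
  assumes "smooth_on UNIV f" "open \<Omega>"
  shows "moderate_on \<Omega> (\<lambda>\<epsilon>. f)"
proof (rule moderate_onI[OF assms(2)])
  show "smooth_on \<Omega> f" using assms(1) smooth_on_subset by blast
  fix K :: "(real^'a) set" and "is" assume "compact K"
  then show "\<exists>N::nat. bigo_on K (- real N) (\<lambda>\<epsilon>. pds is f)"
    using bigo_on_pds_fixed[OF assms(1)] by (intro exI[of _ 0]) simp
qed

text \<open>Multiplication by a cutoff function yields representatives supported in any given
  neighbourhood of the support of a generalized function.\<close>

lemma compact_rep_exists:
  assumes "open \<Omega>" "U \<in> \<G>_c \<Omega>" "gsupp \<Omega> U \<subseteq> W" "open W" "W \<subseteq> \<Omega>"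
  obtains u L where "u \<in> U" "compact L" "L \<subseteq> W" "supported_in L u"
proof -
  have U: "U \<in> \<G> \<Omega>" and c: "compact (gsupp \<Omega> U)" using assms(2) by (auto simp: \<G>_c_def)
  obtain \<phi> :: "real^'a \<Rightarrow> real" and L V where \<phi>: "smooth_on UNIV (\<lambda>x. complex_of_real (\<phi> x))"
    "compact L" "L \<subseteq> W" "\<And>x. x \<notin> L \<Longrightarrow> \<phi> x = 0" "open V" "gsupp \<Omega> U \<subseteq> V" "\<And>x. x \<in> V \<Longrightarrow> \<phi> x = 1"
    using smooth_cutoff[OF c assms(4,3)] by metis
  let ?g = "grep U" and ?u = "\<lambda>\<epsilon> x. complex_of_real (\<phi> x) * grep U \<epsilon> x"
  note g = moderate_on_grep[OF assms(1) U] grep_in[OF assms(1) U]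
  note m = moderate_on_fixed[OF \<phi>(1)]
  have mu: "moderate_on \<Omega> ?u" by (intro moderate_on_mult m assms(1) g)
  have "negligible_on \<Omega> (\<lambda>\<epsilon> x. ?g \<epsilon> x - ?u \<epsilon> x)"
  proof (rule negligible_on_local[OF assms(1)])
    fix x assume x: "x \<in> \<Omega>"
    show "\<exists>V. open V \<and> x \<in> V \<and> negligible_on V (\<lambda>\<epsilon> x. ?g \<epsilon> x - ?u \<epsilon> x)"
    proof (cases "x \<in> gsupp \<Omega> U")
      case True
      have "negligible_on V (\<lambda>\<epsilon> x. ?g \<epsilon> x - ?u \<epsilon> x)"
        by (rule negligible_on_cong[OF \<phi>(5) negligible_on_const[OF \<phi>(5) negligible_net_zero]])
           (simp add: \<phi>(7))
      then show ?thesis using True \<phi>(5,6) by blast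
    next
      case False
      then obtain V' where V': "open V'" "x \<in> V'" "negligible_on V' ?g"
        using x unfolding gsupp_def by blast
      have "negligible_on V' (\<lambda>\<epsilon> x. ?g \<epsilon> x - ?u \<epsilon> x)"
        using V' by (intro negligible_on_diff negligible_on_mult m)
      then show ?thesis using V' by blast
    qed
  qed
  then have "?u \<in> U" using G_memI[OF assms(1) U g(2) mu] by blast
  then show thesis by (rule that[OF _ \<phi>(2,3)]) (simp add: supported_in_def \<phi>(4))
qed

lemma compact_repE:
  assumes "compact_rep \<Omega> U u"
  obtains L where "u \<in> U" "compact L" "L \<subseteq> \<Omega>" "supported_in L u"
  using assms unfolding compact_rep_def supported_in_def by blast

lemma compact_repI:
  "u \<in> U \<Longrightarrow> compact L \<Longrightarrow> L \<subseteq> \<Omega> \<Longrightarrow> supported_in L u \<Longrightarrow> compact_rep \<Omega> U u"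
  unfolding compact_rep_def supported_in_def by blast

lemma compact_rep_crep:
  assumes "open \<Omega>" "U \<in> \<G>_c \<Omega>"
  shows "compact_rep \<Omega> U (crep \<Omega> U)"
proof -
  have "gsupp \<Omega> U \<subseteq> \<Omega>" by (auto simp: gsupp_def)
  then have "\<exists>u. compact_rep \<Omega> U u"
    by (rule compact_rep_exists[OF assms _ assms(1) order_refl]) (blast intro: compact_repI)
  then show ?thesis unfolding crep_def by (rule someI_ex)
qed

lemma supported_in_mono: "supported_in L u \<Longrightarrow> L \<subseteq> L' \<Longrightarrow> supported_in L' u"
  by (auto simp: supported_in_def)

lemma compact_rep_moderate:
  assumes "open \<Omega>" "U \<in> \<G> \<Omega>" "compact_rep \<Omega> U u"
  shows "moderate_on UNIV u"
  using assms(3)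
proof (rule compact_repE)
  fix L assume L: "u \<in> U" "compact L" "L \<subseteq> \<Omega>" "supported_in L u"
  show ?thesis by (rule moderate_on_extend[OF assms(1) G_mem(1)[OF assms(1,2) L(1)] L(2-)])
qed

lemma compact_rep_negligible_diff:
  assumes "open \<Omega>" "U \<in> \<G> \<Omega>" "compact_rep \<Omega> U u" "compact_rep \<Omega> U v"
  obtains L where "compact L" "L \<subseteq> \<Omega>" "supported_in L (\<lambda>\<epsilon> x. u \<epsilon> x - v \<epsilon> x)"
    "negligible_on UNIV (\<lambda>\<epsilon> x. u \<epsilon> x - v \<epsilon> x)"
proof -
  obtain L where L: "u \<in> U" "compact L" "L \<subseteq> \<Omega>" "supported_in L u"
    using assms(3) by (rule compact_repE)
  obtain L' where L': "v \<in> U" "compact L'" "L' \<subseteq> \<Omega>" "supported_in L' v"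
    using assms(4) by (rule compact_repE)
  have s: "supported_in (L \<union> L') (\<lambda>\<epsilon> x. u \<epsilon> x - v \<epsilon> x)"
    using L(4) L'(4) by (auto simp: supported_in_def)
  have "negligible_on UNIV (\<lambda>\<epsilon> x. u \<epsilon> x - v \<epsilon> x)"
    by (rule negligible_on_extend[OF assms(1) G_negligible_diff[OF assms(1,2) L(1) L'(1)] _ _ s])
       (use L L' in auto)
  then show thesis by (intro that[of "L \<union> L'"] s) (use L L' in auto)
qed

section \<open>Moderate nets of distributions define basic functionals\<close>

lemma finite_mpd_bound:
  assumes "compact K" "smooth_on \<Omega> f" "K \<subseteq> \<Omega>"
  shows "bdd_above (insert 0 {norm (mpd \<alpha> f x) | x \<alpha>. x \<in> K \<and> mi_abs \<alpha> \<le> j})"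
proof -
  have "{norm (mpd \<alpha> f x) | x \<alpha>. x \<in> K \<and> mi_abs \<alpha> \<le> j} = (\<Union>\<alpha>\<in>mi_upto j. (\<lambda>x. norm (mpd \<alpha> f x)) ` K)"
    by (auto simp: mi_upto_def)
  moreover have "bdd_above ((\<lambda>x. norm (mpd \<alpha> f x)) ` K)" for \<alpha>
    unfolding mpd_eq_pds
    by (intro bounded_imp_bdd_above compact_imp_bounded compact_continuous_image continuous_intros assms
        continuous_on_subset[OF smooth_on_imp_continuous_on[OF smooth_on_pds[OF assms(2)]]])
  ultimately show ?thesis by (simp add: bdd_above_UN finite_mi_upto)
qed

lemma sup_deriv_ge:
  assumes "compact K" "smooth_on \<Omega> f" "K \<subseteq> \<Omega>" "x \<in> K" "mi_abs \<alpha> \<le> j"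
  shows "norm (mpd \<alpha> f x) \<le> sup_deriv K j f"
  unfolding sup_deriv_def by (rule cSup_upper[OF _ finite_mpd_bound[OF assms(1-3)]]) (use assms in blast)

lemma sup_deriv_le:
  assumes "\<And>x \<alpha>. x \<in> K \<Longrightarrow> mi_abs \<alpha> \<le> j \<Longrightarrow> norm (mpd \<alpha> f x) \<le> C" "0 \<le> C"
  shows "sup_deriv K j f \<le> C"
  unfolding sup_deriv_def by (rule cSup_least) (use assms in auto)

lemma sup_deriv_nonneg:
  assumes "compact K" "smooth_on \<Omega> f" "K \<subseteq> \<Omega>"
  shows "0 \<le> sup_deriv K j f"
  unfolding sup_deriv_def by (rule cSup_upper[OF _ finite_mpd_bound[OF assms]]) auto

lemma length_eq_mi_abs: "length is = mi_abs (count_list is)"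
  using mset_eq_length[OF mi_list_eqI[of "is" "count_list is"]] by (simp add: length_mi_list)

lemma sup_deriv_bigo_iff:
  assumes "open \<Omega>" "\<And>\<epsilon>. \<epsilon> \<in> {0<..1} \<Longrightarrow> smooth_on \<Omega> (u \<epsilon>)" "compact K" "K \<subseteq> \<Omega>"
  shows "(\<lambda>\<epsilon>. sup_deriv K j (u \<epsilon>)) \<in> O[at_right 0](\<lambda>\<epsilon>. \<epsilon> powr p) \<longleftrightarrow>
    (\<forall>is. length is \<le> j \<longrightarrow> bigo_on K p (\<lambda>\<epsilon>. pds is (u \<epsilon>)))"
proof
  assume "(\<lambda>\<epsilon>. sup_deriv K j (u \<epsilon>)) \<in> O[at_right 0](\<lambda>\<epsilon>. \<epsilon> powr p)"
  then obtain C where C: "\<forall>\<^sub>F \<epsilon> in at_right 0. norm (sup_deriv K j (u \<epsilon>)) \<le> C * norm (\<epsilon> powr p)"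
    by (auto elim!: landau_o.bigE)
  show "\<forall>is. length is \<le> j \<longrightarrow> bigo_on K p (\<lambda>\<epsilon>. pds is (u \<epsilon>))"
  proof (intro allI impI)
    fix "is" :: "'a list" assume l: "length is \<le> j"
    have "\<forall>\<^sub>F \<epsilon> in at_right 0. \<forall>x\<in>K. norm (pds is (u \<epsilon>) x) \<le> C * \<epsilon> powr p"
      using C eventually_unit
    proof eventually_elim
      case (elim \<epsilon>)
      show ?case
      proof
        fix x assume x: "x \<in> K"
        have "norm (pds is (u \<epsilon>) x) = norm (mpd (count_list is) (u \<epsilon>) x)"
          using pds_eq_mpd[OF assms(1) assms(2)[OF elim(2)]] x assms(4) by auto
        also have "\<dots> \<le> sup_deriv K j (u \<epsilon>)"
          using l by (intro sup_deriv_ge[OF assms(3) assms(2)[OF elim(2)] assms(4) x]) (simp flip: length_eq_mi_abs)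
        finally show "norm (pds is (u \<epsilon>) x) \<le> C * \<epsilon> powr p" using elim(1) by simp
      qed
    qed
    then show "bigo_on K p (\<lambda>\<epsilon>. pds is (u \<epsilon>))" by (auto simp: bigo_on_def)
  qed
next
  assume *: "\<forall>is. length is \<le> j \<longrightarrow> bigo_on K p (\<lambda>\<epsilon>. pds is (u \<epsilon>))"
  have "\<exists>C>0. \<forall>\<^sub>F \<epsilon> in at_right 0. \<forall>x\<in>K. norm (mpd \<alpha> (u \<epsilon>) x) \<le> C * \<epsilon> powr p" if "\<alpha> \<in> mi_upto j" for \<alpha>
  proof -
    have "bigo_on K p (\<lambda>\<epsilon>. mpd \<alpha> (u \<epsilon>))"
      using *[rule_format, of "mi_list \<alpha>"] that by (simp add: length_mi_list mi_upto_def mpd_eq_pds)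
    then show ?thesis by (rule bigo_on_pos) blast
  qed
  then have "\<forall>\<alpha>\<in>mi_upto j. \<exists>C. C > 0 \<and> (\<forall>\<^sub>F \<epsilon> in at_right 0. \<forall>x\<in>K. norm (mpd \<alpha> (u \<epsilon>) x) \<le> C * \<epsilon> powr p)"
    by simp
  from bchoice[OF this] obtain C where C: "\<forall>\<alpha>\<in>mi_upto j. C \<alpha> > 0 \<and>
      (\<forall>\<^sub>F \<epsilon> in at_right 0. \<forall>x\<in>K. norm (mpd \<alpha> (u \<epsilon>) x) \<le> C \<alpha> * \<epsilon> powr p)" ..
  define B where "B = (\<Sum>\<alpha>\<in>mi_upto j. C \<alpha>)"
  have B: "C \<alpha> \<le> B" if "\<alpha> \<in> mi_upto j" for \<alpha>
    unfolding B_def using C that by (intro member_le_sum) (auto simp: finite_mi_upto less_imp_le)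
  have B0: "B \<ge> 0" unfolding B_def using C by (intro sum_nonneg) (auto simp: less_imp_le)
  have "\<forall>\<^sub>F \<epsilon> in at_right 0. \<forall>\<alpha>\<in>mi_upto j. \<forall>x\<in>K. norm (mpd \<alpha> (u \<epsilon>) x) \<le> C \<alpha> * \<epsilon> powr p"
    using C by (intro eventually_ball_finite finite_mi_upto) auto
  then have "\<forall>\<^sub>F \<epsilon> in at_right 0. norm (sup_deriv K j (u \<epsilon>)) \<le> B * norm (\<epsilon> powr p)"
    using eventually_unit
  proof eventually_elim
    case (elim \<epsilon>)
    have "sup_deriv K j (u \<epsilon>) \<le> B * \<epsilon> powr p"
    proof (rule sup_deriv_le)
      fix x and \<alpha> :: "'a multi_index" assume "x \<in> K" "mi_abs \<alpha> \<le> j"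
      then show "norm (mpd \<alpha> (u \<epsilon>) x) \<le> B * \<epsilon> powr p"
        using elim(1) B[of \<alpha>] mult_right_mono[of "C \<alpha>" B "\<epsilon> powr p"] by (force simp: mi_upto_def)
    qed (use B0 in simp)
    then show ?case using sup_deriv_nonneg[OF assms(3) assms(2)[OF elim(2)] assms(4), of j] by simp
  qed
  then show "(\<lambda>\<epsilon>. sup_deriv K j (u \<epsilon>)) \<in> O[at_right 0](\<lambda>\<epsilon>. \<epsilon> powr p)" by (rule bigoI)
qed

text \<open>What the definition of \<open>basic\<close> demands of a net of distributions.\<close>

definition moderate_distributions ::
  "(real^'n::finite) set \<Rightarrow> (real \<Rightarrow> (real^'n \<Rightarrow> complex) \<Rightarrow> complex) \<Rightarrow> bool" where
  "moderate_distributions \<Omega> t \<longleftrightarrow>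
     (\<forall>\<epsilon>\<in>{0<..1}. distribution \<Omega> (t \<epsilon>)) \<and>
     (\<forall>K. compact K \<and> K \<subseteq> \<Omega> \<longrightarrow>
        (\<exists>j N::nat. \<exists>c>0. \<exists>\<eta>\<in>{0<..1}. \<forall>f\<in>test_functions K. \<forall>\<epsilon>\<in>{0<..\<eta>}.
           norm (t \<epsilon> f) \<le> c * \<epsilon> powr (- real N) * sup_deriv K j f))"

definition gfunctional_of ::
  "(real^'n::finite) set \<Rightarrow> (real \<Rightarrow> (real^'n \<Rightarrow> complex) \<Rightarrow> complex) \<Rightarrow> 'n gfunctional" where
  "gfunctional_of \<Omega> t U = abs_gnum (\<lambda>\<epsilon>. t \<epsilon> (crep \<Omega> U \<epsilon>))"

text \<open>One order \<open>j\<close> and one loss \<open>N\<close> in the exponent serve for all nets supported in \<open>K\<close>.\<close>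

lemma moderate_distributions_bigo:
  assumes "moderate_distributions \<Omega> t" "compact K" "K \<subseteq> \<Omega>"
  obtains j N :: nat where
    "\<And>u p. (\<And>\<epsilon>. \<epsilon> \<in> {0<..1} \<Longrightarrow> smooth_on UNIV (u \<epsilon>)) \<Longrightarrow> supported_in K u \<Longrightarrow>
       (\<And>is. length is \<le> j \<Longrightarrow> bigo_on K p (\<lambda>\<epsilon>. pds is (u \<epsilon>))) \<Longrightarrow>
       (\<lambda>\<epsilon>. norm (t \<epsilon> (u \<epsilon>))) \<in> O[at_right 0](\<lambda>\<epsilon>. \<epsilon> powr (p - real N))"
proof -
  obtain j N :: nat and c \<eta> where *: "c > 0" "\<eta> \<in> {0<..1}"
    "\<And>f \<epsilon>. f \<in> test_functions K \<Longrightarrow> \<epsilon> \<in> {0<..\<eta>} \<Longrightarrow>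
        norm (t \<epsilon> f) \<le> c * \<epsilon> powr (- real N) * sup_deriv K j f"
    using assms unfolding moderate_distributions_def by meson
  show thesis
  proof (rule that[of j N])
    fix u p
    assume u: "\<And>\<epsilon>. \<epsilon> \<in> {0<..1} \<Longrightarrow> smooth_on UNIV (u \<epsilon>)" "supported_in K u"
      "\<And>is. length is \<le> j \<Longrightarrow> bigo_on K p (\<lambda>\<epsilon>. pds is (u \<epsilon>))"
    have s: "(\<lambda>\<epsilon>. sup_deriv K j (u \<epsilon>)) \<in> O[at_right 0](\<lambda>\<epsilon>. \<epsilon> powr p)"
      by (subst sup_deriv_bigo_iff[OF open_UNIV _ assms(2) subset_UNIV]) (use u in auto)
    have "(\<lambda>\<epsilon>. norm (t \<epsilon> (u \<epsilon>))) \<in> O[at_right 0](\<lambda>\<epsilon>. \<epsilon> powr (- real N) * sup_deriv K j (u \<epsilon>))"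
    proof (rule bigoI[where c = c])
      have "\<forall>\<^sub>F \<epsilon> in at_right 0. \<epsilon> \<in> {0<..<\<eta>}" by (rule eventually_at_right_real) (use *(2) in auto)
      then show "\<forall>\<^sub>F \<epsilon> in at_right 0. norm (norm (t \<epsilon> (u \<epsilon>))) \<le> c * norm (\<epsilon> powr (- real N) * sup_deriv K j (u \<epsilon>))"
        using eventually_unit
      proof eventually_elim
        case (elim \<epsilon>)
        have "u \<epsilon> \<in> test_functions K"
          using u(1)[OF elim(2)] u(2) elim(2) by (auto simp: test_functions_def supported_in_def)
        from *(3)[OF this, of \<epsilon>] elim show ?case
          using sup_deriv_nonneg[OF assms(2) u(1)[OF elim(2)] subset_UNIV, of j] by (simp add: mult.assoc)
      qed
    qed
    then have "(\<lambda>\<epsilon>. norm (t \<epsilon> (u \<epsilon>))) \<in> O[at_right 0](\<lambda>\<epsilon>. \<epsilon> powr (- real N) * \<epsilon> powr p)"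
      by (rule landau_o.big_trans[OF _ landau_o.big.mult_left[OF s]])
    then show "(\<lambda>\<epsilon>. norm (t \<epsilon> (u \<epsilon>))) \<in> O[at_right 0](\<lambda>\<epsilon>. \<epsilon> powr (p - real N))"
      by (simp flip: powr_add)
  qed
qed

lemma moderate_distributions_moderate:
  assumes "moderate_distributions \<Omega> t" "compact K" "K \<subseteq> \<Omega>" "moderate_on UNIV u" "supported_in K u"
  shows "moderate_net (\<lambda>\<epsilon>. t \<epsilon> (u \<epsilon>))"
  using assms(1-3)
proof (rule moderate_distributions_bigo)
  fix j N :: nat
  assume *: "\<And>u p. (\<And>\<epsilon>. \<epsilon> \<in> {0<..1} \<Longrightarrow> smooth_on UNIV (u \<epsilon>)) \<Longrightarrow> supported_in K u \<Longrightarrow>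
       (\<And>is. length is \<le> j \<Longrightarrow> bigo_on K p (\<lambda>\<epsilon>. pds is (u \<epsilon>))) \<Longrightarrow>
       (\<lambda>\<epsilon>. norm (t \<epsilon> (u \<epsilon>))) \<in> O[at_right 0](\<lambda>\<epsilon>. \<epsilon> powr (p - real N))"
  obtain M :: nat where M: "\<And>is. length is \<le> j \<Longrightarrow> bigo_on K (- real M) (\<lambda>\<epsilon>. pds is (u \<epsilon>))"
    using moderate_onD[OF open_UNIV assms(4,2) subset_UNIV] by blast
  have "(\<lambda>\<epsilon>. norm (t \<epsilon> (u \<epsilon>))) \<in> O[at_right 0](\<lambda>\<epsilon>. \<epsilon> powr (- real M - real N))"
    by (rule *[OF moderate_on_smooth[OF assms(4)] assms(5) M])
  then show ?thesis unfolding moderate_net_def by (intro exI[of _ "M + N"]) simp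
qed

lemma moderate_distributions_negligible:
  assumes "moderate_distributions \<Omega> t" "compact K" "K \<subseteq> \<Omega>" "negligible_on UNIV u" "supported_in K u"
  shows "negligible_net (\<lambda>\<epsilon>. t \<epsilon> (u \<epsilon>))"
  using assms(1-3)
proof (rule moderate_distributions_bigo)
  fix j N :: nat
  assume *: "\<And>u p. (\<And>\<epsilon>. \<epsilon> \<in> {0<..1} \<Longrightarrow> smooth_on UNIV (u \<epsilon>)) \<Longrightarrow> supported_in K u \<Longrightarrow>
       (\<And>is. length is \<le> j \<Longrightarrow> bigo_on K p (\<lambda>\<epsilon>. pds is (u \<epsilon>))) \<Longrightarrow>
       (\<lambda>\<epsilon>. norm (t \<epsilon> (u \<epsilon>))) \<in> O[at_right 0](\<lambda>\<epsilon>. \<epsilon> powr (p - real N))"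
  show ?thesis unfolding negligible_net_def
  proof
    fix q :: nat
    have "(\<lambda>\<epsilon>. norm (t \<epsilon> (u \<epsilon>))) \<in> O[at_right 0](\<lambda>\<epsilon>. \<epsilon> powr (real (q + N) - real N))"
      by (rule *[OF negligible_on_smooth[OF assms(4)] assms(5) negligible_onD[OF open_UNIV assms(4,2) subset_UNIV]])
    then show "(\<lambda>\<epsilon>. norm (t \<epsilon> (u \<epsilon>))) \<in> O[at_right 0](\<lambda>\<epsilon>. \<epsilon> powr (real q))" by simp
  qed
qed

lemma negligible_net_cong:
  assumes "negligible_net r" "\<And>\<epsilon>. \<epsilon> \<in> {0<..1} \<Longrightarrow> norm (s \<epsilon>) \<le> norm (r \<epsilon>)"
  shows "negligible_net s"
  unfolding negligible_net_def
proof
  fix q :: nat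
  have "(\<lambda>\<epsilon>. norm (s \<epsilon>)) \<in> O[at_right 0](\<lambda>\<epsilon>. norm (r \<epsilon>))"
    by (rule bigoI[where c = 1]) (use eventually_unit in eventually_elim, use assms(2) in auto)
  then show "(\<lambda>\<epsilon>. norm (s \<epsilon>)) \<in> O[at_right 0](\<lambda>\<epsilon>. \<epsilon> powr (real q))"
    using assms(1) landau_o.big_trans unfolding negligible_net_def by blast
qed

lemma moderate_net_cong:
  assumes "moderate_net r" "\<And>\<epsilon>. \<epsilon> \<in> {0<..1} \<Longrightarrow> norm (s \<epsilon>) \<le> norm (r \<epsilon>)"
  shows "moderate_net s"
proof -
  have "(\<lambda>\<epsilon>. norm (s \<epsilon>)) \<in> O[at_right 0](\<lambda>\<epsilon>. norm (r \<epsilon>))"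
    by (rule bigoI[where c = 1]) (use eventually_unit in eventually_elim, use assms(2) in auto)
  then show ?thesis
    using assms(1) landau_o.big_trans unfolding moderate_net_def by blast
qed

lemma abs_gnum_cong:
  assumes "moderate_net r" "\<And>\<epsilon>. \<epsilon> \<in> {0<..1} \<Longrightarrow> s \<epsilon> = r \<epsilon>"
  shows "abs_gnum s = abs_gnum r"
proof (rule abs_gnum_eqI)
  show "moderate_net s" by (rule moderate_net_cong[OF assms(1)]) (use assms(2) in simp)
  show "negligible_net (\<lambda>\<epsilon>. s \<epsilon> - r \<epsilon>)"
    by (rule negligible_net_cong[OF negligible_net_zero[where 'a = 'a]]) (use assms(2) in simp)
qed (rule assms(1))

lemma test_functionI:
  assumes "moderate_on UNIV u" "supported_in K u" "\<epsilon> \<in> {0<..1}"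
  shows "u \<epsilon> \<in> test_functions K"
  using assms moderate_on_smooth[OF assms(1,3)] by (auto simp: test_functions_def supported_in_def)

lemma distribution_add:
  assumes "distribution \<Omega> t" "compact K" "K \<subseteq> \<Omega>" "f \<in> test_functions K" "g \<in> test_functions K"
  shows "t (\<lambda>x. f x + g x) = t f + t g"
  using assms unfolding distribution_def by blast

lemma distribution_cmult:
  assumes "distribution \<Omega> t" "compact K" "K \<subseteq> \<Omega>" "f \<in> test_functions K"
  shows "t (\<lambda>x. a * f x) = a * t f"
  using assms unfolding distribution_def by blast

lemma distribution_diff:
  assumes "distribution \<Omega> t" "compact K" "K \<subseteq> \<Omega>" "f \<in> test_functions K" "g \<in> test_functions K"
  shows "t (\<lambda>x. f x - g x) = t f - t g"
proof -
  have "(\<lambda>x. - 1 * g x) \<in> test_functions K"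
    using assms(5) smooth_on_cmult[OF open_UNIV, of g "-1"] by (simp add: test_functions_def)
  from distribution_add[OF assms(1-4) this] distribution_cmult[OF assms(1-3,5), of "-1"]
  show ?thesis by simp
qed

context
  fixes \<Omega> :: "(real^'n::finite) set" and t :: "real \<Rightarrow> (real^'n \<Rightarrow> complex) \<Rightarrow> complex"
  assumes op: "open \<Omega>" and t: "moderate_distributions \<Omega> t"
begin

text \<open>Two compactly supported representatives differ by a negligible net with compact support, on which
  the distributions are negligible.\<close>

lemma gfunctional_of_eq:
  assumes "U \<in> \<G> \<Omega>" "compact_rep \<Omega> U u"
  shows "gfunctional_of \<Omega> t U = abs_gnum (\<lambda>\<epsilon>. t \<epsilon> (u \<epsilon>))" "moderate_net (\<lambda>\<epsilon>. t \<epsilon> (u \<epsilon>))"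
proof -
  have m: "moderate_net (\<lambda>\<epsilon>. t \<epsilon> (v \<epsilon>))" if "compact_rep \<Omega> U v" for v
    using that
  proof (rule compact_repE)
    fix L assume L: "v \<in> U" "compact L" "L \<subseteq> \<Omega>" "supported_in L v"
    show ?thesis
      by (rule moderate_distributions_moderate[OF t L(2,3) compact_rep_moderate[OF op assms(1) that] L(4)])
  qed
  show "moderate_net (\<lambda>\<epsilon>. t \<epsilon> (u \<epsilon>))" by (rule m[OF assms(2)])
  have c: "compact_rep \<Omega> U (crep \<Omega> U)" unfolding crep_def by (rule someI[of "compact_rep \<Omega> U", OF assms(2)])
  obtain L where L: "compact L" "L \<subseteq> \<Omega>" "supported_in L (crep \<Omega> U)" using c by (rule compact_repE)
  obtain L' where L': "compact L'" "L' \<subseteq> \<Omega>" "supported_in L' u" using assms(2) by (rule compact_repE)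
  define K where "K = L \<union> L'"
  have K: "compact K" "K \<subseteq> \<Omega>" using L L' by (auto simp: K_def)
  have s: "supported_in K (crep \<Omega> U)" "supported_in K u"
    using L(3) L'(3) by (auto simp: K_def elim: supported_in_mono)
  note mod = compact_rep_moderate[OF op assms(1) c] compact_rep_moderate[OF op assms]
  have "negligible_on UNIV (\<lambda>\<epsilon> x. crep \<Omega> U \<epsilon> x - u \<epsilon> x)"
    using op assms(1) c assms(2) by (rule compact_rep_negligible_diff)
  then have "negligible_net (\<lambda>\<epsilon>. t \<epsilon> (\<lambda>x. crep \<Omega> U \<epsilon> x - u \<epsilon> x))"
    by (rule moderate_distributions_negligible[OF t K]) (use s in \<open>auto simp: supported_in_def\<close>)
  then have "negligible_net (\<lambda>\<epsilon>. t \<epsilon> (crep \<Omega> U \<epsilon>) - t \<epsilon> (u \<epsilon>))"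
  proof (rule negligible_net_cong)
    fix \<epsilon> :: real assume e: "\<epsilon> \<in> {0<..1}"
    then have "distribution \<Omega> (t \<epsilon>)" using t by (auto simp: moderate_distributions_def)
    from distribution_diff[OF this K test_functionI[OF mod(1) s(1) e] test_functionI[OF mod(2) s(2) e]]
    show "norm (t \<epsilon> (crep \<Omega> U \<epsilon>) - t \<epsilon> (u \<epsilon>)) \<le> norm (t \<epsilon> (\<lambda>x. crep \<Omega> U \<epsilon> x - u \<epsilon> x))" by simp
  qed
  then show "gfunctional_of \<Omega> t U = abs_gnum (\<lambda>\<epsilon>. t \<epsilon> (u \<epsilon>))"
    unfolding gfunctional_of_def by (intro abs_gnum_eqI m c assms(2))
qed

lemma gfunctional_of_lincomb:
  assumes U: "U \<in> \<G>_c \<Omega>" and V: "V \<in> \<G>_c \<Omega>"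
  shows "gfunctional_of \<Omega> t (gadd \<Omega> U V) = gfunctional_of \<Omega> t U + gfunctional_of \<Omega> t V"
    and "gfunctional_of \<Omega> t (gsub \<Omega> U V) = gfunctional_of \<Omega> t U - gfunctional_of \<Omega> t V"
    and "gfunctional_of \<Omega> t (gsmult \<Omega> a U) = a * gfunctional_of \<Omega> t U"
proof -
  have G: "U \<in> \<G> \<Omega>" "V \<in> \<G> \<Omega>" using U V by (auto simp: \<G>_c_def)
  define u v where "u = crep \<Omega> U" and "v = crep \<Omega> V"
  have u: "compact_rep \<Omega> U u" and v: "compact_rep \<Omega> V v"
    unfolding u_def v_def by (intro compact_rep_crep op U V)+
  obtain L where L: "u \<in> U" "compact L" "L \<subseteq> \<Omega>" "supported_in L u" using u by (rule compact_repE)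
  obtain L' where L': "v \<in> V" "compact L'" "L' \<subseteq> \<Omega>" "supported_in L' v" using v by (rule compact_repE)
  define K where "K = L \<union> L'"
  have K: "compact K" "K \<subseteq> \<Omega>" using L L' by (auto simp: K_def)
  have s: "supported_in K u" "supported_in K v"
    using L(4) L'(4) by (auto simp: K_def elim: supported_in_mono)
  note gU = moderate_on_grep[OF op G(1)] grep_in[OF op G(1)]
  note gV = moderate_on_grep[OF op G(2)] grep_in[OF op G(2)]
  note nU = G_negligible_diff[OF op G(1) gU(2) L(1)]
  note nV = G_negligible_diff[OF op G(2) gV(2) L'(1)]
  note mu = G_mem(1)[OF op G(1) L(1)] and mv = G_mem(1)[OF op G(2) L'(1)]
  note TU = gfunctional_of_eq[OF G(1) u] and TV = gfunctional_of_eq[OF G(2) v]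
  note mod = compact_rep_moderate[OF op G(1) u] compact_rep_moderate[OF op G(2) v]
  have tf: "distribution \<Omega> (t \<epsilon>)" "u \<epsilon> \<in> test_functions K" "v \<epsilon> \<in> test_functions K" if "\<epsilon> \<in> {0<..1}" for \<epsilon>
    using that t test_functionI[OF mod(1) s(1) that] test_functionI[OF mod(2) s(2) that]
    by (auto simp: moderate_distributions_def)
  have "negligible_on \<Omega> (\<lambda>\<epsilon> x. grep U \<epsilon> x + grep V \<epsilon> x - (u \<epsilon> x + v \<epsilon> x))"
    using negligible_on_add[OF op nU nV] by (simp add: algebra_simps)
  then have "(\<lambda>\<epsilon> x. u \<epsilon> x + v \<epsilon> x) \<in> gadd \<Omega> U V"
    unfolding gadd_def gclass_iff by (intro conjI moderate_on_add op gU gV mu mv)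
  then have "compact_rep \<Omega> (gadd \<Omega> U V) (\<lambda>\<epsilon> x. u \<epsilon> x + v \<epsilon> x)"
    using K by (rule compact_repI) (use s in \<open>auto simp: supported_in_def\<close>)
  moreover have "gadd \<Omega> U V \<in> \<G> \<Omega>"
    unfolding gadd_def by (intro gclass_in_G moderate_on_add op gU gV)
  ultimately have "gfunctional_of \<Omega> t (gadd \<Omega> U V) = abs_gnum (\<lambda>\<epsilon>. t \<epsilon> (\<lambda>x. u \<epsilon> x + v \<epsilon> x))"
    by (intro gfunctional_of_eq)
  also have "\<dots> = abs_gnum (\<lambda>\<epsilon>. t \<epsilon> (u \<epsilon>) + t \<epsilon> (v \<epsilon>))"
    by (intro abs_gnum_cong moderate_net_add TU TV distribution_add[OF _ K] tf)
  finally show "gfunctional_of \<Omega> t (gadd \<Omega> U V) = gfunctional_of \<Omega> t U + gfunctional_of \<Omega> t V"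
    by (simp add: TU TV abs_gnum_add)
  have "negligible_on \<Omega> (\<lambda>\<epsilon> x. grep U \<epsilon> x - grep V \<epsilon> x - (u \<epsilon> x - v \<epsilon> x))"
    using negligible_on_diff[OF op nU nV] by (simp add: algebra_simps)
  then have "(\<lambda>\<epsilon> x. u \<epsilon> x - v \<epsilon> x) \<in> gsub \<Omega> U V"
    unfolding gsub_def gclass_iff by (intro conjI moderate_on_diff op gU gV mu mv)
  then have "compact_rep \<Omega> (gsub \<Omega> U V) (\<lambda>\<epsilon> x. u \<epsilon> x - v \<epsilon> x)"
    using K by (rule compact_repI) (use s in \<open>auto simp: supported_in_def\<close>)
  moreover have "gsub \<Omega> U V \<in> \<G> \<Omega>"
    unfolding gsub_def by (intro gclass_in_G moderate_on_diff op gU gV)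
  ultimately have "gfunctional_of \<Omega> t (gsub \<Omega> U V) = abs_gnum (\<lambda>\<epsilon>. t \<epsilon> (\<lambda>x. u \<epsilon> x - v \<epsilon> x))"
    by (intro gfunctional_of_eq)
  also have "\<dots> = abs_gnum (\<lambda>\<epsilon>. t \<epsilon> (u \<epsilon>) - t \<epsilon> (v \<epsilon>))"
    by (intro abs_gnum_cong moderate_net_diff TU TV distribution_diff[OF _ K] tf)
  finally show "gfunctional_of \<Omega> t (gsub \<Omega> U V) = gfunctional_of \<Omega> t U - gfunctional_of \<Omega> t V"
    by (simp add: TU TV abs_gnum_diff)
  note a = moderate_net_rep_gnum[of a]
  have "negligible_on \<Omega> (\<lambda>\<epsilon> x. rep_gnum a \<epsilon> * grep U \<epsilon> x - rep_gnum a \<epsilon> * u \<epsilon> x)"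
    using negligible_on_cmult[OF op a nU] by (simp add: algebra_simps)
  then have "(\<lambda>\<epsilon> x. rep_gnum a \<epsilon> * u \<epsilon> x) \<in> gsmult \<Omega> a U"
    unfolding gsmult_def gclass_iff by (intro conjI moderate_on_cmult op gU mu a)
  then have "compact_rep \<Omega> (gsmult \<Omega> a U) (\<lambda>\<epsilon> x. rep_gnum a \<epsilon> * u \<epsilon> x)"
    using K by (rule compact_repI) (use s in \<open>auto simp: supported_in_def\<close>)
  moreover have "gsmult \<Omega> a U \<in> \<G> \<Omega>"
    unfolding gsmult_def by (intro gclass_in_G moderate_on_cmult op gU a)
  ultimately have "gfunctional_of \<Omega> t (gsmult \<Omega> a U) = abs_gnum (\<lambda>\<epsilon>. t \<epsilon> (\<lambda>x. rep_gnum a \<epsilon> * u \<epsilon> x))"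
    by (intro gfunctional_of_eq)
  also have "\<dots> = abs_gnum (\<lambda>\<epsilon>. rep_gnum a \<epsilon> * t \<epsilon> (u \<epsilon>))"
    by (intro abs_gnum_cong moderate_net_mult a TU distribution_cmult[OF _ K] tf)
  also have "\<dots> = abs_gnum (rep_gnum a) * abs_gnum (\<lambda>\<epsilon>. t \<epsilon> (u \<epsilon>))"
    by (simp add: abs_gnum_mult a TU(2))
  finally show "gfunctional_of \<Omega> t (gsmult \<Omega> a U) = a * gfunctional_of \<Omega> t U"
    by (simp add: TU abs_gnum_rep_gnum)
qed

text \<open>In terms of valuations, \<open>v(TU) \<ge> v\<^bsub>K,j\<^esub>(U) - N\<close>.\<close>

lemma abs_e_gfunctional_of_le:
  assumes "compact K" "K \<subseteq> \<Omega>"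
  obtains j N :: nat where
    "\<And>U u. U \<in> \<G> \<Omega> \<Longrightarrow> u \<in> U \<Longrightarrow> supported_in K u \<Longrightarrow>
       abs_e (gfunctional_of \<Omega> t U) \<le> exp (real N) * exp_neg (gval K j U)"
  using t assms
proof (rule moderate_distributions_bigo)
  fix j N :: nat
  assume *: "\<And>u p. (\<And>\<epsilon>. \<epsilon> \<in> {0<..1} \<Longrightarrow> smooth_on UNIV (u \<epsilon>)) \<Longrightarrow> supported_in K u \<Longrightarrow>
       (\<And>is. length is \<le> j \<Longrightarrow> bigo_on K p (\<lambda>\<epsilon>. pds is (u \<epsilon>))) \<Longrightarrow>
       (\<lambda>\<epsilon>. norm (t \<epsilon> (u \<epsilon>))) \<in> O[at_right 0](\<lambda>\<epsilon>. \<epsilon> powr (p - real N))"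
  show thesis
  proof (rule that[of N j])
    fix U u assume U: "U \<in> \<G> \<Omega>" "u \<in> U" "supported_in K u"
    have u: "compact_rep \<Omega> U u" by (rule compact_repI[OF U(2) assms U(3)])
    note T = gfunctional_of_eq[OF U(1) u]
    note g = moderate_on_grep[OF op U(1)] grep_in[OF op U(1)]
    note n = G_negligible_diff[OF op U(1,2) g(2)]
    have sd: "(\<lambda>\<epsilon>. sup_deriv K j (grep U \<epsilon>)) \<in> O[at_right 0](\<lambda>\<epsilon>. \<epsilon> powr b) \<longleftrightarrow>
        (\<forall>is. length is \<le> j \<longrightarrow> bigo_on K b (\<lambda>\<epsilon>. pds is (grep U \<epsilon>)))" for b
      by (rule sup_deriv_bigo_iff[OF op _ assms]) (rule moderate_on_smooth[OF g(1)])
    have bound: "(\<lambda>\<epsilon>. norm (t \<epsilon> (u \<epsilon>))) \<in> O[at_right 0](\<lambda>\<epsilon>. \<epsilon> powr (b - real N))"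
      if "(\<lambda>\<epsilon>. sup_deriv K j (grep U \<epsilon>)) \<in> O[at_right 0](\<lambda>\<epsilon>. \<epsilon> powr b)" for b
    proof (rule *[OF _ U(3)])
      show "smooth_on UNIV (u \<epsilon>)" if "\<epsilon> \<in> {0<..1}" for \<epsilon>
        by (rule moderate_on_smooth[OF compact_rep_moderate[OF op U(1) u] that])
      fix "is" :: "'n list" assume "length is \<le> j"
      then have "bigo_on K b (\<lambda>\<epsilon>. pds is (grep U \<epsilon>))" using sd that by blast
      from bigo_on_add[OF this negligible_onD[OF op n assms]]
      show "bigo_on K b (\<lambda>\<epsilon>. pds is (u \<epsilon>))"
      proof (rule bigo_on_cong)
        fix \<epsilon> :: real and x assume ex: "\<epsilon> \<in> {0<..1}" "x \<in> K"
        have "pds is (\<lambda>x. u \<epsilon> x - grep U \<epsilon> x) x = pds is (u \<epsilon>) x - pds is (grep U \<epsilon>) x"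
          using ex assms(2) moderate_on_smooth[OF G_mem(1)[OF op U(1,2)] ex(1)] moderate_on_smooth[OF g(1) ex(1)]
          by (intro pds_diff[OF op]) auto
        then show "norm (pds is (u \<epsilon>) x) \<le> norm (pds is (grep U \<epsilon>) x + pds is (\<lambda>x. u \<epsilon> x - grep U \<epsilon> x) x)"
          by simp
      qed
    qed
    have ninf: "gval K j U \<noteq> -\<infinity>"
    proof -
      obtain M :: nat where "\<And>is. length is \<le> j \<Longrightarrow> bigo_on K (- real M) (\<lambda>\<epsilon>. pds is (grep U \<epsilon>))"
        using moderate_onD[OF op g(1) assms] by blast
      then have "(\<lambda>\<epsilon>. sup_deriv K j (grep U \<epsilon>)) \<in> O[at_right 0](\<lambda>\<epsilon>. \<epsilon> powr (- real M))" using sd by blast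
      then have "ereal (- real M) \<le> gval K j U" unfolding gval_def by (intro Sup_upper) blast
      then show ?thesis by auto
    qed
    have "gval K j U \<le> valuation (gfunctional_of \<Omega> t U) + ereal (real N)"
      unfolding gval_def
    proof (rule Sup_least, clarify)
      fix b assume "(\<lambda>\<epsilon>. sup_deriv K j (grep U \<epsilon>)) \<in> O[at_right 0](\<lambda>\<epsilon>. \<epsilon> powr b)"
      from le_valuation[OF T(2) bound[OF this]]
      have "ereal (b - real N) \<le> valuation (gfunctional_of \<Omega> t U)" by (simp add: T(1))
      from add_right_mono[OF this, of "ereal (real N)"]
      show "ereal b \<le> valuation (gfunctional_of \<Omega> t U) + ereal (real N)" by simp
    qed
    then have "gval K j U + ereal (- real N) \<le> valuation (gfunctional_of \<Omega> t U)"
      by (cases "gval K j U"; cases "valuation (gfunctional_of \<Omega> t U)") auto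
    from exp_neg_le[OF ninf this]
    show "abs_e (gfunctional_of \<Omega> t U) \<le> exp (real N) * exp_neg (gval K j U)"
      by (simp add: abs_e_def)
  qed
qed

end

lemma topspace_seminorm_topology: "topspace (seminorm_topology A sub P) \<subseteq> A"
  unfolding seminorm_topology_def topology_generated_by_topspace by blast

lemma openin_seminorm_ball:
  "p \<in> P \<Longrightarrow> u \<in> A \<Longrightarrow> r > 0 \<Longrightarrow> openin (seminorm_topology A sub P) {v \<in> A. p (sub v u) < r}"
  unfolding seminorm_topology_def by (rule topology_generated_by_Basis) blast

text \<open>The map \<open>U \<mapsto> |TU|\<^sub>e\<close> is an ultra-pseudo-seminorm, and its restrictions to the spaces
  \<open>\<G>\<^sub>K(\<Omega>)\<close> are continuous by the preceding estimate. So it is one of the seminorms that define the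
  inductive limit topology, and \<open>T\<close> is continuous.\<close>

theorem basic_gfunctional_of:
  assumes op: "open \<Omega>" and t: "moderate_distributions \<Omega> t"
  shows "basic \<Omega> (gfunctional_of \<Omega> t)"
proof -
  let ?T = "gfunctional_of \<Omega> t"
  note lin = gfunctional_of_lincomb[OF op t]
  have ultra: "ultra_pseudo_seminorm \<Omega> (\<lambda>U. abs_e (?T U))"
    unfolding ultra_pseudo_seminorm_def
    using lin abs_e_nonneg abs_e_mult_le abs_e_add_le by metis
  have T0: "?T (gsub \<Omega> U U) = 0" if "U \<in> \<G>_c \<Omega>" for U
    using lin(2)[OF that that] by simp
  have contK: "continuous_map (\<G>_K_topology \<Omega> K) euclideanreal (\<lambda>U. abs_e (?T U))"
    if K: "compact K" "K \<subseteq> \<Omega>" for K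
  proof -
    obtain \<phi> :: "real^'a \<Rightarrow> real" and L V where \<phi>: "compact L" "L \<subseteq> \<Omega>" "\<And>x. x \<notin> L \<Longrightarrow> \<phi> x = 0"
      "open V" "K \<subseteq> V" "\<And>x. x \<in> V \<Longrightarrow> \<phi> x = 1"
      using smooth_cutoff[OF K(1) op K(2)] by metis
    \<comment> \<open>Only the support \<open>L\<close> of the cutoff function is used, as a compact neighbourhood of \<open>K\<close> in \<open>\<Omega>\<close>.\<close>
    have KL: "K \<subseteq> interior L"
      using \<phi>(3-6) by (metis (no_types, opaque_lifting) interior_maximal subset_eq subset_trans zero_neq_one)
    obtain j N :: nat where est: "\<And>U u. U \<in> \<G> \<Omega> \<Longrightarrow> u \<in> U \<Longrightarrow> supported_in L u \<Longrightarrow>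
        abs_e (?T U) \<le> exp (real N) * exp_neg (gval L j U)"
      using abs_e_gfunctional_of_le[OF op t \<phi>(1,2)] by metis
    have est': "abs_e (?T (gsub \<Omega> U V)) \<le> exp (real N) * exp_neg (gval L j (gsub \<Omega> U V))"
      if UV: "U \<in> \<G>_K \<Omega> K" "V \<in> \<G>_K \<Omega> K" for U V
    proof -
      \<comment> \<open>The estimate requires representatives supported in \<open>L\<close>; those of elements of \<open>\<G>\<^sub>K(\<Omega>)\<close> can be
        chosen so because \<open>L\<close> is a neighbourhood of \<open>K\<close>.\<close>
      have rep: "\<exists>u. u \<in> U \<and> supported_in L u \<and> moderate_on \<Omega> u \<and> moderate_on \<Omega> (grep U) \<and>
          negligible_on \<Omega> (\<lambda>\<epsilon> x. grep U \<epsilon> x - u \<epsilon> x)" if "U \<in> \<G>_K \<Omega> K" for U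
      proof -
        have U: "U \<in> \<G>_c \<Omega>" "U \<in> \<G> \<Omega>" "gsupp \<Omega> U \<subseteq> interior L"
          using that KL by (auto simp: \<G>_K_def \<G>_c_def)
        have "interior L \<subseteq> \<Omega>" using \<phi>(2) interior_subset by blast
        then obtain u L' where u: "u \<in> U" "compact L'" "L' \<subseteq> interior L" "supported_in L' u"
          using compact_rep_exists[OF op U(1,3) open_interior] by metis
        have "L' \<subseteq> L" using u(3) interior_subset by blast
        then show ?thesis
          using u supported_in_mono G_mem(1)[OF op U(2)] grep_in[OF op U(2)] G_negligible_diff[OF op U(2)]
          by blast
      qed
      obtain u where u: "supported_in L u" "moderate_on \<Omega> u" "moderate_on \<Omega> (grep U)"
          "negligible_on \<Omega> (\<lambda>\<epsilon> x. grep U \<epsilon> x - u \<epsilon> x)" using rep[OF UV(1)] by blast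
      obtain v where v: "supported_in L v" "moderate_on \<Omega> v" "moderate_on \<Omega> (grep V)"
          "negligible_on \<Omega> (\<lambda>\<epsilon> x. grep V \<epsilon> x - v \<epsilon> x)" using rep[OF UV(2)] by blast
      have "negligible_on \<Omega> (\<lambda>\<epsilon> x. grep U \<epsilon> x - grep V \<epsilon> x - (u \<epsilon> x - v \<epsilon> x))"
        using negligible_on_diff[OF op u(4) v(4)] by (simp add: algebra_simps)
      then have "(\<lambda>\<epsilon> x. u \<epsilon> x - v \<epsilon> x) \<in> gsub \<Omega> U V"
        unfolding gsub_def gclass_iff by (intro conjI moderate_on_diff op u v)
      moreover have "gsub \<Omega> U V \<in> \<G> \<Omega>"
        unfolding gsub_def by (intro gclass_in_G moderate_on_diff op u v)
      moreover have "supported_in L (\<lambda>\<epsilon> x. u \<epsilon> x - v \<epsilon> x)"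
        using u(1) v(1) by (auto simp: supported_in_def)
      ultimately show ?thesis by (intro est)
    qed
    have gval0: "exp_neg (gval L j (gsub \<Omega> U U)) = 0" if "U \<in> \<G>_K \<Omega> K" for U
    proof -
      have U: "U \<in> \<G> \<Omega>" using that by (auto simp: \<G>_K_def \<G>_c_def)
      have "moderate_on \<Omega> (\<lambda>\<epsilon> x. 0)" by (rule moderate_on_const[OF op moderate_net_const])
      then have G: "gsub \<Omega> U U \<in> \<G> \<Omega>" "(\<lambda>\<epsilon> x. 0) \<in> gsub \<Omega> U U"
        unfolding gsub_def by (auto intro!: gclass_in_G gclass_self[OF op])
      note g = moderate_on_grep[OF op G(1)]
      have n: "negligible_on \<Omega> (grep (gsub \<Omega> U U))"
        using G_negligible_diff[OF op G(1) grep_in[OF op G(1)] G(2)] by simp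
      have *: "(\<lambda>\<epsilon>. sup_deriv L j (grep (gsub \<Omega> U U) \<epsilon>)) \<in> O[at_right 0](\<lambda>\<epsilon>. \<epsilon> powr b)" for b
        by (subst sup_deriv_bigo_iff[OF op _ \<phi>(1,2)])
           (auto intro: moderate_on_smooth[OF g] negligible_onD[OF op n \<phi>(1,2)])
      have "gval L j (gsub \<Omega> U U) = \<infinity>"
        unfolding gval_def
      proof (rule ereal_top)
        show "ereal B \<le> Sup {ereal b | b. (\<lambda>\<epsilon>. sup_deriv L j (grep (gsub \<Omega> U U) \<epsilon>)) \<in> O[at_right 0](\<lambda>\<epsilon>. \<epsilon> powr b)}" for B
          by (rule Sup_upper) (use * in blast)
      qed
      then show ?thesis by (simp add: exp_neg_def)
    qed
    show ?thesis
      unfolding continuous_map_def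
    proof (intro conjI allI impI)
      fix S :: "real set" assume "openin euclideanreal S"
      then have S: "open S" by simp
      let ?Q = "{x \<in> topspace (\<G>_K_topology \<Omega> K). abs_e (?T x) \<in> S}"
      show "openin (\<G>_K_topology \<Omega> K) ?Q"
      proof (subst openin_subopen, intro ballI)
        fix U assume U: "U \<in> ?Q"
        then have UK: "U \<in> \<G>_K \<Omega> K"
          using topspace_seminorm_topology unfolding \<G>_K_topology_def by fastforce
        obtain e where e: "e > 0" "\<And>y. \<bar>y - abs_e (?T U)\<bar> < e \<Longrightarrow> y \<in> S"
          using S U unfolding open_dist dist_real_def by blast
        define d where "d = e * exp (- real N)"
        have d: "d > 0" "exp (real N) * d = e" using e(1) by (auto simp: d_def exp_minus)
        let ?B = "{V \<in> \<G>_K \<Omega> K. exp_neg (gval L j (gsub \<Omega> V U)) < d}"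
        have "openin (\<G>_K_topology \<Omega> K) ?B"
          unfolding \<G>_K_topology_def
          by (rule openin_seminorm_ball[where p = "\<lambda>U. exp_neg (gval L j U)"]) (use \<phi>(1,2) KL UK d(1) in blast)+
        moreover have "U \<in> ?B" using UK d(1) gval0 by simp
        moreover have "?B \<subseteq> ?Q"
        proof
          fix V assume V: "V \<in> ?B"
          have "\<bar>abs_e (?T V) - abs_e (?T U)\<bar> \<le> abs_e (?T V - ?T U)" by (rule abs_abs_e_diff_le)
          also have "?T V - ?T U = ?T (gsub \<Omega> V U)"
            using V UK by (intro lin(2)[symmetric]) (auto simp: \<G>_K_def)
          also have "abs_e \<dots> \<le> exp (real N) * exp_neg (gval L j (gsub \<Omega> V U))"
            using V UK by (intro est') auto
          also have "\<dots> < e" using V d(2) by (metis (no_types, lifting) exp_gt_zero mem_Collect_eq mult_less_cancel_left_pos)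
          finally have "abs_e (?T V) \<in> S" by (rule e(2))
          moreover have "V \<in> topspace (\<G>_K_topology \<Omega> K)"
            using openin_subset[OF \<open>openin (\<G>_K_topology \<Omega> K) ?B\<close>] V by blast
          ultimately show "V \<in> ?Q" by blast
        qed
        ultimately show "\<exists>B. openin (\<G>_K_topology \<Omega> K) B \<and> U \<in> B \<and> B \<subseteq> ?Q" by blast
      qed
    qed auto
  qed
  let ?P = "{p. ultra_pseudo_seminorm \<Omega> p \<and>
         (\<forall>K. compact K \<and> K \<subseteq> \<Omega> \<longrightarrow> continuous_map (\<G>_K_topology \<Omega> K) euclideanreal p)}"
  have p: "(\<lambda>U. abs_e (?T U)) \<in> ?P" using ultra contK by blast
  have cont: "continuous_map (\<G>_c_topology \<Omega>) gnum_topology ?T"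
    unfolding gnum_topology_def seminorm_topology_def[of UNIV]
  proof (subst continuous_on_generated_topo_iff, intro conjI allI impI)
    fix B :: "complex gnum set"
    assume "B \<in> {B. \<exists>p\<in>{abs_e}. \<exists>u\<in>UNIV. \<exists>r>0. B = {v \<in> UNIV. p (v - u) < r}}"
    then obtain b r where B: "B = {v. abs_e (v - b) < r}" "r > 0" by auto
    show "openin (\<G>_c_topology \<Omega>) (?T -` B \<inter> topspace (\<G>_c_topology \<Omega>))"
    proof (subst openin_subopen, intro ballI)
      fix U assume U: "U \<in> ?T -` B \<inter> topspace (\<G>_c_topology \<Omega>)"
      then have Uc: "U \<in> \<G>_c \<Omega>"
        using topspace_seminorm_topology unfolding \<G>_c_topology_def by fastforce
      let ?B = "{V \<in> \<G>_c \<Omega>. abs_e (?T (gsub \<Omega> V U)) < r}"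
      have o: "openin (\<G>_c_topology \<Omega>) ?B"
        unfolding \<G>_c_topology_def by (rule openin_seminorm_ball[OF p Uc B(2)])
      moreover have "U \<in> ?B" using Uc B(2) T0 by (simp add: abs_e_0)
      moreover have "?B \<subseteq> ?T -` B \<inter> topspace (\<G>_c_topology \<Omega>)"
      proof
        fix V assume V: "V \<in> ?B"
        then have "?T V - b = ?T (gsub \<Omega> V U) + (?T U - b)" using lin(2) Uc by simp
        then have "abs_e (?T V - b) \<le> max (abs_e (?T (gsub \<Omega> V U))) (abs_e (?T U - b))"
          by (metis abs_e_add_le)
        also have "\<dots> < r" using V U B(1) by auto
        finally show "V \<in> ?T -` B \<inter> topspace (\<G>_c_topology \<Omega>)"
          using openin_subset[OF o] V B(1) by blast
      qed
      ultimately show "\<exists>S. openin (\<G>_c_topology \<Omega>) S \<and> U \<in> S \<and> S \<subseteq> ?T -` B \<inter> topspace (\<G>_c_topology \<Omega>)"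
        by blast
    qed
  next
    have "a \<in> \<Union>{B. \<exists>p\<in>{abs_e}. \<exists>u\<in>UNIV. \<exists>r>0. B = {v \<in> UNIV. p (v - u) < r}}" for a :: "complex gnum"
      using abs_e_0[where 'a = complex]
      by (intro UnionI[of "{v \<in> UNIV. abs_e (v - a) < 1}"]) (auto intro!: exI[of _ 1] exI[of _ a])
    then show "?T ` topspace (\<G>_c_topology \<Omega>) \<subseteq> \<Union>{B. \<exists>p\<in>{abs_e}. \<exists>u\<in>UNIV. \<exists>r>0. B = {v \<in> UNIV. p (v - u) < r}}"
      by blast
  qed
  have "?T \<in> dual \<Omega>" unfolding dual_def using lin cont by blast
  moreover have "?T U = abs_gnum (\<lambda>\<epsilon>. t \<epsilon> (u \<epsilon>))" if "U \<in> \<G>_c \<Omega>" "compact_rep \<Omega> U u" for U u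
    using that gfunctional_of_eq[OF op t] by (auto simp: \<G>_c_def)
  ultimately show ?thesis
    unfolding basic_def using t[unfolded moderate_distributions_def] by blast
qed

section \<open>Integration by parts\<close>

lemma test_functions_smooth: "f \<in> test_functions K \<Longrightarrow> smooth_on UNIV f"
  and test_functions_outside: "f \<in> test_functions K \<Longrightarrow> x \<notin> K \<Longrightarrow> f x = 0"
  by (auto simp: test_functions_def)

lemma test_functions_continuous: "f \<in> test_functions K \<Longrightarrow> continuous_on S f"
  by (meson continuous_on_subset smooth_on_imp_continuous_on subset_UNIV test_functions_smooth)

lemma test_functions_pds:
  assumes "compact K" "f \<in> test_functions K"
  shows "pds is f \<in> test_functions K"
  using assms pds_outside_support[OF compact_imp_closed[OF assms(1)], of f]
  by (auto simp: test_functions_def smooth_on_pds)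

lemma test_functions_mult:
  assumes "f \<in> test_functions K" "smooth_on UNIV g"
  shows "(\<lambda>x. g x * f x) \<in> test_functions K"
  using assms by (auto simp: test_functions_def intro: smooth_on_mult)

lemma integrable_continuous_compact_support:
  fixes f :: "real^'n::finite \<Rightarrow> complex"
  assumes "compact K" "continuous_on K f" "\<And>x. x \<notin> K \<Longrightarrow> f x = 0"
  shows "integrable lborel f"
proof -
  have "integrable lborel (\<lambda>x. indicator K x *\<^sub>R f x)"
    by (rule borel_integrable_compact[OF assms(1,2)])
  moreover have "(\<lambda>x. indicator K x *\<^sub>R f x) = f"
    using assms(3) by (auto simp: fun_eq_iff indicator_def)
  ultimately show ?thesis by simp
qed

lemma norm_integral_le_measure:
  fixes f :: "real^'n::finite \<Rightarrow> complex"
  assumes "compact K" "\<And>x. x \<notin> K \<Longrightarrow> f x = 0" "\<And>x. x \<in> K \<Longrightarrow> norm (f x) \<le> B"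
  shows "norm (\<integral>x. f x \<partial>lborel) \<le> measure lborel K * B"
proof (cases "integrable lborel f")
  case True
  have K: "K \<in> sets lborel" "emeasure lborel K < \<infinity>"
    using assms(1) emeasure_bounded_finite[OF compact_imp_bounded[OF assms(1)]] by (auto simp: borel_compact)
  have int: "integrable lborel (\<lambda>x. indicator K x * B)"
    by (intro integrable_mult_left integrable_real_indicator K)
  have "norm (\<integral>x. f x \<partial>lborel) \<le> (\<integral>x. norm (f x) \<partial>lborel)" by (rule integral_norm_bound)
  also have "\<dots> \<le> (\<integral>x. indicator K x * B \<partial>lborel)"
    by (rule integral_mono[OF integrable_norm[OF True] int]) (use assms in \<open>auto simp: indicator_def\<close>)
  also have "\<dots> = measure lborel K * B" using K by simp
  finally show ?thesis .
next
  case False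
  show ?thesis
  proof (cases "K = {}")
    case False
    then have "B \<ge> 0" using assms(3) norm_ge_zero order_trans by blast
    then show ?thesis using \<open>\<not> integrable lborel f\<close> by (simp add: not_integrable_integral_eq)
  qed (use assms in simp)
qed

lemma integral_translate:
  fixes f :: "real^'n::finite \<Rightarrow> complex"
  assumes "f \<in> borel_measurable borel"
  shows "(\<integral>x. f (x + a) \<partial>lborel) = (\<integral>x. f x \<partial>lborel)"
proof -
  have "(\<integral>x. f x \<partial>lborel) = (\<integral>x. f x \<partial>(distr lborel borel ((+) a)))"
    by (simp add: lborel_distr_plus)
  also have "\<dots> = (\<integral>x. f (a + x) \<partial>lborel)"
    by (rule integral_distr) (use assms in auto)
  finally show ?thesis by (simp add: add.commute)
qed

lemma compact_support_bounded:
  fixes f :: "real^'n::finite \<Rightarrow> complex"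
  assumes "compact K" "f \<in> test_functions K"
  obtains B where "B \<ge> 0" "\<And>x. norm (f x) \<le> B"
proof -
  have "bounded (f ` K)"
    by (intro compact_imp_bounded compact_continuous_image test_functions_continuous[OF assms(2)] assms(1))
  then obtain B where B: "\<And>x. x \<in> K \<Longrightarrow> norm (f x) \<le> B" by (auto simp: bounded_iff)
  show thesis
  proof (rule that[of "\<bar>B\<bar>"])
    show "norm (f x) \<le> \<bar>B\<bar>" for x
      using B[of x] test_functions_outside[OF assms(2), of x] by (cases "x \<in> K") auto
  qed simp
qed

text \<open>By translation invariance of the Lebesgue measure the integrals of the difference quotients of
  \<open>f\<close> vanish. The quotients are bounded by the supremum of the derivative and vanish outside of one
  ball, so that dominated convergence applies.\<close>

lemma integral_pd_eq_0:
  fixes f :: "real^'n::finite \<Rightarrow> complex"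
  assumes K: "compact K" and f: "f \<in> test_functions K"
  shows "(\<integral>x. pd i f x \<partial>lborel) = 0"
proof -
  let ?e = "axis i (1::real) :: real^'n"
  have pdf: "pd i f \<in> test_functions K" using test_functions_pds[OF K f, of "[i]"] by simp
  obtain B where B: "B \<ge> 0" "\<And>x. norm (pd i f x) \<le> B" using compact_support_bounded[OF K pdf] by blast
  obtain R where R: "\<And>x. x \<in> K \<Longrightarrow> norm x \<le> R"
    using compact_imp_bounded[OF K] by (auto simp: bounded_iff)
  have meas: "f \<in> borel_measurable borel" "pd i f \<in> borel_measurable borel"
    by (intro borel_measurable_continuous_onI test_functions_continuous[OF f] test_functions_continuous[OF pdf])+
  have int: "integrable lborel f"
    by (rule integrable_continuous_compact_support[OF K test_functions_continuous[OF f] test_functions_outside[OF f]])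
  have int': "integrable lborel (\<lambda>x. f (x + a))" for a
  proof (rule integrable_continuous_compact_support[where K = "(+) (- a) ` K"])
    show "compact ((+) (- a) ` K)" by (rule compact_translation[OF K])
    show "continuous_on ((+) (- a) ` K) (\<lambda>x. f (x + a))"
      by (rule continuous_on_compose2[OF test_functions_continuous[OF f, of UNIV]]) (auto intro!: continuous_intros)
    fix x assume "x \<notin> (+) (- a) ` K"
    moreover have "x = - a + (x + a)" by simp
    ultimately have "x + a \<notin> K" by blast
    then show "f (x + a) = 0" by (rule test_functions_outside[OF f])
  qed
  define h where "h n = 1 / real (Suc n)" for n
  have h: "0 < h n" "h n \<le> 1" for n by (auto simp: h_def)
  have h0: "h \<longlonglongrightarrow> 0" unfolding h_def using LIMSEQ_inverse_real_of_nat by (simp add: inverse_eq_divide)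
  define s where "s n x = (f (x + h n *\<^sub>R ?e) - f x) /\<^sub>R h n" for n x
  have dv: "((\<lambda>t. f (x + t *\<^sub>R ?e)) has_vector_derivative pd i f (x + t *\<^sub>R ?e)) (at t)" for x t
    by (rule has_vector_derivative_pd) (rule smooth_on_imp_differentiable[OF test_functions_smooth[OF f]], simp)
  have s_lim: "(\<lambda>n. s n x) \<longlonglongrightarrow> pd i f x" for x
  proof -
    have "((\<lambda>t. (f (x + t *\<^sub>R ?e) - f x) /\<^sub>R t) \<longlongrightarrow> pd i f x) (at 0)"
    proof -
      have "((\<lambda>t. norm (f (x + t *\<^sub>R ?e) - f x - t *\<^sub>R pd i f x) / norm t) \<longlongrightarrow> 0) (at 0)"
        using dv[of x 0] by (simp add: has_vector_derivative_def has_derivative_at)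
      then have "((\<lambda>t. norm ((f (x + t *\<^sub>R ?e) - f x) /\<^sub>R t - pd i f x)) \<longlongrightarrow> 0) (at 0)"
      proof (rule Lim_transform_eventually)
        show "\<forall>\<^sub>F t in at 0. norm (f (x + t *\<^sub>R ?e) - f x - t *\<^sub>R pd i f x) / norm t =
            norm ((f (x + t *\<^sub>R ?e) - f x) /\<^sub>R t - pd i f x)"
          unfolding eventually_at_filter
        proof (intro always_eventually allI impI)
          fix t :: real assume t: "t \<noteq> 0"
          have "(f (x + t *\<^sub>R ?e) - f x) /\<^sub>R t - pd i f x = (f (x + t *\<^sub>R ?e) - f x - t *\<^sub>R pd i f x) /\<^sub>R t"
            using t by (simp add: scaleR_right_diff_distrib)
          then show "norm (f (x + t *\<^sub>R ?e) - f x - t *\<^sub>R pd i f x) / norm t =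
              norm ((f (x + t *\<^sub>R ?e) - f x) /\<^sub>R t - pd i f x)"
            by (simp add: divide_inverse mult.commute)
        qed
      qed
      from LIM_zero_cancel[OF tendsto_norm_zero_cancel[OF this]] show ?thesis .
    qed
    moreover have "filterlim h (at 0) sequentially"
      using h0 h by (simp add: filterlim_at less_imp_neq[symmetric])
    ultimately show ?thesis unfolding s_def by (rule filterlim_compose)
  qed
  have s_bound: "norm (s n x) \<le> B" for n x
  proof -
    have "\<exists>t\<in>{0<..<h n}. norm (f (x + h n *\<^sub>R ?e) - f (x + 0 *\<^sub>R ?e)) \<le>
        norm ((h n - 0) *\<^sub>R pd i f (x + t *\<^sub>R ?e))"
      using dv[of x] h[of n] unfolding has_vector_derivative_def
      by (intro mvt_general) (auto intro!: has_derivative_continuous_on intro: has_derivative_at_withinI)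
    then obtain t where "norm (f (x + h n *\<^sub>R ?e) - f x) \<le> h n * norm (pd i f (x + t *\<^sub>R ?e))"
      using h[of n] by auto
    also have "\<dots> \<le> h n * B" using B(2) h[of n] by (intro mult_left_mono) auto
    finally show ?thesis using h[of n] unfolding s_def by (simp add: divide_simps mult.commute)
  qed
  have s_supp: "s n x = 0" if "x \<notin> cball 0 (R + 1)" for n x
  proof -
    have x: "norm x > R + 1" using that by simp
    have "norm x \<le> norm (x + h n *\<^sub>R ?e) + norm (h n *\<^sub>R ?e)"
      by (metis add_diff_cancel norm_triangle_ineq4)
    then have "norm (x + h n *\<^sub>R ?e) > R" using x h[of n] by (simp add: norm_axis_1)
    then have "x + h n *\<^sub>R ?e \<notin> K" "x \<notin> K" using R x by fastforce+
    then show ?thesis using test_functions_outside[OF f] by (simp add: s_def)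
  qed
  have "(\<lambda>n. \<integral>x. s n x \<partial>lborel) \<longlonglongrightarrow> (\<integral>x. pd i f x \<partial>lborel)"
  proof (rule integral_dominated_convergence)
    show "integrable lborel (\<lambda>x. indicator (cball 0 (R + 1)) x * B :: real)"
      by (intro integrable_mult_left integrable_real_indicator) (use emeasure_bounded_finite[OF bounded_cball] in auto)
    show "AE x in lborel. norm (s n x) \<le> indicator (cball 0 (R + 1)) x * B" for n
      using s_bound s_supp by (auto simp: indicator_def)
    show "s n \<in> borel_measurable lborel" for n
      unfolding s_def using meas(1) by measurable
  qed (use meas(2) s_lim in auto)
  moreover have "(\<integral>x. s n x \<partial>lborel) = 0" for n
  proof -
    have "(\<integral>x. s n x \<partial>lborel) = ((\<integral>x. f (x + h n *\<^sub>R ?e) \<partial>lborel) - (\<integral>x. f x \<partial>lborel)) /\<^sub>R h n"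
      unfolding s_def using int int' by (simp add: Bochner_Integration.integral_diff)
    then show ?thesis by (simp add: integral_translate[OF meas(1)])
  qed
  ultimately show ?thesis by (simp add: LIMSEQ_const_iff)
qed

text \<open>The Fourier--Laplace transform of \<open>f\<close> at \<open>-z\<close>.\<close>

definition osc_integral :: "complex^'n::finite \<Rightarrow> (real^'n \<Rightarrow> complex) \<Rightarrow> complex" where
  "osc_integral z f = (\<integral>x. cexp z x * f x \<partial>lborel)"

lemma osc_integrable:
  assumes "compact K" "f \<in> test_functions K"
  shows "integrable lborel (\<lambda>x. cexp z x * f x)"
proof -
  have "(\<lambda>x. cexp z x * f x) \<in> test_functions K" by (rule test_functions_mult[OF assms(2) smooth_on_cexp])
  then show ?thesis
    using integrable_continuous_compact_support[OF assms(1)] test_functions_continuous test_functions_outside by blast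
qed

lemma osc_integral_pd:
  assumes "compact K" "f \<in> test_functions K"
  shows "osc_integral z (pd i f) = - \<i> * z $ i * osc_integral z f"
proof -
  have pdf: "pd i f \<in> test_functions K" using test_functions_pds[OF assms, of "[i]"] by simp
  have "0 = (\<integral>x. pd i (\<lambda>x. cexp z x * f x) x \<partial>lborel)"
    by (rule integral_pd_eq_0[OF assms(1) test_functions_mult[OF assms(2) smooth_on_cexp], symmetric])
  also have "\<dots> = (\<integral>x. \<i> * z $ i * (cexp z x * f x) + cexp z x * pd i f x \<partial>lborel)"
  proof (intro Bochner_Integration.integral_cong refl)
    fix x
    have "cexp z differentiable (at x)" using cexp_has_derivative by (auto simp: differentiable_def)
    moreover have "f differentiable (at x)"
      using smooth_on_imp_differentiable[OF test_functions_smooth[OF assms(2)]] by simp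
    ultimately show "pd i (\<lambda>x. cexp z x * f x) x = \<i> * z $ i * (cexp z x * f x) + cexp z x * pd i f x"
      by (simp add: pd_mult pd_cexp)
  qed
  also have "\<dots> = \<i> * z $ i * osc_integral z f + osc_integral z (pd i f)"
    unfolding osc_integral_def using osc_integrable[OF assms] osc_integrable[OF assms(1) pdf]
    by (subst Bochner_Integration.integral_add) (auto intro!: integrable_mult_right)
  finally show ?thesis by (simp add: eq_neg_iff_add_eq_0 add.commute)
qed

lemma osc_integral_pds:
  assumes "compact K" "f \<in> test_functions K"
  shows "osc_integral z (pds is f) = prod_list (map (\<lambda>i. - \<i> * z $ i) is) * osc_integral z f"
proof (induction "is")
  case (Cons i "is")
  then show ?case
    using osc_integral_pd[OF assms(1) test_functions_pds[OF assms, of "is"], of z i] by simp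
qed simp

lemma osc_integral_mpd:
  assumes "compact K" "f \<in> test_functions K"
  shows "osc_integral z (mpd \<alpha> f) = (- \<i>) ^ mi_abs \<alpha> * mi_power z \<alpha> * osc_integral z f"
proof -
  have "prod_list (map (\<lambda>i. - \<i> * z $ i) (mi_list \<alpha>)) = (\<Prod>i\<in>UNIV. (- \<i>) ^ \<alpha> i * (z $ i) ^ \<alpha> i)"
    by (simp only: prod_list_mi_list power_mult_distrib)
  also have "\<dots> = (- \<i>) ^ mi_abs \<alpha> * mi_power z \<alpha>"
    by (simp add: prod.distrib mi_power_def mi_abs_def power_sum)
  finally show ?thesis unfolding mpd_eq_pds osc_integral_pds[OF assms] by simp
qed

text \<open>Integration by parts \<open>j\<close> times in direction \<open>i\<close>.\<close>

lemma osc_integral_bound: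
  assumes K: "compact K" "K \<subseteq> cball 0 r" and f: "f \<in> test_functions K"
    and B: "\<And>x. x \<in> K \<Longrightarrow> norm (pds (replicate j i) f x) \<le> B"
  shows "norm (z $ i) ^ j * norm (osc_integral z f) \<le> measure lborel K * (exp (r * norm (Im_vec z)) * B)"
proof -
  have "norm (z $ i) ^ j * norm (osc_integral z f) = norm (osc_integral z (pds (replicate j i) f))"
    unfolding osc_integral_pds[OF K(1) f] by (simp add: norm_mult map_replicate_const prod_list_replicate norm_power)
  also have "\<dots> \<le> measure lborel K * (exp (r * norm (Im_vec z)) * B)"
    unfolding osc_integral_def
  proof (rule norm_integral_le_measure[OF K(1)])
    show "norm (cexp z x * pds (replicate j i) f x) \<le> exp (r * norm (Im_vec z)) * B" if "x \<in> K" for x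
      using that unfolding norm_mult using K(2) B by (intro mult_mono norm_cexp_le) auto
    show "cexp z x * pds (replicate j i) f x = 0" if "x \<notin> K" for x
      using test_functions_outside[OF test_functions_pds[OF K(1) f] that] by (simp only: mult_zero_right)
  qed
  finally show ?thesis .
qed

section \<open>Oscillatory functionals\<close>

definition osc_net :: "real set \<Rightarrow> (real \<Rightarrow> complex^'n::finite) \<Rightarrow> real \<Rightarrow> (real^'n \<Rightarrow> complex) \<Rightarrow> complex" where
  "osc_net A z \<epsilon> f = (if \<epsilon> \<in> A then osc_integral (z \<epsilon>) f else 0)"

lemma osc_integral_sum:
  assumes "compact K" "\<And>a. a \<in> I \<Longrightarrow> f a \<in> test_functions K"
  shows "osc_integral z (\<lambda>x. \<Sum>a\<in>I. c a * f a x) = (\<Sum>a\<in>I. c a * osc_integral z (f a))"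
proof -
  have "osc_integral z (\<lambda>x. \<Sum>a\<in>I. c a * f a x) = (\<integral>x. (\<Sum>a\<in>I. c a * (cexp z x * f a x)) \<partial>lborel)"
    unfolding osc_integral_def by (simp add: sum_distrib_left algebra_simps)
  also have "\<dots> = (\<Sum>a\<in>I. (\<integral>x. c a * (cexp z x * f a x) \<partial>lborel))"
    by (rule Bochner_Integration.integral_sum)
       (intro integrable_mult_right osc_integrable[OF assms(1)] assms(2))
  finally show ?thesis by (simp add: osc_integral_def)
qed

lemma norm_pds_le_sup_deriv:
  assumes "compact K" "f \<in> test_functions K" "x \<in> K" "length is \<le> j"
  shows "norm (pds is f x) \<le> sup_deriv K j f"
  using sup_deriv_ge[OF assms(1) test_functions_smooth[OF assms(2)] subset_UNIV assms(3), of "count_list is" j]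
    pds_eq_mpd[OF open_UNIV test_functions_smooth[OF assms(2)], of x "is"] assms(4)
  by (simp flip: length_eq_mi_abs)

lemma compact_subset_cball:
  assumes "compact (K :: (real^'n) set)"
  obtains r :: nat where "K \<subseteq> cball 0 (real r)"
proof -
  obtain R where "\<And>x. x \<in> K \<Longrightarrow> norm x \<le> R"
    using compact_imp_bounded[OF assms] by (auto simp: bounded_iff)
  moreover obtain r :: nat where "R \<le> real r" using real_arch_simple by blast
  ultimately show thesis by (intro that[of r]) force
qed

lemma distribution_osc_net: "distribution UNIV (osc_net A z \<epsilon>)"
proof (cases "\<epsilon> \<in> A")
  case True
  show ?thesis unfolding distribution_def
  proof (intro allI impI conjI ballI)
    fix K :: "(real^'a) set" assume "compact K \<and> K \<subseteq> UNIV"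
    then have K: "compact K" by simp
    show "osc_net A z \<epsilon> (\<lambda>x. f x + g x) = osc_net A z \<epsilon> f + osc_net A z \<epsilon> g"
      if "f \<in> test_functions K" "g \<in> test_functions K" for f g
      using osc_integral_sum[OF K, of UNIV "\<lambda>b. if b then f else g" "z \<epsilon>" "\<lambda>_. 1"] that True
      by (simp add: UNIV_bool osc_net_def add.commute)
    show "osc_net A z \<epsilon> (\<lambda>x. a * f x) = a * osc_net A z \<epsilon> f" if "f \<in> test_functions K" for f a
      using osc_integral_sum[OF K, of "{()}" "\<lambda>_. f" "z \<epsilon>" "\<lambda>_. a"] that True by (simp add: osc_net_def)
    obtain r :: nat where r: "K \<subseteq> cball 0 (real r)" using compact_subset_cball[OF K] by blast
    have "norm (osc_net A z \<epsilon> f) \<le> measure lborel K * exp (real r * norm (Im_vec (z \<epsilon>))) * sup_deriv K 0 f"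
      if "f \<in> test_functions K" for f
      using osc_integral_bound[OF K r that, of 0 undefined "sup_deriv K 0 f" "z \<epsilon>"]
        norm_pds_le_sup_deriv[OF K that, of _ "[]" 0] True
      by (simp add: osc_net_def mult.assoc)
    then show "\<exists>j C. \<forall>f\<in>test_functions K. norm (osc_net A z \<epsilon> f) \<le> C * sup_deriv K j f" by blast
  qed
next
  case False
  then show ?thesis unfolding distribution_def by (auto simp: osc_net_def intro!: exI[of _ 0])
qed

lemma norm_le_card_mult_component:
  fixes z :: "complex^'n::finite"
  obtains i where "norm z \<le> real CARD('n) * norm (z $ i)"
proof (rule ccontr)
  assume "\<not> thesis"
  then have "\<And>i. norm (z $ i) < norm z / real CARD('n)"
    using that by (force simp: field_simps not_le)
  then have "(\<Sum>i\<in>UNIV. norm (z $ i)) < (\<Sum>i\<in>(UNIV::'n set). norm z / real CARD('n))"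
    by (intro sum_strict_mono) auto
  moreover have "norm z \<le> (\<Sum>i\<in>UNIV. norm (z $ i))"
    unfolding norm_vec_def by (rule L2_set_le_sum) simp
  ultimately show False by simp
qed

lemma eventually_at_right_0_obtain:
  assumes "eventually P (at_right (0::real))"
  obtains \<eta> where "\<eta> \<in> {0<..1}" "\<And>\<epsilon>. \<epsilon> \<in> {0<..\<eta>} \<Longrightarrow> P \<epsilon>"
proof -
  obtain b where b: "b > 0" "\<And>y. 0 < y \<Longrightarrow> y < b \<Longrightarrow> P y"
    using assms by (auto simp: eventually_at_right[of 0 1])
  then show thesis by (intro that[of "min (b / 2) 1"]) auto
qed

text \<open>On functions supported in the ball of radius \<open>r\<close> the exponential is bounded by the \<open>r\<close>-th power of
  \<open>e\<^bsup>|Im z|\<^esup>\<close>, hence by \<open>\<epsilon>\<^bsup>-Mr\<^esup>(1 + |z|)\<^sup>r\<close>. If \<open>|z| > 1\<close> then \<open>r\<close> integrations by parts in the direction of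
  a large component of \<open>z\<close> compensate the factor \<open>|z|\<^sup>r\<close>. Under the hypothesis
  \<open>|Re z|\<close> may grow arbitrarily fast.\<close>

lemma moderate_distributions_osc_net:
  fixes z :: "real \<Rightarrow> complex^'n::finite" and M :: nat
  assumes "\<forall>\<^sub>F \<epsilon> in at_right 0. \<epsilon> \<in> A \<longrightarrow> exp (norm (Im_vec (z \<epsilon>))) \<le> \<epsilon> powr (- real M) * (1 + norm (z \<epsilon>))"
  shows "moderate_distributions UNIV (osc_net A z)"
  unfolding moderate_distributions_def
proof (intro conjI ballI allI impI)
  fix K :: "(real^'n) set" assume "compact K \<and> K \<subseteq> UNIV"
  then have K: "compact K" by simp
  obtain r :: nat where r: "K \<subseteq> cball 0 (real r)" using compact_subset_cball[OF K] by blast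
  obtain \<eta> where \<eta>: "\<eta> \<in> {0<..1}" "\<And>\<epsilon>. \<epsilon> \<in> {0<..\<eta>} \<Longrightarrow> \<epsilon> \<in> A \<Longrightarrow>
      exp (norm (Im_vec (z \<epsilon>))) \<le> \<epsilon> powr (- real M) * (1 + norm (z \<epsilon>))"
    using eventually_at_right_0_obtain[OF assms] by metis
  define n where "n = real CARD('n)"
  have n: "n \<ge> 1" unfolding n_def using zero_less_card_finite[where 'a = 'n] by simp
  define \<mu> where "\<mu> = measure lborel K"
  have \<mu>: "\<mu> \<ge> 0" by (simp add: \<mu>_def)
  have est: "norm (osc_net A z \<epsilon> f) \<le> (\<mu> + 1) * (2 * n) ^ r * \<epsilon> powr (- real (M * r)) * sup_deriv K r f"
    if f: "f \<in> test_functions K" and e: "\<epsilon> \<in> {0<..\<eta>}" for f \<epsilon>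
  proof (cases "\<epsilon> \<in> A")
    case True
    define S where "S = sup_deriv K r f"
    define X where "X = norm (osc_integral (z \<epsilon>) f)"
    define E where "E = exp (real r * norm (Im_vec (z \<epsilon>)))"
    define P where "P = \<epsilon> powr (- real (M * r))"
    have S: "S \<ge> 0"
      unfolding S_def by (rule sup_deriv_nonneg[OF K test_functions_smooth[OF f] subset_UNIV])
    have P: "P \<ge> 0" by (simp add: P_def)
    have E: "E \<le> P * (1 + norm (z \<epsilon>)) ^ r"
    proof -
      have "E = exp (norm (Im_vec (z \<epsilon>))) ^ r" by (simp add: E_def exp_of_nat_mult)
      also have "\<dots> \<le> (\<epsilon> powr (- real M) * (1 + norm (z \<epsilon>))) ^ r"
        by (intro power_mono \<eta>(2) e True) simp
      also have "\<dots> = P * (1 + norm (z \<epsilon>)) ^ r"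
        using e by (simp add: power_mult_distrib P_def powr_power mult.commute[of "real r"])
      finally show ?thesis .
    qed
    have bound: "norm (z \<epsilon> $ i) ^ k * X \<le> \<mu> * (E * S)" if "k \<le> r" for i k
      unfolding X_def \<mu>_def E_def
      by (rule osc_integral_bound[OF K r f])
         (unfold S_def, rule norm_pds_le_sup_deriv[OF K f], assumption, simp add: that)
    have "X \<le> \<mu> * (P * (2 * n) ^ r * S)"
    proof (cases "norm (z \<epsilon>) \<le> 1")
      case True
      have "X \<le> \<mu> * (E * S)" using bound[of 0] by simp
      also have "\<dots> \<le> \<mu> * (P * (2 * n) ^ r * S)"
      proof (intro mult_left_mono mult_right_mono \<mu> S)
        have "(1 + norm (z \<epsilon>)) ^ r \<le> (2 * n) ^ r" using True n by (intro power_mono) auto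
        then show "E \<le> P * (2 * n) ^ r" using E mult_left_mono[OF _ P] order_trans by blast
      qed
      finally show ?thesis .
    next
      case False
      obtain i where i: "norm (z \<epsilon>) \<le> n * norm (z \<epsilon> $ i)"
        using norm_le_card_mult_component[of "z \<epsilon>"] unfolding n_def by blast
      have pos: "norm (z \<epsilon> $ i) > 0" using i False by (cases "z \<epsilon> $ i = 0") auto
      have "(1 + norm (z \<epsilon>)) ^ r \<le> (2 * n * norm (z \<epsilon> $ i)) ^ r"
        using False i by (intro power_mono) auto
      then have "E \<le> P * (2 * n * norm (z \<epsilon> $ i)) ^ r"
        using E mult_left_mono[OF _ P] order_trans by blast
      then have "\<mu> * (E * S) \<le> \<mu> * (P * (2 * n * norm (z \<epsilon> $ i)) ^ r * S)"
        by (intro mult_left_mono mult_right_mono \<mu> S)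
      then have "norm (z \<epsilon> $ i) ^ r * X \<le> norm (z \<epsilon> $ i) ^ r * (\<mu> * (P * (2 * n) ^ r * S))"
        using bound[of r i] by (simp add: power_mult_distrib algebra_simps)
      then show ?thesis using pos by (simp add: mult_le_cancel_left_pos)
    qed
    also have "\<dots> \<le> (\<mu> + 1) * (P * (2 * n) ^ r * S)"
      using P S n by (intro mult_right_mono mult_nonneg_nonneg) auto
    finally show ?thesis using True by (simp add: osc_net_def X_def P_def S_def algebra_simps)
  next
    case False
    have "0 \<le> (\<mu> + 1) * (2 * n) ^ r * \<epsilon> powr (- real (M * r)) * sup_deriv K r f"
      using \<mu> n sup_deriv_nonneg[OF K test_functions_smooth[OF f] subset_UNIV, of r]
      by (intro mult_nonneg_nonneg) auto
    then show ?thesis using False by (simp add: osc_net_def)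
  qed
  have "(\<mu> + 1) * (2 * n) ^ r > 0" using \<mu> n by (intro mult_pos_pos) auto
  then show "\<exists>j N::nat. \<exists>c>0. \<exists>\<eta>\<in>{0<..1}. \<forall>f\<in>test_functions K. \<forall>\<epsilon>\<in>{0<..\<eta>}.
      norm (osc_net A z \<epsilon> f) \<le> c * \<epsilon> powr (- real N) * sup_deriv K j f"
    using est \<eta>(1) by blast
qed (rule distribution_osc_net)

text \<open>The symbol of \<open>\<^sup>tP(D)\<close> at \<open>-y\<close>, formed with the same representatives of its coefficients as in
  \<open>diff_op\<close>. These agree with \<open>(-1)\<^bsup>|\<alpha>|\<^esup> c\<^sub>\<alpha>\<close> only up to negligible nets, a difference that matters for
  arguments \<open>y\<close> that are not moderate.\<close>

definition transposed_symbol :: "nat \<Rightarrow> 'n::finite coeffs \<Rightarrow> real \<Rightarrow> complex^'n \<Rightarrow> complex" where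
  "transposed_symbol m c \<epsilon> y =
     (\<Sum>\<alpha>\<in>mi_upto m. rep_gnum (transpose_coeffs c \<alpha>) \<epsilon> * ((- 1) ^ mi_abs \<alpha> * mi_power y \<alpha>))"

text \<open>Integration by parts moves \<open>\<^sup>tP(D)\<close> from the test function to the exponential, which is thereby
  multiplied by the value of \<open>P\<^sub>\<epsilon>\<close> at \<open>z\<^sub>\<epsilon>\<close>.\<close>

lemma apply_op_osc_eq_0:
  fixes z :: "real \<Rightarrow> complex^'n::finite"
  assumes t: "moderate_distributions UNIV (osc_net A z)"
    and Q: "negligible_net (\<lambda>\<epsilon>. if \<epsilon> \<in> A then transposed_symbol m c \<epsilon> (z \<epsilon>) else 0)"
    and U: "U \<in> \<G>_c UNIV"
  shows "apply_op UNIV m c (gfunctional_of UNIV (osc_net A z)) U = 0"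
proof -
  let ?tc = "transpose_coeffs c" and ?q = "\<lambda>\<epsilon>. if \<epsilon> \<in> A then transposed_symbol m c \<epsilon> (z \<epsilon>) else 0"
  have G: "U \<in> \<G> UNIV" using U by (simp add: \<G>_c_def)
  define u where "u = crep UNIV U"
  have u: "compact_rep UNIV U u" unfolding u_def by (rule compact_rep_crep[OF open_UNIV U])
  obtain L where L: "u \<in> U" "compact L" "supported_in L u" using u by (rule compact_repE)
  note mu = compact_rep_moderate[OF open_UNIV G u]
  note g = moderate_on_grep[OF open_UNIV G] grep_in[OF open_UNIV G]
  define D where "D v = (\<lambda>\<epsilon> x. \<Sum>\<alpha>\<in>mi_upto m. rep_gnum (?tc \<alpha>) \<epsilon> * ((- \<i>) ^ mi_abs \<alpha> * mpd \<alpha> (v \<epsilon>) x))"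
    for v :: "'n fnet"
  have mD: "moderate_on UNIV (D v)" if "moderate_on UNIV v" for v
    unfolding D_def mpd_eq_pds
    by (intro moderate_on_sum moderate_on_cmult moderate_net_rep_gnum moderate_net_const moderate_on_pds that open_UNIV)
  have "negligible_on UNIV (D (\<lambda>\<epsilon> x. grep U \<epsilon> x - u \<epsilon> x))"
    unfolding D_def mpd_eq_pds
    by (intro negligible_on_sum negligible_on_cmult moderate_net_rep_gnum moderate_net_const negligible_on_pds
        G_negligible_diff[OF open_UNIV G g(2) L(1)] open_UNIV)
  then have "negligible_on UNIV (\<lambda>\<epsilon> x. D (grep U) \<epsilon> x - D u \<epsilon> x)"
  proof (rule negligible_on_cong[OF open_UNIV])
    fix \<epsilon> :: real and x assume "\<epsilon> \<in> {0<..1}"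
    then have eq: "mpd \<alpha> (\<lambda>x. grep U \<epsilon> x - u \<epsilon> x) x = mpd \<alpha> (grep U \<epsilon>) x - mpd \<alpha> (u \<epsilon>) x" for \<alpha>
      unfolding mpd_eq_pds using moderate_on_smooth mu g(1) by (intro pds_diff[OF open_UNIV]) auto
    show "D (\<lambda>\<epsilon> x. grep U \<epsilon> x - u \<epsilon> x) \<epsilon> x = D (grep U) \<epsilon> x - D u \<epsilon> x"
      unfolding D_def eq right_diff_distrib sum_subtractf by (rule refl)
  qed
  then have "D u \<in> diff_op UNIV m ?tc U"
    unfolding diff_op_def D_def[symmetric] gclass_iff using mD[OF mu] mD[OF g(1)] by (simp add: D_def)
  moreover have "supported_in L (D u)"
    unfolding supported_in_def D_def mpd_eq_pds
    using pds_outside_support[OF compact_imp_closed[OF L(2)]] L(3) by (auto simp: supported_in_def)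
  ultimately have "compact_rep UNIV (diff_op UNIV m ?tc U) (D u)"
    by (intro compact_repI[OF _ L(2)]) auto
  moreover have "diff_op UNIV m ?tc U \<in> \<G> UNIV"
    unfolding diff_op_def using mD[OF g(1)] by (intro gclass_in_G) (simp add: D_def)
  ultimately have T: "gfunctional_of UNIV (osc_net A z) (diff_op UNIV m ?tc U) = abs_gnum (\<lambda>\<epsilon>. osc_net A z \<epsilon> (D u \<epsilon>))"
    and mT: "moderate_net (\<lambda>\<epsilon>. osc_net A z \<epsilon> (D u \<epsilon>))"
    using gfunctional_of_eq[OF open_UNIV t] by blast+
  have "negligible_net (\<lambda>\<epsilon>. osc_net A z \<epsilon> (u \<epsilon>) * ?q \<epsilon>)"
    by (rule negligible_net_mult[OF gfunctional_of_eq(2)[OF open_UNIV t G u] Q])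
  then have "negligible_net (\<lambda>\<epsilon>. osc_net A z \<epsilon> (D u \<epsilon>))"
  proof (rule negligible_net_cong)
    fix \<epsilon> :: real assume e: "\<epsilon> \<in> {0<..1}"
    have f: "u \<epsilon> \<in> test_functions L" by (rule test_functionI[OF mu L(3) e])
    have ii: "(- \<i>) ^ k * (- \<i>) ^ k = (- 1) ^ k" for k by (simp flip: power_mult_distrib)
    have "osc_integral (z \<epsilon>) (D u \<epsilon>) =
        (\<Sum>\<alpha>\<in>mi_upto m. (rep_gnum (?tc \<alpha>) \<epsilon> * (- \<i>) ^ mi_abs \<alpha>) * osc_integral (z \<epsilon>) (mpd \<alpha> (u \<epsilon>)))"
      unfolding D_def using osc_integral_sum[OF L(2), of "mi_upto m" "\<lambda>\<alpha>. mpd \<alpha> (u \<epsilon>)" "z \<epsilon>"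
          "\<lambda>\<alpha>. rep_gnum (?tc \<alpha>) \<epsilon> * (- \<i>) ^ mi_abs \<alpha>"] test_functions_pds[OF L(2) f]
      by (simp add: mpd_eq_pds mult.assoc)
    also have "\<dots> = (\<Sum>\<alpha>\<in>mi_upto m. rep_gnum (?tc \<alpha>) \<epsilon> * (((- \<i>) ^ mi_abs \<alpha> * (- \<i>) ^ mi_abs \<alpha>) *
        mi_power (z \<epsilon>) \<alpha>)) * osc_integral (z \<epsilon>) (u \<epsilon>)"
      by (simp add: osc_integral_mpd[OF L(2) f] sum_distrib_right mult.assoc)
    finally show "norm (osc_net A z \<epsilon> (D u \<epsilon>)) \<le> norm (osc_net A z \<epsilon> (u \<epsilon>) * ?q \<epsilon>)"
      by (simp add: osc_net_def transposed_symbol_def ii mult.commute)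
  qed
  then have "abs_gnum (\<lambda>\<epsilon>. osc_net A z \<epsilon> (D u \<epsilon>)) = abs_gnum (\<lambda>\<epsilon>. 0)"
    by (intro abs_gnum_eqI mT moderate_net_const) simp
  then show ?thesis by (simp add: apply_op_def T zero_gnum.abs_eq)
qed

section \<open>Embedded generalized functions\<close>

lemma norm_integral_bigo:
  assumes "compact K" "supported_in K g" "bigo_on K p g"
  shows "(\<lambda>\<epsilon>. norm (\<integral>x. g \<epsilon> x \<partial>lborel)) \<in> O[at_right 0](\<lambda>\<epsilon>. \<epsilon> powr p)"
proof -
  obtain C where C: "\<forall>\<^sub>F \<epsilon> in at_right 0. \<forall>x\<in>K. norm (g \<epsilon> x) \<le> C * \<epsilon> powr p"
    using assms(3) by (auto simp: bigo_on_def)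
  show ?thesis
  proof (rule bigoI[where c = "measure lborel K * C"])
    show "\<forall>\<^sub>F \<epsilon> in at_right 0. norm (norm (\<integral>x. g \<epsilon> x \<partial>lborel)) \<le> measure lborel K * C * norm (\<epsilon> powr p)"
      using C eventually_unit
    proof eventually_elim
      case (elim \<epsilon>)
      then show ?case
        using norm_integral_le_measure[OF assms(1), of "g \<epsilon>" "C * \<epsilon> powr p"] assms(2)
        by (auto simp: supported_in_def mult.assoc)
    qed
  qed
qed

lemma moderate_net_integral:
  assumes "compact K" "supported_in K g" "moderate_on UNIV g"
  shows "moderate_net (\<lambda>\<epsilon>. \<integral>x. g \<epsilon> x \<partial>lborel)"
proof -
  obtain N :: nat where "bigo_on K (- real N) (\<lambda>\<epsilon>. pds [] (g \<epsilon>))"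
    using moderate_onD[OF open_UNIV assms(3,1) subset_UNIV, of 0] by auto
  then show ?thesis
    unfolding moderate_net_def using norm_integral_bigo[OF assms(1,2), of "- real N"] by auto
qed

lemma negligible_net_integral:
  assumes "compact K" "supported_in K g" "negligible_on UNIV g"
  shows "negligible_net (\<lambda>\<epsilon>. \<integral>x. g \<epsilon> x \<partial>lborel)"
  unfolding negligible_net_def
  using norm_integral_bigo[OF assms(1,2)] negligible_onD[OF open_UNIV assms(3,1) subset_UNIV, of _ "[]"] by auto

lemma integrable_moderate:
  assumes "compact K" "supported_in K g" "moderate_on UNIV g" "\<epsilon> \<in> {0<..1}"
  shows "integrable lborel (g \<epsilon>)"
  using integrable_continuous_compact_support[OF assms(1), of "g \<epsilon>"] assms
    continuous_on_subset[OF smooth_on_imp_continuous_on[OF moderate_on_smooth[OF assms(3,4)]]]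
  by (auto simp: supported_in_def)

text \<open>The value of an embedded generalized function does not depend on the representatives that the
  definition chooses.\<close>

lemma embed_eq:
  assumes V: "open V" and W: "W \<in> \<G> V" "w \<in> W" and U: "U \<in> \<G>_c V" "compact_rep V U v"
  shows "embed V W U = abs_gnum (\<lambda>\<epsilon>. \<integral>x. w \<epsilon> x * v \<epsilon> x \<partial>lborel)"
    "moderate_net (\<lambda>\<epsilon>. \<integral>x. w \<epsilon> x * v \<epsilon> x \<partial>lborel)"
proof -
  have G: "U \<in> \<G> V" using U(1) by (simp add: \<G>_c_def)
  define v' where "v' = crep V U"
  have v': "compact_rep V U v'" unfolding v'_def by (rule compact_rep_crep[OF V U(1)])
  obtain L1 where L1: "v \<in> U" "compact L1" "L1 \<subseteq> V" "supported_in L1 v" using U(2) by (rule compact_repE)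
  obtain L2 where L2: "v' \<in> U" "compact L2" "L2 \<subseteq> V" "supported_in L2 v'" using v' by (rule compact_repE)
  define L where "L = L1 \<union> L2"
  have L: "compact L" "L \<subseteq> V" "supported_in L v" "supported_in L v'"
    using L1 L2 by (auto simp: L_def elim: supported_in_mono)
  note g = moderate_on_grep[OF V W(1)] grep_in[OF V W(1)]
  note mw = G_mem(1)[OF V W] and mv = G_mem(1)[OF V G L1(1)] and mv' = G_mem(1)[OF V G L2(1)]
  have s: "supported_in L (\<lambda>\<epsilon> x. y \<epsilon> x * v \<epsilon> x)" "supported_in L (\<lambda>\<epsilon> x. y \<epsilon> x * v' \<epsilon> x)" for y :: "'a fnet"
    using L(3,4) by (auto simp: supported_in_def)
  have m: "moderate_on UNIV (\<lambda>\<epsilon> x. w \<epsilon> x * v \<epsilon> x)" "moderate_on UNIV (\<lambda>\<epsilon> x. grep W \<epsilon> x * v' \<epsilon> x)"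
    by (rule moderate_on_extend[OF V _ L(1,2)]; intro moderate_on_mult V mw mv mv' g s)+
  note mi = moderate_net_integral[OF L(1) s(1) m(1)] moderate_net_integral[OF L(1) s(2) m(2)]
  show "moderate_net (\<lambda>\<epsilon>. \<integral>x. w \<epsilon> x * v \<epsilon> x \<partial>lborel)" by (rule mi)
  have "negligible_on V (\<lambda>\<epsilon> x. grep W \<epsilon> x * (v' \<epsilon> x - v \<epsilon> x) + v \<epsilon> x * (grep W \<epsilon> x - w \<epsilon> x))"
    by (intro negligible_on_add negligible_on_mult V g mv G_negligible_diff[OF V G L2(1) L1(1)]
        G_negligible_diff[OF V W(1) g(2) W(2)])
  then have "negligible_on V (\<lambda>\<epsilon> x. grep W \<epsilon> x * v' \<epsilon> x - w \<epsilon> x * v \<epsilon> x)"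
    by (simp add: algebra_simps)
  moreover have s': "supported_in L (\<lambda>\<epsilon> x. grep W \<epsilon> x * v' \<epsilon> x - w \<epsilon> x * v \<epsilon> x)"
    using L(3,4) by (auto simp: supported_in_def)
  ultimately have "negligible_on UNIV (\<lambda>\<epsilon> x. grep W \<epsilon> x * v' \<epsilon> x - w \<epsilon> x * v \<epsilon> x)"
    by (intro negligible_on_extend[OF V _ L(1,2)])
  from negligible_net_integral[OF L(1) s' this]
  have "negligible_net (\<lambda>\<epsilon>. (\<integral>x. grep W \<epsilon> x * v' \<epsilon> x \<partial>lborel) - (\<integral>x. w \<epsilon> x * v \<epsilon> x \<partial>lborel))"
    by (rule negligible_net_cong)
       (simp add: Bochner_Integration.integral_diff integrable_moderate[OF L(1) s(1) m(1)]
          integrable_moderate[OF L(1) s(2) m(2)])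
  then have eq: "abs_gnum (\<lambda>\<epsilon>. \<integral>x. grep W \<epsilon> x * v' \<epsilon> x \<partial>lborel) = abs_gnum (\<lambda>\<epsilon>. \<integral>x. w \<epsilon> x * v \<epsilon> x \<partial>lborel)"
    by (intro abs_gnum_eqI mi)
  have "embed V W U = abs_gnum (\<lambda>\<epsilon>. \<integral>x. grep W \<epsilon> x * v' \<epsilon> x \<partial>lborel)"
    unfolding embed_def v'_def[symmetric]
  proof (rule abs_gnum_cong[OF mi(2)])
    fix \<epsilon> :: real assume e: "\<epsilon> \<in> {0<..1}"
    have "v' \<epsilon> x = 0" if "x \<notin> V" for x
      using L(2,4) e that unfolding supported_in_def by blast
    then have "indicator V x *\<^sub>R (grep W \<epsilon> x * v' \<epsilon> x) = grep W \<epsilon> x * v' \<epsilon> x" for x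
      by (cases "x \<in> V") auto
    then show "set_lebesgue_integral lborel V (\<lambda>x. grep W \<epsilon> x * v' \<epsilon> x) = (\<integral>x. grep W \<epsilon> x * v' \<epsilon> x \<partial>lborel)"
      by (simp add: set_lebesgue_integral_def)
  qed
  then show "embed V W U = abs_gnum (\<lambda>\<epsilon>. \<integral>x. w \<epsilon> x * v \<epsilon> x \<partial>lborel)" using eq by simp
qed

section \<open>Testing against localized oscillations\<close>

lemma gclass_zero_G: "open \<Omega> \<Longrightarrow> gclass \<Omega> (\<lambda>\<epsilon> x. 0) \<in> \<G> \<Omega>"
  by (intro gclass_in_G moderate_on_const moderate_net_const)

lemma gclass_zero_G_inf: "open \<Omega> \<Longrightarrow> gclass \<Omega> (\<lambda>\<epsilon> x. 0) \<in> \<G>_inf \<Omega>"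
proof -
  assume op: "open \<Omega>"
  have m: "moderate_on \<Omega> (\<lambda>\<epsilon> x. 0)" by (intro moderate_on_const op moderate_net_const)
  have "regular_on \<Omega> (\<lambda>\<epsilon> x. 0)"
    unfolding regular_on_def
  proof (intro conjI ballI allI impI exI)
    fix K \<alpha> assume K: "compact K \<and> K \<subseteq> \<Omega>"
    show "(\<lambda>\<epsilon>. sup_abs K (mpd \<alpha> (\<lambda>x. 0))) \<in> O[at_right 0](\<lambda>\<epsilon>. \<epsilon> powr (- real 0))"
      using K by (subst sup_abs_mpd_bigo_iff[OF op]) (auto simp: smooth_on_const mpd_eq_pds pds_zero bigo_on_zero)
  qed (rule smooth_on_const)
  then show ?thesis
    unfolding \<G>_inf_def using gclass_in_G[OF m] gclass_self[OF op m] by blast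
qed

text \<open>As \<open>P(D)T = 0\<close> is represented by \<open>0\<close> everywhere, hypoellipticity makes the singular
  support of \<open>T\<close> empty; the conclusion is what this says at the point \<open>0\<close>.\<close>

lemma hypoelliptic_osc:
  fixes z :: "real \<Rightarrow> complex^'n::finite"
  assumes hyp: "hypoelliptic \<A> m c"
    and \<A>: "gclass UNIV (\<lambda>\<epsilon> x. 0) \<in> \<A> UNIV"
    and t: "moderate_distributions UNIV (osc_net A z)"
    and Q: "negligible_net (\<lambda>\<epsilon>. if \<epsilon> \<in> A then transposed_symbol m c \<epsilon> (z \<epsilon>) else 0)"
  obtains V W where "open V" "0 \<in> V" "W \<in> \<A> V"
    "\<And>U. U \<in> \<G>_c V \<Longrightarrow> gfunctional_of UNIV (osc_net A z) (gclass UNIV (crep V U)) = embed V W U"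
proof -
  let ?T = "gfunctional_of UNIV (osc_net A z)" and ?Z = "gclass UNIV (\<lambda>\<epsilon> x. 0) :: 'n gfun"
  have Z: "?Z \<in> \<G> UNIV" "(\<lambda>\<epsilon> x. 0) \<in> ?Z"
    by (auto intro!: gclass_zero_G gclass_self moderate_on_const moderate_net_const)
  have "restrict_functional UNIV UNIV (apply_op UNIV m c ?T) U = embed UNIV ?Z U" if U: "U \<in> \<G>_c UNIV" for U
  proof -
    have G: "U \<in> \<G> UNIV" using U by (simp add: \<G>_c_def)
    have r: "compact_rep UNIV U (crep UNIV U)" by (rule compact_rep_crep[OF open_UNIV U])
    then have "crep UNIV U \<in> U" by (simp add: compact_rep_def)
    then have "gclass UNIV (crep UNIV U) = U" using G_mem(2)[OF open_UNIV G] by simp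
    then have "restrict_functional UNIV UNIV (apply_op UNIV m c ?T) U = 0"
      unfolding restrict_functional_def using apply_op_osc_eq_0[OF t Q U] by simp
    moreover have "embed UNIV ?Z U = 0"
      using embed_eq(1)[OF open_UNIV Z U r] by (simp add: zero_gnum.abs_eq)
    ultimately show ?thesis by simp
  qed
  then have "sing_supp \<A> UNIV (apply_op UNIV m c ?T) = {}"
    unfolding sing_supp_def using \<A> by blast
  then have "sing_supp \<A> UNIV ?T = {}"
    using hyp basic_gfunctional_of[OF open_UNIV t] unfolding hypoelliptic_def by (metis open_UNIV)
  then have "0 \<in> {x. \<exists>V. open V \<and> x \<in> V \<and> V \<subseteq> UNIV \<and>
     (\<exists>W\<in>\<A> V. \<forall>U\<in>\<G>_c V. restrict_functional UNIV V ?T U = embed V W U)}"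
    unfolding sing_supp_def by blast
  then show thesis unfolding restrict_functional_def using that by blast
qed

text \<open>The conditions under which the exponentials \<open>e\<^bsup>ixz\<^esup>\<close>, \<open>\<epsilon> \<in> A\<close>, form a moderate net.\<close>

definition moderate_exponents :: "real set \<Rightarrow> (real \<Rightarrow> complex^'n::finite) \<Rightarrow> nat \<Rightarrow> bool" where
  "moderate_exponents A z M \<longleftrightarrow> (\<forall>\<^sub>F \<epsilon> in at_right 0. \<epsilon> \<in> A \<longrightarrow>
     norm (z \<epsilon>) \<le> \<epsilon> powr (- real M) \<and> exp (norm (Im_vec (z \<epsilon>))) \<le> \<epsilon> powr (- real M))"

lemma moderate_on_cexp_net:
  fixes z :: "real \<Rightarrow> complex^'n::finite" and M :: nat
  assumes "moderate_exponents A z M"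
  shows "moderate_on UNIV (\<lambda>\<epsilon> x. if \<epsilon> \<in> A then cexp (z \<epsilon>) x else 0)"
proof (rule moderate_onI[OF open_UNIV])
  show "smooth_on UNIV (\<lambda>x. if \<epsilon> \<in> A then cexp (z \<epsilon>) x else 0)" for \<epsilon>
    using smooth_on_cexp[of UNIV "z \<epsilon>"] by (cases "\<epsilon> \<in> A") (auto simp: smooth_on_const)
  fix K :: "(real^'n) set" and "is" :: "'n list" assume "compact K"
  then obtain r :: nat where r: "K \<subseteq> cball 0 (real r)" by (rule compact_subset_cball)
  have "\<forall>\<^sub>F \<epsilon> in at_right 0. \<forall>x\<in>K. norm (pds is (\<lambda>x. if \<epsilon> \<in> A then cexp (z \<epsilon>) x else 0) x)
      \<le> 1 * \<epsilon> powr (- real (M * (length is + r)))"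
    using assms[unfolded moderate_exponents_def] eventually_unit
  proof eventually_elim
    case (elim \<epsilon>)
    show ?case
    proof (cases "\<epsilon> \<in> A")
      case True
      have "norm (prod_list (map (\<lambda>i. \<i> * z \<epsilon> $ i) is)) \<le> (\<epsilon> powr (- real M)) ^ length is"
      proof (induction "is")
        case (Cons i "is")
        have "norm (z \<epsilon> $ i) \<le> \<epsilon> powr (- real M)"
          using elim(1) True Finite_Cartesian_Product.norm_nth_le[of "z \<epsilon>" i] by linarith
        then show ?case using Cons by (simp add: norm_mult mult_mono)
      qed simp
      moreover have "norm (cexp (z \<epsilon>) x) \<le> (\<epsilon> powr (- real M)) ^ r" if "x \<in> K" for x
      proof -
        have "norm (cexp (z \<epsilon>) x) \<le> exp (real r * norm (Im_vec (z \<epsilon>)))"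
          using r that by (intro norm_cexp_le) auto
        also have "\<dots> = exp (norm (Im_vec (z \<epsilon>))) ^ r" by (simp add: exp_of_nat_mult)
        also have "\<dots> \<le> (\<epsilon> powr (- real M)) ^ r" using elim(1) True by (intro power_mono) auto
        finally show ?thesis .
      qed
      ultimately have "norm (prod_list (map (\<lambda>i. \<i> * z \<epsilon> $ i) is)) * norm (cexp (z \<epsilon>) x)
          \<le> (\<epsilon> powr (- real M)) ^ length is * (\<epsilon> powr (- real M)) ^ r" if "x \<in> K" for x
        using that by (intro mult_mono) auto
      moreover have "(\<epsilon> powr (- real M)) ^ (length is + r) = \<epsilon> powr (- real (M * (length is + r)))"
        using elim(2) by (simp add: powr_power algebra_simps)
      ultimately show ?thesis using True by (simp add: pds_cexp norm_mult power_add)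
    next
      case False
      then show ?thesis by (simp add: pds_zero)
    qed
  qed
  then show "\<exists>N::nat. bigo_on K (- real N) (\<lambda>\<epsilon>. pds is (\<lambda>x. if \<epsilon> \<in> A then cexp (z \<epsilon>) x else 0))"
    unfolding bigo_on_def by blast
qed

lemma Im_vec_minus: "Im_vec (- z) = - Im_vec z"
  by (simp add: Im_vec_def vec_eq_iff)

lemma bump_function:
  fixes V :: "(real^'n::finite) set"
  assumes "open V" "0 \<in> V"
  obtains \<phi> :: "real^'n \<Rightarrow> complex" and K where "compact K" "K \<subseteq> V" "K \<subseteq> cball 0 1" "\<phi> \<in> test_functions K"
    "(\<integral>x. \<phi> x \<partial>lborel) \<noteq> 0"
proof -
  have "open (V \<inter> ball 0 1)" "{0} \<subseteq> V \<inter> ball 0 1" using assms by auto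
  then obtain \<phi> :: "real^'n \<Rightarrow> real" and K N where \<phi>: "smooth_on UNIV (\<lambda>x. complex_of_real (\<phi> x))"
    "compact K" "K \<subseteq> V \<inter> ball 0 1" "\<And>x. x \<notin> K \<Longrightarrow> \<phi> x = 0" "open N" "{0} \<subseteq> N"
    "\<And>x. x \<in> N \<Longrightarrow> \<phi> x = 1" "\<And>x. 0 \<le> \<phi> x"
    by (rule smooth_cutoff[of "{0}", OF finite_imp_compact, OF finite.insertI[OF finite.emptyI]]) auto
  obtain s where s: "s > 0" "ball 0 s \<subseteq> N" using \<phi>(5,6) open_contains_ball by blast
  have test: "(\<lambda>x. complex_of_real (\<phi> x)) \<in> test_functions K"
    using \<phi>(1,4) by (simp add: test_functions_def)
  have int: "integrable lborel (\<lambda>x. complex_of_real (\<phi> x))"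
    by (rule integrable_continuous_compact_support[OF \<phi>(2) test_functions_continuous[OF test]]) (simp add: \<phi>(4))
  then have int': "integrable lborel \<phi>" by (simp add: complex_of_real_integrable_eq)
  have "measure lborel (ball (0::real^'n) s) = (\<integral>x. indicator (ball (0::real^'n) s) x \<partial>lborel)" by simp
  also have "\<dots> \<le> (\<integral>x. \<phi> x \<partial>lborel)"
  proof (rule integral_mono[OF _ int'])
    show "integrable lborel (indicator (ball (0::real^'n) s) :: _ \<Rightarrow> real)"
      by (rule integrable_real_indicator) (use emeasure_bounded_finite[OF bounded_ball] in auto)
  qed (use s(2) \<phi>(7,8) in \<open>auto simp: indicator_def\<close>)
  finally have "(\<integral>x. \<phi> x \<partial>lborel) > 0"
    using content_ball_pos[OF s(1), of "0::real^'n"] by linarith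
  then have "(\<integral>x. complex_of_real (\<phi> x) \<partial>lborel) \<noteq> 0" by simp
  moreover have "K \<subseteq> V" "K \<subseteq> cball 0 1" using \<phi>(3) by auto
  ultimately show thesis using that[OF \<phi>(2) _ _ test] by simp
qed

text \<open>Let \<open>\<phi>\<close> be a bump function. Testing the identity of \<open>T\<close> and \<open>W\<close> against \<open>\<phi> e\<^bsup>-ixz\<^esup>\<close>, with \<open>\<epsilon>\<close>
  restricted to \<open>A'\<close>, yields \<open>\<integral>\<phi>\<close> on the side of \<open>T\<close> and the Fourier--Laplace transform of \<open>\<phi>W\<close> on
  the side of \<open>W\<close>, which decays like \<open>|z|\<^bsup>-j\<^esup>\<close> by integration by parts. The support of \<open>\<phi>\<close> lies in the
  unit ball, whence the single factor \<open>e\<^bsup>|Im z|\<^esup>\<close>. That \<open>K\<close> is the same for all \<open>A'\<close> and \<open>j\<close> allows the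
  exponent \<open>p\<close> to be fixed before \<open>A'\<close> is chosen.\<close>

lemma osc_growth:
  fixes z :: "real \<Rightarrow> complex^'n::finite"
  assumes t: "moderate_distributions UNIV (osc_net A z)"
    and V: "open V" "0 \<in> V" and W: "W \<in> \<G> V"
    and T: "\<And>U. U \<in> \<G>_c V \<Longrightarrow> gfunctional_of UNIV (osc_net A z) (gclass UNIV (crep V U)) = embed V W U"
  obtains K where "compact K" "K \<subseteq> V"
    "\<And>w A' M j p. w \<in> W \<Longrightarrow> A' \<subseteq> A \<Longrightarrow>
      moderate_exponents A' z M \<Longrightarrow>
      (\<And>is. length is \<le> j \<Longrightarrow> bigo_on K p (\<lambda>\<epsilon>. pds is (w \<epsilon>))) \<Longrightarrow>
      \<exists>C. \<forall>\<^sub>F \<epsilon> in at_right 0. \<epsilon> \<in> A' \<longrightarrow> norm (z \<epsilon>) ^ j \<le> C * \<epsilon> powr p * exp (norm (Im_vec (z \<epsilon>)))"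
proof -
  obtain \<phi> :: "real^'n \<Rightarrow> complex" and K where K: "compact K" "K \<subseteq> V" "K \<subseteq> cball 0 1"
    and \<phi>: "\<phi> \<in> test_functions K" "(\<integral>x. \<phi> x \<partial>lborel) \<noteq> 0"
    by (rule bump_function[OF V])
  define I where "I = (\<integral>x. \<phi> x \<partial>lborel)"
  show thesis
  proof (rule that[OF K(1,2)])
    fix w A' and M j :: nat and p
    assume w: "w \<in> W" and A': "A' \<subseteq> A"
      and mod: "moderate_exponents A' z M"
      and bw: "\<And>is. length is \<le> j \<Longrightarrow> bigo_on K p (\<lambda>\<epsilon>. pds is (w \<epsilon>))"
    define v where "v = (\<lambda>\<epsilon> x. \<phi> x * (if \<epsilon> \<in> A' then cexp (- z \<epsilon>) x else 0))"
    have mv: "moderate_on UNIV v"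
      unfolding v_def
    proof (intro moderate_on_mult moderate_on_fixed test_functions_smooth[OF \<phi>(1)] open_UNIV)
      show "moderate_on UNIV (\<lambda>\<epsilon> x. if \<epsilon> \<in> A' then cexp (- z \<epsilon>) x else 0)"
        by (rule moderate_on_cexp_net[where M = M]) (use mod in \<open>simp add: moderate_exponents_def Im_vec_minus\<close>)
    qed
    have sv: "supported_in K v" by (simp add: supported_in_def v_def test_functions_outside[OF \<phi>(1)])
    define U where "U = gclass V v"
    have mvV: "moderate_on V v" using mv moderate_on_subset by blast
    have U: "U \<in> \<G>_c V" "compact_rep V U v"
      unfolding U_def by (rule gclass_in_G_c[OF V(1) mvV K(1,2) sv])+
    have G: "U \<in> \<G> V" using U(1) by (simp add: \<G>_c_def)
    have rep: "compact_rep V U (crep V U)" by (rule compact_rep_crep[OF V(1) U(1)])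
    have mc: "moderate_on UNIV (crep V U)" by (rule compact_rep_moderate[OF V(1) G rep])
    have "negligible_on UNIV (\<lambda>\<epsilon> x. crep V U \<epsilon> x - v \<epsilon> x)"
      using V(1) G rep U(2) by (rule compact_rep_negligible_diff)
    then have "v \<in> gclass UNIV (crep V U)" using mc mv by (simp add: gclass_iff)
    then have r: "compact_rep UNIV (gclass UNIV (crep V U)) v" using K(1) sv by (intro compact_repI) auto
    note TE = gfunctional_of_eq[OF open_UNIV t gclass_in_G[OF mc] r]
    note E = embed_eq[OF V(1) W w U]
    have "abs_gnum (\<lambda>\<epsilon>. osc_net A z \<epsilon> (v \<epsilon>)) = abs_gnum (\<lambda>\<epsilon>. \<integral>x. w \<epsilon> x * v \<epsilon> x \<partial>lborel)"
      using T[OF U(1)] TE(1) E(1) by simp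
    then have n: "negligible_net (\<lambda>\<epsilon>. osc_net A z \<epsilon> (v \<epsilon>) - (\<integral>x. w \<epsilon> x * v \<epsilon> x \<partial>lborel))"
      using abs_gnum_eq_iff[OF TE(2) E(2)] by blast
    have osc_v: "osc_net A z \<epsilon> (v \<epsilon>) = I" if "\<epsilon> \<in> A'" for \<epsilon>
    proof -
      have eq: "cexp (z \<epsilon>) x * (\<phi> x * cexp (- z \<epsilon>) x) = \<phi> x" for x
        using cexp_minus[of "z \<epsilon>" x] by (simp add: mult.left_commute)
      show ?thesis using that A' by (simp add: osc_net_def osc_integral_def v_def I_def subsetD eq)
    qed
    define f where "f = (\<lambda>\<epsilon> x. \<phi> x * w \<epsilon> x)"
    have smw: "smooth_on V (w \<epsilon>)" if "\<epsilon> \<in> {0<..1}" for \<epsilon>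
      by (rule moderate_on_smooth[OF G_mem(1)[OF V(1) W w] that])
    have sm\<phi>: "smooth_on V \<phi>" using test_functions_smooth[OF \<phi>(1)] smooth_on_subset by blast
    have ftest: "f \<epsilon> \<in> test_functions K" if "\<epsilon> \<in> {0<..1}" for \<epsilon>
    proof -
      have "smooth_on V (f \<epsilon>)" unfolding f_def by (intro smooth_on_mult V sm\<phi> smw that)
      then have "smooth_on UNIV (f \<epsilon>)"
        by (rule smooth_on_extend[OF V(1) _ K(1,2)]) (simp add: f_def test_functions_outside[OF \<phi>(1)])
      then show ?thesis by (simp add: test_functions_def f_def test_functions_outside[OF \<phi>(1)])
    qed
    have osc_w: "(\<integral>x. w \<epsilon> x * v \<epsilon> x \<partial>lborel) = osc_integral (- z \<epsilon>) (f \<epsilon>)" if "\<epsilon> \<in> A'" for \<epsilon>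
      using that by (simp add: v_def osc_integral_def f_def algebra_simps)
    have bf: "bigo_on K p (\<lambda>\<epsilon>. pds is (f \<epsilon>))" if "length is \<le> j" for "is"
    proof -
      have "bigo_on K (0 + p) (\<lambda>\<epsilon>. pds is (\<lambda>x. \<phi> x * w \<epsilon> x))"
        by (rule bigo_on_pds_mult[OF V(1) K(2) _ _ _ bw that])
           (use sm\<phi> smw bigo_on_pds_fixed[OF test_functions_smooth[OF \<phi>(1)] K(1)] in auto)
      then show ?thesis by (simp add: f_def)
    qed
    have "\<forall>i. \<exists>C. \<forall>\<^sub>F \<epsilon> in at_right 0. \<forall>x\<in>K. norm (pds (replicate j i) (f \<epsilon>) x) \<le> C * \<epsilon> powr p"
      using bf[of "replicate j _"] by (simp add: bigo_on_def)
    from choice[OF this] obtain C where C: "\<forall>i. \<forall>\<^sub>F \<epsilon> in at_right 0. \<forall>x\<in>K. norm (pds (replicate j i) (f \<epsilon>) x) \<le> C i * \<epsilon> powr p" ..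
    have C': "\<forall>\<^sub>F \<epsilon> in at_right 0. \<forall>i\<in>UNIV. \<forall>x\<in>K. norm (pds (replicate j i) (f \<epsilon>) x) \<le> C i * \<epsilon> powr p"
      using C by (intro eventually_ball_finite) auto
    define B where "B = (\<Sum>i\<in>UNIV. \<bar>C i\<bar>)"
    have B: "C i \<le> B" for i
      using member_le_sum[of i UNIV "\<lambda>i. \<bar>C i\<bar>"] unfolding B_def by force
    \<comment> \<open>The difference of both sides is eventually at most half of \<open>|\<integral>\<phi>|\<close>, which leaves at least the
      other half for the transform of \<open>\<phi>W\<close>.\<close>
    have small: "\<forall>\<^sub>F \<epsilon> in at_right 0. norm (osc_net A z \<epsilon> (v \<epsilon>) - (\<integral>x. w \<epsilon> x * v \<epsilon> x \<partial>lborel)) \<le> norm I / 2"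
    proof -
      have "(\<lambda>\<epsilon>. norm (osc_net A z \<epsilon> (v \<epsilon>) - (\<integral>x. w \<epsilon> x * v \<epsilon> x \<partial>lborel))) \<in> O[at_right 0](\<lambda>\<epsilon>. \<epsilon> powr (real 1))"
        using n unfolding negligible_net_def by blast
      then obtain c0 where c0: "c0 > 0" "\<forall>\<^sub>F \<epsilon> in at_right 0.
          norm (osc_net A z \<epsilon> (v \<epsilon>) - (\<integral>x. w \<epsilon> x * v \<epsilon> x \<partial>lborel)) \<le> c0 * norm (\<epsilon> powr 1)"
        by (auto elim!: landau_o.bigE)
      have "\<forall>\<^sub>F \<epsilon> in at_right 0. \<epsilon> \<in> {0<..<norm I / (2 * c0)}"
        by (rule eventually_at_right_real) (use c0 \<phi>(2) in \<open>simp add: I_def\<close>)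
      with c0(2) show ?thesis
        by eventually_elim (use c0(1) in \<open>auto simp: field_simps\<close>)
    qed
    define n where "n = real CARD('n)"
    have n0: "n \<ge> 0" by (simp add: n_def)
    define D where "D = n ^ j * (measure lborel K * B) * (2 / norm I)"
    have I: "norm I > 0" using \<phi>(2) by (simp add: I_def)
    have "\<forall>\<^sub>F \<epsilon> in at_right 0. \<epsilon> \<in> A' \<longrightarrow> norm (z \<epsilon>) ^ j \<le> D * \<epsilon> powr p * exp (norm (Im_vec (z \<epsilon>)))"
      using C' small eventually_unit
    proof eventually_elim
      case (elim \<epsilon>)
      show ?case
      proof
        assume a: "\<epsilon> \<in> A'"
        let ?o = "norm (osc_integral (- z \<epsilon>) (f \<epsilon>))" and ?E = "exp (norm (Im_vec (z \<epsilon>)))"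
        have "norm I \<le> ?o + norm (I - osc_integral (- z \<epsilon>) (f \<epsilon>))"
          using norm_triangle_sub by blast
        then have o: "?o \<ge> norm I / 2" using elim(2) osc_v[OF a] osc_w[OF a] by simp
        obtain i where i: "norm (z \<epsilon>) \<le> n * norm (z \<epsilon> $ i)"
          using norm_le_card_mult_component[of "z \<epsilon>"] unfolding n_def by blast
        have "norm ((- z \<epsilon>) $ i) ^ j * ?o \<le> measure lborel K * (exp (1 * norm (Im_vec (- z \<epsilon>))) * (B * \<epsilon> powr p))"
        proof (rule osc_integral_bound[OF K(1,3) ftest[OF elim(3)]])
          fix x assume "x \<in> K"
          then show "norm (pds (replicate j i) (f \<epsilon>) x) \<le> B * \<epsilon> powr p"
            using order_trans[OF elim(1)[rule_format, of i x] mult_right_mono[OF B[of i] powr_ge_zero]] by simp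
        qed
        then have 1: "norm (z \<epsilon> $ i) ^ j * ?o \<le> (measure lborel K * B) * (\<epsilon> powr p * ?E)"
          by (simp add: Im_vec_minus algebra_simps)
        have "norm (z \<epsilon> $ i) ^ j * (norm I / 2) \<le> norm (z \<epsilon> $ i) ^ j * ?o"
          using o by (intro mult_left_mono) auto
        also note 1
        finally have 2: "norm (z \<epsilon> $ i) ^ j \<le> (measure lborel K * B) * (2 / norm I) * (\<epsilon> powr p * ?E)"
          using I by (simp add: field_simps)
        have "norm (z \<epsilon>) ^ j \<le> (n * norm (z \<epsilon> $ i)) ^ j" by (intro power_mono i) simp
        also have "\<dots> = n ^ j * norm (z \<epsilon> $ i) ^ j" by (simp add: power_mult_distrib)
        also have "\<dots> \<le> n ^ j * ((measure lborel K * B) * (2 / norm I) * (\<epsilon> powr p * ?E))"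
          using 2 n0 by (intro mult_left_mono) auto
        finally show "norm (z \<epsilon>) ^ j \<le> D * \<epsilon> powr p * ?E" by (simp add: D_def algebra_simps)
      qed
    qed
    then show "\<exists>C. \<forall>\<^sub>F \<epsilon> in at_right 0. \<epsilon> \<in> A' \<longrightarrow> norm (z \<epsilon>) ^ j \<le> C * \<epsilon> powr p * exp (norm (Im_vec (z \<epsilon>)))" by blast
  qed
qed

section \<open>Representatives of zeros\<close>

lemma represents_rep_gnum: "represents (rep_gnum a) a"
  by (simp add: represents_def moderate_net_rep_gnum abs_gnum_rep_gnum)

lemma represents_negligible_diff:
  "represents r x \<Longrightarrow> represents s x \<Longrightarrow> negligible_net (\<lambda>\<epsilon>. r \<epsilon> - s \<epsilon>)"
  using abs_gnum_eq_iff[of r s] by (auto simp: represents_def)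

lemma represents_0: "represents (\<lambda>\<epsilon>. 0) 0"
  by (simp add: represents_def moderate_net_const zero_gnum.abs_eq)

lemma represents_1: "represents (\<lambda>\<epsilon>. 1) 1"
  by (simp add: represents_def moderate_net_const one_gnum.abs_eq)

lemma represents_add: "represents r x \<Longrightarrow> represents s y \<Longrightarrow> represents (\<lambda>\<epsilon>. r \<epsilon> + s \<epsilon>) (x + y)"
  by (auto simp: represents_def moderate_net_add abs_gnum_add)

lemma represents_mult: "represents r x \<Longrightarrow> represents s y \<Longrightarrow> represents (\<lambda>\<epsilon>. r \<epsilon> * s \<epsilon>) (x * y)"
  by (auto simp: represents_def moderate_net_mult abs_gnum_mult)

lemma represents_minus: "represents r x \<Longrightarrow> represents (\<lambda>\<epsilon>. - r \<epsilon>) (- x)"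
  by (auto simp: represents_def moderate_net_uminus uminus_gnum.abs_eq gnum_rel_refl_iff)

lemma represents_power: "represents r x \<Longrightarrow> represents (\<lambda>\<epsilon>. r \<epsilon> ^ k) (x ^ k)"
  by (induction k) (auto intro: represents_1 represents_mult)

lemma represents_sum: "(\<And>a. a \<in> I \<Longrightarrow> represents (r a) (x a)) \<Longrightarrow> represents (\<lambda>\<epsilon>. \<Sum>a\<in>I. r a \<epsilon>) (\<Sum>a\<in>I. x a)"
  by (induction I rule: infinite_finite_induct) (auto intro: represents_0 represents_add)

lemma represents_prod: "(\<And>a. a \<in> I \<Longrightarrow> represents (r a) (x a)) \<Longrightarrow> represents (\<lambda>\<epsilon>. \<Prod>a\<in>I. r a \<epsilon>) (\<Prod>a\<in>I. x a)"
  by (induction I rule: infinite_finite_induct) (auto intro: represents_1 represents_mult)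

lemma moderate_net_norm_le:
  assumes "moderate_net r" "\<And>x. norm (f x) \<le> norm x"
  shows "moderate_net (\<lambda>\<epsilon>. f (r \<epsilon>))"
proof -
  have "(\<lambda>\<epsilon>. norm (f (r \<epsilon>))) \<in> O[at_right 0](\<lambda>\<epsilon>. norm (r \<epsilon>))"
    by (rule bigoI[where c = 1]) (auto intro!: always_eventually assms(2))
  then show ?thesis using assms(1) landau_o.big_trans unfolding moderate_net_def by blast
qed

lemma represents_Complex:
  assumes "represents r (gRe a)" "represents s (gIm a)"
  shows "represents (\<lambda>\<epsilon>. Complex (r \<epsilon>) (s \<epsilon>)) a"
proof -
  have "gRe a = abs_gnum (\<lambda>\<epsilon>. Re (rep_gnum a \<epsilon>))" "gIm a = abs_gnum (\<lambda>\<epsilon>. Im (rep_gnum a \<epsilon>))"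
    using gRe.abs_eq[of "rep_gnum a"] gIm.abs_eq[of "rep_gnum a"] moderate_net_rep_gnum[of a]
    by (simp_all add: gnum_rel_refl_iff abs_gnum_rep_gnum)
  moreover have "moderate_net (\<lambda>\<epsilon>. Re (rep_gnum a \<epsilon>))" "moderate_net (\<lambda>\<epsilon>. Im (rep_gnum a \<epsilon>))"
    using moderate_net_norm_le[OF moderate_net_rep_gnum[of a], of Re]
      moderate_net_norm_le[OF moderate_net_rep_gnum[of a], of Im]
    by (simp_all add: abs_Re_le_cmod abs_Im_le_cmod)
  ultimately have n: "negligible_net (\<lambda>\<epsilon>. r \<epsilon> - Re (rep_gnum a \<epsilon>))" "negligible_net (\<lambda>\<epsilon>. s \<epsilon> - Im (rep_gnum a \<epsilon>))"
    using assms by (auto intro!: represents_negligible_diff simp: represents_def)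
  have "negligible_net (\<lambda>\<epsilon>. Complex (r \<epsilon>) (s \<epsilon>) - rep_gnum a \<epsilon>)"
    unfolding negligible_net_def
  proof
    fix q :: nat
    have "(\<lambda>\<epsilon>. norm (Complex (r \<epsilon>) (s \<epsilon>) - rep_gnum a \<epsilon>)) \<in> O[at_right 0](\<lambda>\<epsilon>.
        norm (r \<epsilon> - Re (rep_gnum a \<epsilon>)) + norm (s \<epsilon> - Im (rep_gnum a \<epsilon>)))"
      by (rule bigoI[where c = 1]) (auto intro!: always_eventually order_trans[OF cmod_le])
    also have "(\<lambda>\<epsilon>. norm (r \<epsilon> - Re (rep_gnum a \<epsilon>)) + norm (s \<epsilon> - Im (rep_gnum a \<epsilon>))) \<in> O[at_right 0](\<lambda>\<epsilon>. \<epsilon> powr real q)"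
      using n by (intro sum_in_bigo) (auto simp: negligible_net_def)
    finally show "(\<lambda>\<epsilon>. norm (Complex (r \<epsilon>) (s \<epsilon>) - rep_gnum a \<epsilon>)) \<in> O[at_right 0](\<lambda>\<epsilon>. \<epsilon> powr real q)" .
  qed
  then have d: "moderate_net (\<lambda>\<epsilon>. Complex (r \<epsilon>) (s \<epsilon>) - rep_gnum a \<epsilon>)"
    unfolding negligible_net_def moderate_net_def by (auto intro!: exI[of _ 0] dest: spec[of _ 0])
  have "moderate_net (\<lambda>\<epsilon>. Complex (r \<epsilon>) (s \<epsilon>))"
    using moderate_net_add[OF d moderate_net_rep_gnum[of a]] by simp
  then show ?thesis
    unfolding represents_def
    using abs_gnum_eqI[OF _ moderate_net_rep_gnum \<open>negligible_net (\<lambda>\<epsilon>. Complex (r \<epsilon>) (s \<epsilon>) - rep_gnum a \<epsilon>)\<close>]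
    by (simp add: abs_gnum_rep_gnum)
qed

text \<open>This representative is composed of the ones that \<open>gnorm\<close> and \<open>gexp_norm\<close> choose for the real and
  the imaginary part, so that no negligible differences occur in the norms.\<close>

definition zero_net :: "(complex gnum)^'n \<Rightarrow> real \<Rightarrow> complex^'n" where
  "zero_net \<zeta> \<epsilon> = (\<chi> i. Complex (vec_rep (vec_Re \<zeta>) \<epsilon> $ i) (vec_rep (vec_Im \<zeta>) \<epsilon> $ i))"

lemma Im_zero_net: "Im_vec (zero_net \<zeta> \<epsilon>) = vec_rep (vec_Im \<zeta>) \<epsilon>"
  by (simp add: Im_vec_def zero_net_def vec_eq_iff)

lemma norm_Re_zero_net_le: "norm (vec_rep (vec_Re \<zeta>) \<epsilon>) \<le> norm (zero_net \<zeta> \<epsilon>)"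
  for \<zeta> :: "(complex gnum)^'n::finite"
  unfolding norm_vec_def
  by (rule L2_set_mono) (simp_all add: zero_net_def vec_rep_def complex_norm)

lemma represents_zero_net: "represents (\<lambda>\<epsilon>. zero_net \<zeta> \<epsilon> $ i) (\<zeta> $ i)"
  unfolding zero_net_def vec_rep_def vec_Re_def vec_Im_def
  by (simp, rule represents_Complex) (rule represents_rep_gnum)+

text \<open>The two signs \<open>(-1)\<^bsup>|\<alpha>|\<^esup>\<close>, of the transposed coefficients and of the argument, cancel.\<close>

lemma represents_symbol:
  fixes \<zeta> :: "(complex gnum)^'n::finite"
  shows "represents (\<lambda>\<epsilon>. transposed_symbol m c \<epsilon> (zero_net \<zeta> \<epsilon>)) (symbol m c \<zeta>)"
proof -
  have "represents (\<lambda>\<epsilon>. \<Sum>\<alpha>\<in>mi_upto m. rep_gnum (transpose_coeffs c \<alpha>) \<epsilon> *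
      ((- 1) ^ mi_abs \<alpha> * mi_power (zero_net \<zeta> \<epsilon>) \<alpha>))
      (\<Sum>\<alpha>\<in>mi_upto m. transpose_coeffs c \<alpha> * ((- 1) ^ mi_abs \<alpha> * mi_power \<zeta> \<alpha>))"
    unfolding mi_power_def
    by (intro represents_sum represents_mult represents_prod represents_power represents_minus represents_1
        represents_rep_gnum represents_zero_net)
  moreover have "transpose_coeffs c \<alpha> * ((- 1) ^ mi_abs \<alpha> * mi_power \<zeta> \<alpha>) = c \<alpha> * mi_power \<zeta> \<alpha>" for \<alpha>
  proof -
    have "(- 1) ^ mi_abs \<alpha> * (- 1) ^ mi_abs \<alpha> = (1 :: complex gnum)" by (simp flip: power_mult_distrib)
    then show ?thesis by (simp add: transpose_coeffs_def mult.left_commute mult.assoc[symmetric])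
  qed
  ultimately show ?thesis by (simp add: symbol_def transposed_symbol_def)
qed

lemma negligible_symbol_zero_net:
  assumes "\<zeta> \<in> log_zeros m c"
  shows "negligible_net (\<lambda>\<epsilon>. transposed_symbol m c \<epsilon> (zero_net \<zeta> \<epsilon>))"
proof -
  have "symbol m c \<zeta> = 0" using assms by (simp add: log_zeros_def)
  then show ?thesis
    using represents_negligible_diff[OF represents_symbol[where m = m and c = c and \<zeta> = \<zeta>], of "\<lambda>\<epsilon>. 0"] represents_0 by simp
qed

lemma moderate_net_norm_vec_rep: "moderate_net (\<lambda>\<epsilon>. norm (vec_rep \<xi> \<epsilon>))"
  for \<xi> :: "(real gnum)^'n::finite"
proof -
  have "moderate_net (\<lambda>\<epsilon>. \<Sum>i\<in>UNIV. \<bar>rep_gnum (\<xi> $ i) \<epsilon>\<bar>)"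
  proof -
    have "moderate_net (\<lambda>\<epsilon>. \<bar>rep_gnum (\<xi> $ i) \<epsilon>\<bar>)" for i
      by (rule moderate_net_cong[OF moderate_net_rep_gnum[of "\<xi> $ i"]]) simp
    then have "moderate_net (\<lambda>\<epsilon>. \<Sum>i\<in>I. \<bar>rep_gnum (\<xi> $ i) \<epsilon>\<bar>)" for I
      by (induction I rule: infinite_finite_induct) (auto intro: moderate_net_add moderate_net_const)
    then show ?thesis .
  qed
  then show ?thesis
  proof (rule moderate_net_cong)
    fix \<epsilon> :: real
    have "norm (vec_rep \<xi> \<epsilon>) \<le> (\<Sum>i\<in>UNIV. \<bar>vec_rep \<xi> \<epsilon> $ i\<bar>)" by (rule norm_le_l1_cart)
    then show "norm (norm (vec_rep \<xi> \<epsilon>)) \<le> norm (\<Sum>i\<in>UNIV. \<bar>rep_gnum (\<xi> $ i) \<epsilon>\<bar>)"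
      by (simp add: vec_rep_def)
  qed
qed

lemma eventually_le_powr:
  fixes C :: real
  assumes "q < p"
  shows "\<forall>\<^sub>F \<epsilon> in at_right 0. C * \<epsilon> powr p \<le> \<epsilon> powr q"
proof -
  have "((\<lambda>\<epsilon>. C * \<epsilon> powr (p - q)) \<longlongrightarrow> C * 0) (at_right 0)"
  proof (intro tendsto_mult tendsto_const)
    show "((\<lambda>\<epsilon>::real. \<epsilon> powr (p - q)) \<longlongrightarrow> 0) (at_right 0)"
      using assms by (intro tendsto_zero_powrI[where b = "p - q"] tendsto_intros eventually_mono[OF eventually_unit]) auto
  qed
  then have "\<forall>\<^sub>F \<epsilon> in at_right 0. C * \<epsilon> powr (p - q) < 1" by (rule order_tendstoD) simp
  then show ?thesis
    using eventually_unit
  proof eventually_elim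
    case (elim \<epsilon>)
    have "C * \<epsilon> powr p = C * \<epsilon> powr (p - q) * \<epsilon> powr q" by (simp flip: powr_add)
    also have "\<dots> \<le> 1 * \<epsilon> powr q" using elim by (intro mult_right_mono) auto
    finally show ?case by simp
  qed
qed

text \<open>The logarithmic bound holds for some representative of the imaginary part; the one in \<open>zero_net\<close>
  differs from it by a negligible, hence bounded net.\<close>

lemma zero_net_growth:
  fixes \<zeta> :: "(complex gnum)^'n::finite"
  assumes "log_type (vec_Im \<zeta>)"
  obtains M :: nat where "moderate_exponents UNIV (zero_net \<zeta>) M"
proof -
  have "moderate_net (\<lambda>\<epsilon>. norm (vec_rep (vec_Re \<zeta>) \<epsilon>) + norm (vec_rep (vec_Im \<zeta>) \<epsilon>))"
    by (intro moderate_net_add moderate_net_norm_vec_rep)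
  then obtain N :: nat where "(\<lambda>\<epsilon>. norm (norm (vec_rep (vec_Re \<zeta>) \<epsilon>) + norm (vec_rep (vec_Im \<zeta>) \<epsilon>)))
      \<in> O[at_right 0](\<lambda>\<epsilon>. \<epsilon> powr (- real N))"
    unfolding moderate_net_def by blast
  then obtain C where C: "\<forall>\<^sub>F \<epsilon> in at_right 0. norm (vec_rep (vec_Re \<zeta>) \<epsilon>) + norm (vec_rep (vec_Im \<zeta>) \<epsilon>) \<le> C * \<epsilon> powr (- real N)"
    by (auto elim!: landau_o.bigE)
  have tri: "norm (zero_net \<zeta> \<epsilon>) \<le> norm (vec_rep (vec_Re \<zeta>) \<epsilon>) + norm (vec_rep (vec_Im \<zeta>) \<epsilon>)" for \<epsilon>
  proof -
    have "norm (zero_net \<zeta> \<epsilon>) \<le> L2_set (\<lambda>i. norm (vec_rep (vec_Re \<zeta>) \<epsilon> $ i) + norm (vec_rep (vec_Im \<zeta>) \<epsilon> $ i)) UNIV"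
      unfolding norm_vec_def by (rule L2_set_mono) (auto simp: zero_net_def intro: order_trans[OF cmod_le])
    also have "\<dots> \<le> norm (vec_rep (vec_Re \<zeta>) \<epsilon>) + norm (vec_rep (vec_Im \<zeta>) \<epsilon>)"
      unfolding norm_vec_def by (rule L2_set_triangle_ineq)
    finally show ?thesis .
  qed
  obtain x where x: "vec_represents x (vec_Im \<zeta>)" "(\<lambda>\<epsilon>. norm (x \<epsilon>)) \<in> O[at_right 0](\<lambda>\<epsilon>. ln (1 / \<epsilon>))"
    using assms unfolding log_type_def by blast
  obtain D where D: "D > 0" "\<forall>\<^sub>F \<epsilon> in at_right 0. norm (norm (x \<epsilon>)) \<le> D * norm (ln (1 / \<epsilon>))"
    using x(2) by (auto elim!: landau_o.bigE)
  have "\<forall>\<^sub>F \<epsilon> in at_right 0. \<bar>vec_rep (vec_Im \<zeta>) \<epsilon> $ i - x \<epsilon> $ i\<bar> \<le> 1" for i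
  proof -
    have "negligible_net (\<lambda>\<epsilon>. rep_gnum (vec_Im \<zeta> $ i) \<epsilon> - x \<epsilon> $ i)"
      using x(1) represents_negligible_diff[OF represents_rep_gnum] by (auto simp: vec_represents_def)
    then have "(\<lambda>\<epsilon>. norm (rep_gnum (vec_Im \<zeta> $ i) \<epsilon> - x \<epsilon> $ i)) \<in> O[at_right 0](\<lambda>\<epsilon>. \<epsilon> powr (real 1))"
      unfolding negligible_net_def by blast
    then obtain c where c: "\<forall>\<^sub>F \<epsilon> in at_right 0. \<bar>rep_gnum (vec_Im \<zeta> $ i) \<epsilon> - x \<epsilon> $ i\<bar> \<le> c * \<epsilon> powr 1"
      by (auto elim!: landau_o.bigE)
    have "\<forall>\<^sub>F \<epsilon> in at_right 0. c * \<epsilon> powr 1 \<le> \<epsilon> powr 0" by (rule eventually_le_powr) simp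
    with c eventually_unit show ?thesis
      by eventually_elim (auto simp: vec_rep_def)
  qed
  then have "\<forall>\<^sub>F \<epsilon> in at_right 0. \<forall>i\<in>UNIV. \<bar>vec_rep (vec_Im \<zeta>) \<epsilon> $ i - x \<epsilon> $ i\<bar> \<le> 1"
    by (intro eventually_ball_finite) auto
  then have E: "\<forall>\<^sub>F \<epsilon> in at_right 0. exp (norm (vec_rep (vec_Im \<zeta>) \<epsilon>)) \<le> exp (real CARD('n)) * \<epsilon> powr (- D)"
    using D(2) eventually_unit
  proof eventually_elim
    case (elim \<epsilon>)
    have "norm (vec_rep (vec_Im \<zeta>) \<epsilon>) \<le> norm (vec_rep (vec_Im \<zeta>) \<epsilon> - x \<epsilon>) + norm (x \<epsilon>)"
      using norm_triangle_sub[of "vec_rep (vec_Im \<zeta>) \<epsilon>" "x \<epsilon>"] by simp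
    also have "norm (vec_rep (vec_Im \<zeta>) \<epsilon> - x \<epsilon>) \<le> (\<Sum>i\<in>UNIV. \<bar>(vec_rep (vec_Im \<zeta>) \<epsilon> - x \<epsilon>) $ i\<bar>)"
      by (rule norm_le_l1_cart)
    also have "\<dots> \<le> (\<Sum>i\<in>(UNIV::'n set). 1)" by (rule sum_mono) (use elim(1) in auto)
    also have "norm (x \<epsilon>) \<le> D * (- ln \<epsilon>)"
      using elim(2,3) by (simp add: ln_div)
    finally have "norm (vec_rep (vec_Im \<zeta>) \<epsilon>) \<le> real CARD('n) + (- D) * ln \<epsilon>" by simp
    then have "exp (norm (vec_rep (vec_Im \<zeta>) \<epsilon>)) \<le> exp (real CARD('n) + (- D) * ln \<epsilon>)" by simp
    also have "\<dots> = exp (real CARD('n)) * \<epsilon> powr (- D)"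
      using elim(3) by (simp only: exp_add) (simp add: powr_def)
    finally show ?case .
  qed
  obtain M :: nat where M: "max (real N) D < real M" using reals_Archimedean2 by blast
  have "\<forall>\<^sub>F \<epsilon> in at_right 0. C * \<epsilon> powr (- real N) \<le> \<epsilon> powr (- real M)"
    "\<forall>\<^sub>F \<epsilon> in at_right 0. exp (real CARD('n)) * \<epsilon> powr (- D) \<le> \<epsilon> powr (- real M)"
    using M by (auto intro!: eventually_le_powr)
  with C E have "moderate_exponents UNIV (zero_net \<zeta>) M"
    unfolding moderate_exponents_def by eventually_elim (use tri in \<open>auto simp: Im_zero_net intro: order_trans\<close>)
  then show thesis by (rule that)
qed

section \<open>The necessary conditions\<close>

text \<open>For a regular net the exponent \<open>N\<close> is independent of the order of differentiation, so that
  \<open>|z|\<^sup>j = O(\<epsilon>\<^bsup>-N-M\<^esup>)\<close> for all \<open>j\<close>.\<close>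

lemma G_inf_hypoelliptic_imp_valuation_Re_nonneg:
  fixes c :: "'n::finite coeffs"
  assumes hyp: "hypoelliptic \<G>_inf m c" and \<zeta>: "\<zeta> \<in> log_zeros m c"
  shows "valuation (gnorm (vec_Re \<zeta>)) \<ge> 0"
proof -
  have "log_type (vec_Im \<zeta>)" using \<zeta> by (simp add: log_zeros_def)
  then obtain M :: nat where M: "moderate_exponents UNIV (zero_net \<zeta>) M" by (rule zero_net_growth)
  have t: "moderate_distributions UNIV (osc_net UNIV (zero_net \<zeta>))"
  proof (rule moderate_distributions_osc_net)
    show "\<forall>\<^sub>F \<epsilon> in at_right 0. \<epsilon> \<in> UNIV \<longrightarrow>
        exp (norm (Im_vec (zero_net \<zeta> \<epsilon>))) \<le> \<epsilon> powr (- real M) * (1 + norm (zero_net \<zeta> \<epsilon>))"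
      using M unfolding moderate_exponents_def
    proof eventually_elim
      case (elim \<epsilon>)
      have "\<epsilon> powr (- real M) * 1 \<le> \<epsilon> powr (- real M) * (1 + norm (zero_net \<zeta> \<epsilon>))"
        by (intro mult_left_mono) auto
      then show ?case using elim by simp
    qed
  qed
  obtain V W where V: "open V" "0 \<in> V" and W: "W \<in> \<G>_inf V"
    and T: "\<And>U. U \<in> \<G>_c V \<Longrightarrow> gfunctional_of UNIV (osc_net UNIV (zero_net \<zeta>)) (gclass UNIV (crep V U)) = embed V W U"
    using hypoelliptic_osc[OF hyp gclass_zero_G_inf[OF open_UNIV] t] negligible_symbol_zero_net[OF \<zeta>] by auto
  obtain w where w: "W \<in> \<G> V" "w \<in> W" "regular_on V w" using W by (auto simp: \<G>_inf_def)
  obtain K where K: "compact K" "K \<subseteq> V" and growth: "\<And>w A' M j p. w \<in> W \<Longrightarrow> A' \<subseteq> UNIV \<Longrightarrow>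
      moderate_exponents A' (zero_net \<zeta>) M \<Longrightarrow>
      (\<And>is. length is \<le> j \<Longrightarrow> bigo_on K p (\<lambda>\<epsilon>. pds is (w \<epsilon>))) \<Longrightarrow>
      \<exists>C. \<forall>\<^sub>F \<epsilon> in at_right 0. \<epsilon> \<in> A' \<longrightarrow>
        norm (zero_net \<zeta> \<epsilon>) ^ j \<le> C * \<epsilon> powr p * exp (norm (Im_vec (zero_net \<zeta> \<epsilon>)))"
    using osc_growth[OF t V w(1) T] by blast
  obtain N :: nat where N: "\<And>is. bigo_on K (- real N) (\<lambda>\<epsilon>. pds is (w \<epsilon>))"
    using regular_on_imp[OF V(1) w(3) K] by blast
  show ?thesis
    unfolding gnorm_def
  proof (rule valuation_geI[OF moderate_net_norm_vec_rep])
    fix b assume "ereal b < 0"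
    then have b: "b < 0" by simp
    obtain j :: nat where j: "real (N + M) / (- b) < real j" using reals_Archimedean2 by blast
    then have jb: "real (N + M) < real j * (- b)" using b by (simp add: field_simps)
    then have j0: "j > 0" by (cases j) auto
    obtain C where C: "\<forall>\<^sub>F \<epsilon> in at_right 0. \<epsilon> \<in> UNIV \<longrightarrow>
        norm (zero_net \<zeta> \<epsilon>) ^ j \<le> C * \<epsilon> powr (- real N) * exp (norm (Im_vec (zero_net \<zeta> \<epsilon>)))"
      using growth[OF w(2) order_refl _ N, of M j] M by auto
    define B where "B = max C 1"
    have "\<forall>\<^sub>F \<epsilon> in at_right 0. norm (norm (norm (vec_rep (vec_Re \<zeta>) \<epsilon>))) \<le> B * norm (\<epsilon> powr b)"
      using C M[unfolded moderate_exponents_def] eventually_unit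
    proof eventually_elim
      case (elim \<epsilon>)
      have "norm (zero_net \<zeta> \<epsilon>) ^ j \<le> C * \<epsilon> powr (- real N) * exp (norm (Im_vec (zero_net \<zeta> \<epsilon>)))"
        using elim(1) by simp
      also have "\<dots> \<le> B * \<epsilon> powr (- real N) * \<epsilon> powr (- real M)"
        using elim(2) by (intro mult_mono mult_right_mono) (auto simp: B_def)
      also have "\<dots> = B * \<epsilon> powr (- real (N + M))" by (simp flip: powr_add)
      also have "\<dots> \<le> B ^ j * \<epsilon> powr (b * real j)"
        using elim(3) jb j0 self_le_power[of B j]
        by (intro mult_mono powr_mono') (auto simp: B_def mult.commute)
      also have "\<dots> = (B * \<epsilon> powr b) ^ j"
        using elim(3) by (simp add: power_mult_distrib powr_power mult.commute)
      finally have "norm (zero_net \<zeta> \<epsilon>) \<le> B * \<epsilon> powr b"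
        using j0 by (subst (asm) power_mono_iff) (auto simp: B_def)
      then show ?case using norm_Re_zero_net_le[of \<zeta> \<epsilon>] by simp
    qed
    then show "(\<lambda>\<epsilon>. norm (norm (vec_rep (vec_Re \<zeta>) \<epsilon>))) \<in> O[at_right 0](\<lambda>\<epsilon>. \<epsilon> powr b)" by (rule bigoI)
  qed
qed

text \<open>If the opposite inequality held for all small \<open>\<epsilon>\<close>, then every bound \<open>e\<^bsup>\<kappa>|Im \<zeta>|\<^esup> = O(\<epsilon>\<^bsup>b+\<kappa>\<^esup>)\<close> would give
  \<open>|Re \<zeta>| = O(\<epsilon>\<^sup>b)\<close>, and the valuations would satisfy the inequality that fails.\<close>

lemma frequently_large_zero:
  fixes \<zeta> :: "(complex gnum)^'n::finite"
  assumes lt: "log_type (vec_Im \<zeta>)" and \<kappa>: "\<kappa> > 0"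
    and fail: "\<not> valuation (gnorm (vec_Re \<zeta>)) \<ge> ereal (- \<kappa>) + valuation (gexp_norm \<kappa> (vec_Im \<zeta>))"
  shows "\<exists>\<^sub>F \<epsilon> in at_right 0. norm (zero_net \<zeta> \<epsilon>) \<ge> \<epsilon> powr (- \<kappa>) * exp (\<kappa> * norm (Im_vec (zero_net \<zeta> \<epsilon>)))"
proof (rule ccontr)
  assume "\<not> ?thesis"
  then have small: "\<forall>\<^sub>F \<epsilon> in at_right 0. norm (zero_net \<zeta> \<epsilon>) < \<epsilon> powr (- \<kappa>) * exp (\<kappa> * norm (Im_vec (zero_net \<zeta> \<epsilon>)))"
    by (simp add: not_frequently not_le)
  let ?E = "\<lambda>\<epsilon>. exp (\<kappa> * norm (vec_rep (vec_Im \<zeta>) \<epsilon>))"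
  obtain M :: nat where M: "moderate_exponents UNIV (zero_net \<zeta>) M" using zero_net_growth[OF lt] by blast
  obtain k :: nat where k: "\<kappa> \<le> real k" using real_arch_simple by blast
  have mE: "moderate_net ?E"
    unfolding moderate_net_def
  proof (intro exI bigoI[where c = 1])
    show "\<forall>\<^sub>F \<epsilon> in at_right 0. norm (norm (?E \<epsilon>)) \<le> 1 * norm (\<epsilon> powr (- real (M * k)))"
      using M[unfolded moderate_exponents_def] eventually_unit
    proof eventually_elim
      case (elim \<epsilon>)
      have "?E \<epsilon> \<le> exp (real k * norm (vec_rep (vec_Im \<zeta>) \<epsilon>))" using k by (simp add: mult_right_mono)
      also have "\<dots> = exp (norm (vec_rep (vec_Im \<zeta>) \<epsilon>)) ^ k" by (simp add: exp_of_nat_mult)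
      also have "\<dots> \<le> (\<epsilon> powr (- real M)) ^ k" using elim(1) by (intro power_mono) (auto simp: Im_zero_net)
      also have "\<dots> = \<epsilon> powr (- real (M * k))" using elim(2) by (simp add: powr_power mult.commute)
      finally show ?case by simp
    qed
  qed
  have "ereal (- \<kappa>) + valuation (abs_gnum ?E) \<le> valuation (gnorm (vec_Re \<zeta>))"
    unfolding gnorm_def
  proof (rule valuation_geI[OF moderate_net_norm_vec_rep])
    fix b assume "ereal b < ereal (- \<kappa>) + valuation (abs_gnum ?E)"
    then have "ereal (b + \<kappa>) < valuation (abs_gnum ?E)"
      by (cases "valuation (abs_gnum ?E)") auto
    then have "(\<lambda>\<epsilon>. norm (?E \<epsilon>)) \<in> O[at_right 0](\<lambda>\<epsilon>. \<epsilon> powr (b + \<kappa>))"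
      by (rule bigo_if_less_valuation[OF mE])
    then obtain C where C: "\<forall>\<^sub>F \<epsilon> in at_right 0. ?E \<epsilon> \<le> C * \<epsilon> powr (b + \<kappa>)"
      by (auto elim!: landau_o.bigE)
    have "\<forall>\<^sub>F \<epsilon> in at_right 0. norm (norm (norm (vec_rep (vec_Re \<zeta>) \<epsilon>))) \<le> C * norm (\<epsilon> powr b)"
      using C small
    proof eventually_elim
      case (elim \<epsilon>)
      have "norm (vec_rep (vec_Re \<zeta>) \<epsilon>) \<le> \<epsilon> powr (- \<kappa>) * ?E \<epsilon>"
        using norm_Re_zero_net_le[of \<zeta> \<epsilon>] elim(2) by (simp add: Im_zero_net)
      also have "\<dots> \<le> \<epsilon> powr (- \<kappa>) * (C * \<epsilon> powr (b + \<kappa>))" using elim(1) by (intro mult_left_mono) auto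
      also have "\<dots> = C * \<epsilon> powr b" by (simp add: algebra_simps flip: powr_add)
      finally show ?case by simp
    qed
    then show "(\<lambda>\<epsilon>. norm (norm (vec_rep (vec_Re \<zeta>) \<epsilon>))) \<in> O[at_right 0](\<lambda>\<epsilon>. \<epsilon> powr b)" by (rule bigoI)
  qed
  then show False using fail by (simp add: gexp_norm_def)
qed

text \<open>Zeros violating the inequality with worse and worse constants are combined into one functional by
  a gliding hump in \<open>\<epsilon>\<close>: the parameters \<open>e 0 > e 1 > \<dots>\<close> tend to \<open>0\<close>, and at \<open>e l\<close> the \<open>\<iota> l\<close>-th zero is
  used. The pairing function makes \<open>\<iota>\<close> take every value infinitely often.\<close>

lemma G_hypoelliptic_imp_valuation_Re_ge:
  fixes c :: "'n::finite coeffs"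
  assumes hyp: "hypoelliptic \<G> m c"
  shows "\<exists>(b::real) (a::real). a > 0 \<and> (\<forall>\<zeta>\<in>log_zeros m c.
     valuation (gnorm (vec_Re \<zeta>)) \<ge> ereal b + valuation (gexp_norm a (vec_Im \<zeta>)))"
proof (rule ccontr)
  assume contra: "\<not> ?thesis"
  have "\<exists>\<zeta>\<in>log_zeros m c. \<not> valuation (gnorm (vec_Re \<zeta>)) \<ge>
      ereal (- real (Suc k)) + valuation (gexp_norm (real (Suc k)) (vec_Im \<zeta>))" for k
  proof (rule ccontr)
    assume "\<not> ?thesis"
    moreover have "real (Suc k) > 0" by simp
    ultimately show False using contra by blast
  qed
  then obtain Z where Z: "\<And>k. Z k \<in> log_zeros m c" and fail: "\<And>k. \<not> valuation (gnorm (vec_Re (Z k))) \<ge>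
      ereal (- real (Suc k)) + valuation (gexp_norm (real (Suc k)) (vec_Im (Z k)))" by metis
  have lt: "log_type (vec_Im (Z k))" for k using Z by (simp add: log_zeros_def)
  define large where "large k \<epsilon> \<longleftrightarrow> norm (zero_net (Z k) \<epsilon>) \<ge>
      \<epsilon> powr (- real (Suc k)) * exp (real (Suc k) * norm (Im_vec (zero_net (Z k) \<epsilon>)))" for k \<epsilon>
  define \<iota> where "\<iota> l = fst (prod_decode l)" for l
  define good where "good l \<epsilon> \<longleftrightarrow> 0 < \<epsilon> \<and> \<epsilon> \<le> 1 \<and> \<epsilon> < 1 / real (Suc l) \<and> large (\<iota> l) \<epsilon> \<and>
      norm (transposed_symbol m c \<epsilon> (zero_net (Z (\<iota> l)) \<epsilon>)) \<le> \<epsilon> powr real l" for l \<epsilon>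
  \<comment> \<open>Largeness of the zero occurs frequently, all other requirements hold eventually.\<close>
  have ex: "\<exists>\<epsilon>. good l \<epsilon> \<and> \<epsilon> < \<delta>" if "\<delta> > 0" for l \<delta>
  proof -
    have f: "\<exists>\<^sub>F \<epsilon> in at_right 0. large (\<iota> l) \<epsilon>"
      unfolding large_def by (rule frequently_large_zero[OF lt _ fail]) simp
    have "(\<lambda>\<epsilon>. norm (transposed_symbol m c \<epsilon> (zero_net (Z (\<iota> l)) \<epsilon>))) \<in> O[at_right 0](\<lambda>\<epsilon>. \<epsilon> powr (real (Suc l)))"
      using negligible_symbol_zero_net[OF Z] unfolding negligible_net_def by blast
    then obtain C where C: "\<forall>\<^sub>F \<epsilon> in at_right 0. norm (transposed_symbol m c \<epsilon> (zero_net (Z (\<iota> l)) \<epsilon>)) \<le> C * \<epsilon> powr (real (Suc l))"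
      by (auto elim!: landau_o.bigE)
    have "\<forall>\<^sub>F \<epsilon> in at_right 0. C * \<epsilon> powr (real (Suc l)) \<le> \<epsilon> powr (real l)"
      by (rule eventually_le_powr) simp
    moreover have "\<forall>\<^sub>F \<epsilon> in at_right 0. \<epsilon> \<in> {0<..<min \<delta> (1 / real (Suc l))}"
      by (rule eventually_at_right_real) (use that in simp)
    ultimately have "\<forall>\<^sub>F \<epsilon> in at_right 0. large (\<iota> l) \<epsilon> \<longrightarrow> good l \<epsilon> \<and> \<epsilon> < \<delta>"
      using C eventually_unit by eventually_elim (auto simp: good_def)
    from frequently_rev_mp[OF f this] show ?thesis by (rule frequently_ex)
  qed
  have "\<exists>e. \<forall>l. good l (e l) \<and> e (Suc l) < e l"
  proof (rule dependent_nat_choice)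
    show "\<exists>\<epsilon>. good 0 \<epsilon>" using ex[of 1 0] by auto
    show "\<exists>\<epsilon>'. good (Suc l) \<epsilon>' \<and> \<epsilon>' < \<epsilon>" if "good l \<epsilon>" for \<epsilon> l
      using ex[of \<epsilon> "Suc l"] that by (auto simp: good_def)
  qed
  then obtain e where e: "\<And>l. good l (e l)" "\<And>l. e (Suc l) < e l" by blast
  have dec: "e l < e k" if "k < l" for k l
    using that e(2) by (induction l) (auto simp: less_Suc_eq intro: less_trans)
  have inj: "inj e" by (rule injI) (metis dec less_irrefl linorder_neqE_nat)
  define A where "A = range e"
  define z where "z \<epsilon> = zero_net (Z (\<iota> (inv e \<epsilon>))) \<epsilon>" for \<epsilon>
  have z: "z (e l) = zero_net (Z (\<iota> l)) (e l)" for l by (simp add: z_def inv_f_f[OF inj])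
  have zl: "norm (z (e l)) \<ge> e l powr (- real (Suc (\<iota> l))) * exp (real (Suc (\<iota> l)) * norm (Im_vec (z (e l))))" for l
    using e(1)[of l] by (simp only: good_def large_def z)
  \<comment> \<open>As \<open>Suc (\<iota> l) \<ge> 1\<close>, largeness of the zero implies \<open>e\<^bsup>|Im z|\<^esup> \<le> |z|\<close>.\<close>
  have t: "moderate_distributions UNIV (osc_net A z)"
  proof (rule moderate_distributions_osc_net[where M = 0], rule always_eventually, intro allI impI)
    fix \<epsilon> assume "\<epsilon> \<in> A"
    then obtain l where l: "\<epsilon> = e l" by (auto simp: A_def)
    have pos: "0 < \<epsilon>" "\<epsilon> \<le> 1" using e(1)[of l] by (auto simp: good_def l)
    have "1 * exp (1 * norm (Im_vec (z \<epsilon>))) \<le> \<epsilon> powr (- real (Suc (\<iota> l))) * exp (real (Suc (\<iota> l)) * norm (Im_vec (z \<epsilon>)))"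
    proof (intro mult_mono)
      show "1 \<le> \<epsilon> powr (- real (Suc (\<iota> l)))" using pos powr_mono'[of "- real (Suc (\<iota> l))" 0 \<epsilon>] by simp
      have "1 * norm (Im_vec (z \<epsilon>)) \<le> real (Suc (\<iota> l)) * norm (Im_vec (z \<epsilon>))" by (rule mult_right_mono) auto
      then show "exp (1 * norm (Im_vec (z \<epsilon>))) \<le> exp (real (Suc (\<iota> l)) * norm (Im_vec (z \<epsilon>)))" by simp
    qed auto
    then show "exp (norm (Im_vec (z \<epsilon>))) \<le> \<epsilon> powr - real 0 * (1 + norm (z \<epsilon>))"
      using zl[of l] pos by (simp add: l)
  qed
  \<comment> \<open>The values at \<open>e l\<close> are at most \<open>(e l)\<^sup>l\<close>, and \<open>l\<close> exceeds any given \<open>q\<close> when \<open>e l\<close> is small.\<close>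
  have Q: "negligible_net (\<lambda>\<epsilon>. if \<epsilon> \<in> A then transposed_symbol m c \<epsilon> (z \<epsilon>) else 0)"
    unfolding negligible_net_def
  proof (intro allI bigoI[where c = 1])
    fix q :: nat
    have "\<forall>\<^sub>F \<epsilon> in at_right 0. \<epsilon> \<in> {0<..<e q}"
      by (rule eventually_at_right_real) (use e(1)[of q] in \<open>simp add: good_def\<close>)
    then show "\<forall>\<^sub>F \<epsilon> in at_right 0. norm (norm (if \<epsilon> \<in> A then transposed_symbol m c \<epsilon> (z \<epsilon>) else 0)) \<le> 1 * norm (\<epsilon> powr real q)"
    proof eventually_elim
      case (elim \<epsilon>)
      show ?case
      proof (cases "\<epsilon> \<in> A")
        case True
        then obtain l where l: "\<epsilon> = e l" by (auto simp: A_def)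
        have "q < l"
        proof (rule ccontr)
          assume "\<not> q < l"
          then have "e q \<le> e l" using dec[of l q] by (cases "l = q") auto
          then show False using elim l by simp
        qed
        have "norm (transposed_symbol m c \<epsilon> (z \<epsilon>)) \<le> \<epsilon> powr real l" using e(1)[of l] by (simp add: l good_def z)
        also have "\<dots> \<le> \<epsilon> powr real q"
          using e(1)[of l] \<open>q < l\<close> by (intro powr_mono') (auto simp: good_def l)
        finally show ?thesis using True by simp
      qed simp
    qed
  qed
  obtain V W where V: "open V" "0 \<in> V" and W: "W \<in> \<G> V"
    and T: "\<And>U. U \<in> \<G>_c V \<Longrightarrow> gfunctional_of UNIV (osc_net A z) (gclass UNIV (crep V U)) = embed V W U"
    by (rule hypoelliptic_osc[OF hyp gclass_zero_G[OF open_UNIV] t Q]) blast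
  obtain K where K: "compact K" "K \<subseteq> V" and growth: "\<And>w A' M j p. w \<in> W \<Longrightarrow> A' \<subseteq> A \<Longrightarrow>
      moderate_exponents A' z M \<Longrightarrow>
      (\<And>is. length is \<le> j \<Longrightarrow> bigo_on K p (\<lambda>\<epsilon>. pds is (w \<epsilon>))) \<Longrightarrow>
      \<exists>C. \<forall>\<^sub>F \<epsilon> in at_right 0. \<epsilon> \<in> A' \<longrightarrow> norm (z \<epsilon>) ^ j \<le> C * \<epsilon> powr p * exp (norm (Im_vec (z \<epsilon>)))"
    using osc_growth[OF t V W T] by blast
  obtain N :: nat where N: "\<And>is. length is \<le> 1 \<Longrightarrow> bigo_on K (- real N) (\<lambda>\<epsilon>. pds is (grep W \<epsilon>))"
    using moderate_onD[OF V(1) moderate_on_grep[OF V(1) W] K] by blast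
  \<comment> \<open>The \<open>N\<close>-th zero satisfies \<open>|z| \<ge> \<epsilon>\<^bsup>-N-1\<^esup> e\<^bsup>(N+1)|Im z|\<^esup>\<close> infinitely often, whereas \<open>W\<close> only admits
    \<open>|z| = O(\<epsilon>\<^bsup>-N\<^esup> e\<^bsup>|Im z|\<^esup>)\<close>.\<close>
  define A' where "A' = e ` {l. \<iota> l = N}"
  have zA': "z \<epsilon> = zero_net (Z N) \<epsilon>" if "\<epsilon> \<in> A'" for \<epsilon>
    using that z by (auto simp: A'_def)
  obtain M :: nat where M: "moderate_exponents UNIV (zero_net (Z N)) M" using zero_net_growth[OF lt] by blast
  have mA': "moderate_exponents A' z M"
    using M unfolding moderate_exponents_def by eventually_elim (simp add: zA')
  have "A' \<subseteq> A" by (auto simp: A'_def A_def)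
  from growth[OF grep_in[OF V(1) W] this mA' N] obtain C where C: "\<forall>\<^sub>F \<epsilon> in at_right 0. \<epsilon> \<in> A' \<longrightarrow>
      norm (z \<epsilon>) ^ 1 \<le> C * \<epsilon> powr (- real N) * exp (norm (Im_vec (z \<epsilon>)))" ..
  have "\<forall>\<^sub>F \<epsilon> in at_right 0. 2 * C * \<epsilon> powr (- real N) \<le> \<epsilon> powr (- real (Suc N))"
    by (rule eventually_le_powr) simp
  with C have "\<forall>\<^sub>F \<epsilon> in at_right 0. \<epsilon> \<notin> A'"
    using eventually_unit
  proof eventually_elim
    case (elim \<epsilon>)
    show ?case
    proof
      assume a: "\<epsilon> \<in> A'"
      then obtain l where l: "\<epsilon> = e l" "\<iota> l = N" by (auto simp: A'_def)
      let ?E = "exp (norm (Im_vec (z \<epsilon>)))"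
      have "\<epsilon> powr (- real (Suc N)) * ?E \<le> \<epsilon> powr (- real (Suc N)) * exp (real (Suc N) * norm (Im_vec (z \<epsilon>)))"
        by (intro mult_left_mono) (auto simp: distrib_right)
      also have "\<dots> \<le> norm (z \<epsilon>)" using zl[of l] l by simp
      also have "\<dots> \<le> C * \<epsilon> powr (- real N) * ?E" using elim(1) a by simp
      finally have 1: "\<epsilon> powr (- real (Suc N)) \<le> C * \<epsilon> powr (- real N)" by simp
      moreover have "\<epsilon> powr (- real (Suc N)) > 0" using elim(3) by simp
      ultimately show False using elim(2) by linarith
    qed
  qed
  then obtain \<eta> where \<eta>: "\<eta> \<in> {0<..1}" "\<And>\<epsilon>. \<epsilon> \<in> {0<..\<eta>} \<Longrightarrow> \<epsilon> \<notin> A'" by (rule eventually_at_right_0_obtain) blast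
  obtain n :: nat where n: "1 / real (Suc n) < \<eta>" using \<eta>(1) nat_approx_posE[of \<eta>] by auto
  define l where "l = prod_encode (N, n)"
  have "n \<le> l" unfolding l_def by (rule le_prod_encode_2)
  have "e l < 1 / real (Suc l)" "0 < e l" using e(1)[of l] by (auto simp: good_def)
  moreover have "1 / real (Suc l) \<le> 1 / real (Suc n)" using \<open>n \<le> l\<close> by (simp add: frac_le)
  ultimately have "e l \<in> {0<..\<eta>}" using n by simp
  moreover have "e l \<in> A'" by (simp add: A'_def \<iota>_def l_def)
  ultimately show False using \<eta>(2) by blast
qed

theorem theorem3p9:
  fixes m :: nat and c :: "'n::finite coeffs"
  assumes "\<exists>\<xi>::real^'n. symbol_tilde m c \<xi> dvd 1"
  shows "(hypoelliptic \<G> m c \<longrightarrow>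
            (\<exists>(b::real) (a::real). a > 0 \<and> (\<forall>\<zeta>\<in>log_zeros m c.
               valuation (gnorm (vec_Re \<zeta>)) \<ge> ereal b + valuation (gexp_norm a (vec_Im \<zeta>))))) \<and>
         (hypoelliptic \<G>_inf m c \<longrightarrow>
            (\<forall>\<zeta>\<in>log_zeros m c. valuation (gnorm (vec_Re \<zeta>)) \<ge> 0))"
  using G_hypoelliptic_imp_valuation_Re_ge G_inf_hypoelliptic_imp_valuation_Re_nonneg by blast

end
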